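(* Let $f$ be a polynomial in $n$ noncommuting variables with coefficients in $\mathbb{C}$ such that $f(\mathbb{C})=\{0\}$, and let $K\in\mathbb{N}$. Then there exist a unital $C^*$-algebra $A$ without bounded traces and an element $e\in A$ that is not expressible as a linear combination of $K$ values of $f$ on $A$.
   Context: $f(\mathbb{C})=\{0\}$ means $f(\lambda_1,\dots,\lambda_n)=0$ for all $\lambda_1,\dots,\lambda_n\in\mathbb{C}$. A value of $f$ on $A$ is an element $f(a_1,\dots,a_n)$ with $a_1,\dots,a_n\in A$. A bounded trace on $A$ is a nonzero bounded positive linear functional $\tau$ with $\tau(xy)=\tau(yx)$ for all $x,y\in A$. *)

theory Defs
  imports
    "HOL-Analysis.Analysis"
    "HOL-Algebra.Module"
    "HOL-Library.Poly_Mapping"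
begin

(* The complex numbers as an algebra over themselves; also the scalar field of the
   vector space structure of a C*-algebra. *)
definition complex_alg :: "(complex, complex) module"
  where "complex_alg =
    \<lparr>carrier = UNIV, mult = (*), one = 1, zero = 0, add = (+), smult = (*)\<rparr>"

record 'a cstar = "(complex, 'a) module" +
  star :: "'a \<Rightarrow> 'a"
  cstar_norm :: "'a \<Rightarrow> real"

(* The zero algebra is not excluded, as it is commonly regarded as a unital C*-algebra. *)
locale unital_cstar_algebra =
  A?: ring A + module complex_alg A for A :: "('a, 'm) cstar_scheme" (structure) +
  assumes smult_mult_left: "\<lbrakk>x \<in> carrier A; y \<in> carrier A\<rbrakk> \<Longrightarrow>
      (c \<odot> x) \<otimes> y = c \<odot> (x \<otimes> y)"
    and smult_mult_right: "\<lbrakk>x \<in> carrier A; y \<in> carrier A\<rbrakk> \<Longrightarrow>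
      x \<otimes> (c \<odot> y) = c \<odot> (x \<otimes> y)"
    and star_closed: "x \<in> carrier A \<Longrightarrow> star A x \<in> carrier A"
    and star_star: "x \<in> carrier A \<Longrightarrow> star A (star A x) = x"
    and star_add: "\<lbrakk>x \<in> carrier A; y \<in> carrier A\<rbrakk> \<Longrightarrow>
      star A (x \<oplus> y) = star A x \<oplus> star A y"
    and star_smult: "x \<in> carrier A \<Longrightarrow> star A (c \<odot> x) = cnj c \<odot> star A x"
    and star_mult: "\<lbrakk>x \<in> carrier A; y \<in> carrier A\<rbrakk> \<Longrightarrow>
      star A (x \<otimes> y) = star A y \<otimes> star A x"
    and norm_nonneg: "x \<in> carrier A \<Longrightarrow> 0 \<le> cstar_norm A x"
    and norm_eq_zero: "x \<in> carrier A \<Longrightarrow> cstar_norm A x = 0 \<longleftrightarrow> x = \<zero>"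
    and norm_triangle: "\<lbrakk>x \<in> carrier A; y \<in> carrier A\<rbrakk> \<Longrightarrow>
      cstar_norm A (x \<oplus> y) \<le> cstar_norm A x + cstar_norm A y"
    and norm_smult: "x \<in> carrier A \<Longrightarrow> cstar_norm A (c \<odot> x) = cmod c * cstar_norm A x"
    and norm_mult: "\<lbrakk>x \<in> carrier A; y \<in> carrier A\<rbrakk> \<Longrightarrow>
      cstar_norm A (x \<otimes> y) \<le> cstar_norm A x * cstar_norm A y"
    and complete: "Metric_space.mcomplete (carrier A) (\<lambda>x y. cstar_norm A (x \<ominus> y))"
    and cstar_identity: "x \<in> carrier A \<Longrightarrow>
      cstar_norm A (star A x \<otimes> x) = (cstar_norm A x)\<^sup>2"

(* Only the values of t on the carrier of A matter. *)
definition bounded_trace :: "('a, 'm) cstar_scheme \<Rightarrow> ('a \<Rightarrow> complex) \<Rightarrow> bool"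
  where "bounded_trace A t \<longleftrightarrow>
    (\<forall>x\<in>carrier A. \<forall>y\<in>carrier A. t (x \<oplus>\<^bsub>A\<^esub> y) = t x + t y) \<and>
    (\<forall>c. \<forall>x\<in>carrier A. t (c \<odot>\<^bsub>A\<^esub> x) = c * t x) \<and>
    (\<exists>x\<in>carrier A. t x \<noteq> 0) \<and>
    (\<exists>C. \<forall>x\<in>carrier A. cmod (t x) \<le> C * cstar_norm A x) \<and>
    (\<forall>x\<in>carrier A. t (star A x \<otimes>\<^bsub>A\<^esub> x) \<in> \<real>\<^sub>\<ge>\<^sub>0) \<and>
    (\<forall>x\<in>carrier A. \<forall>y\<in>carrier A. t (x \<otimes>\<^bsub>A\<^esub> y) = t (y \<otimes>\<^bsub>A\<^esub> x))"

(* A noncommutative polynomial is a finitely supported family of complex coefficients indexed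
   by words; the word [i, j, ...] stands for the monomial X_i X_j ... and [] for 1.
   The n variables are X_0, ..., X_(n-1). *)
type_synonym ncpoly = "nat list \<Rightarrow>\<^sub>0 complex"

definition ncpolys :: "nat \<Rightarrow> ncpoly set"
  where "ncpolys n = {f. \<forall>w\<in>Poly_Mapping.keys f. set w \<subseteq> {..<n}}"

definition word_eval :: "('a, 'm) monoid_scheme \<Rightarrow> (nat \<Rightarrow> 'a) \<Rightarrow> nat list \<Rightarrow> 'a"
  where "word_eval A a w = foldr (\<lambda>i x. a i \<otimes>\<^bsub>A\<^esub> x) w \<one>\<^bsub>A\<^esub>"

definition ncpoly_eval :: "(complex, 'a, 'm) module_scheme \<Rightarrow> ncpoly \<Rightarrow> (nat \<Rightarrow> 'a) \<Rightarrow> 'a"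
  where "ncpoly_eval A f a =
    (\<Oplus>\<^bsub>A\<^esub>w\<in>Poly_Mapping.keys f. Poly_Mapping.lookup f w \<odot>\<^bsub>A\<^esub> word_eval A a w)"

definition ncpoly_values :: "(complex, 'a, 'm) module_scheme \<Rightarrow> nat \<Rightarrow> ncpoly \<Rightarrow> 'a set"
  where "ncpoly_values A n f = {ncpoly_eval A f a | a. \<forall>i<n. a i \<in> carrier A}"

(* HOL cannot quantify existentially over types, so the carrier of an existentially quantified
   C*-algebra is a subset of a fixed type. This one has the cardinality of the power set of the
   continuum, so up to isomorphism it accommodates all C*-algebras of at most that cardinality,
   in particular all separable ones and all algebras of operators on a separable Hilbert space. *)
type_synonym ambient = "(nat \<Rightarrow> complex) \<Rightarrow> (nat \<Rightarrow> complex)"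

end

theory Submission
  imports Defs "HOL-Library.Sublist"
begin

text \<open>
  The idea is to find a traceless C*-algebra in which any \<open>n K\<close> elements have approximate joint
  eigenvectors. If \<open>a\<^sub>i \<xi>\<close> is close to \<open>\<mu>\<^sub>i \<xi>\<close> for all \<open>i\<close>, then \<open>f(a) \<xi>\<close> is close to
  \<open>f(\<mu>) \<xi> = 0\<close>, because \<open>f\<close> vanishes on scalars. Hence a linear combination of \<open>K\<close> values of
  \<open>f\<close> is nearly zero on some unit vector, and it cannot be the identity; \<open>e = 1\<close> is the required
  element.

  The algebra. Let \<open>N = n K\<close>, \<open>d = 2 N\<close>, and let the vectors \<open>e\<^sub>y\<close> of an orthonormal basis be indexed
  by the nodes \<open>y\<close> of the infinite binary tree. Given a point \<open>x\<^sub>y\<close> of the unit sphere of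
  \<open>\<real>\<^sup>d\<^sup>+\<^sup>1\<close> at every node, the operators \<open>g\<^sub>i\<^sub>t e\<^sub>y = (x\<^sub>t\<^sub>y)\<^sub>i e\<^sub>t\<^sub>y\<close>, where \<open>ty\<close> is the \<open>t\<close>-th child
  of \<open>y\<close>, satisfy \<open>\<Sum> (g\<^sub>i\<^sub>t\<^sup>* g\<^sub>i\<^sub>t - g\<^sub>i\<^sub>t g\<^sub>i\<^sub>t\<^sup>*) = 1 + p\<close>, where \<open>p\<close> is the projection onto the span of
  the root vector: each node has two outgoing edges but at most one incoming edge. A trace vanishes on
  the left hand side and is nonnegative on \<open>1\<close> and \<open>p\<close>, so it vanishes on \<open>1\<close> and is zero. The
  algebra \<open>\<A>\<close> is generated by the direct sums of the \<open>g\<^sub>i\<^sub>t\<close> over countably many choices of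
  the points \<open>x\<^sub>y\<close>.

  The eigenvectors are the root vectors \<open>\<xi>\<close>. A *-polynomial \<open>b\<close> in the generators maps \<open>\<xi>\<close> to a
  finite combination \<open>\<Sum> F\<^sub>y(x) e\<^sub>y\<close>, and \<open>\<xi>\<close> is nearly an eigenvector of \<open>N\<close> such polynomials if
  their components at the nodes \<open>y\<close> other than the root are nearly zero. Per node these are \<open>N\<close>
  complex and hence \<open>d\<close> real functions, as many as the sphere at \<open>y\<close> has dimensions. Changing the sign
  of \<open>x\<^sub>z\<close> is the same as changing the signs of all \<open>e\<^sub>y\<close> with \<open>y\<close> in the subtree at \<open>z\<close>, so \<open>F\<^sub>y\<close>
  is odd in \<open>x\<^sub>z\<close> for such \<open>y\<close> and even for the others. A Borsuk-Ulam theorem for products of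
  spheres (\<open>common_near_zero\<close>) shows that such functions come simultaneously close to zero.

  The proof of the Borsuk-Ulam theorem is a cup product computation. A function that is odd
  in some of the variables defines a class in the first cohomology, with two-element
  coefficients, of the quotient of the product of spheres by the sign changes: its cocycle records
  the edges on which the function changes sign. The class depends only on the parities, so the cup
  product of all these classes can be computed from one explicit choice of functions, for which it is
  nonzero. Hence it is nonzero for the given functions, and some small simplex carries sign changes of
  all of them. In place of the spheres the proof uses grids in polar coordinates, that is, cubes with
  suitably glued faces (\<open>total_eq\<close>, \<open>total_reference\<close>).
\<close>

section \<open>The Hilbert space of square-summable families\<close>

typedef 'i ell2 = "{x :: 'i \<Rightarrow> complex. (\<lambda>i. (cmod (x i))\<^sup>2) summable_on UNIV}"
  morphisms coord Abs_ell2
  by (intro exI[of _ "\<lambda>_. 0"]) simp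

lemma coord_summable: "(\<lambda>i. (cmod (coord x i))\<^sup>2) summable_on UNIV"
  using coord[of x] by simp

lemma ell2_eqI: "(\<And>i. coord x i = coord y i) \<Longrightarrow> x = y"
  by (simp add: coord_inject[symmetric] fun_eq_iff)

lemma square_summable_product:
  assumes "(\<lambda>i. (cmod (x i))\<^sup>2) summable_on UNIV" "(\<lambda>i. (cmod (y i))\<^sup>2) summable_on UNIV"
  shows "(\<lambda>i. cmod (x i) * cmod (y i)) summable_on UNIV"
proof (rule summable_on_comparison_test)
  show "(\<lambda>i. (cmod (x i))\<^sup>2 + (cmod (y i))\<^sup>2) summable_on UNIV"
    using assms by (rule summable_on_add)
  show "cmod (x i) * cmod (y i) \<le> (cmod (x i))\<^sup>2 + (cmod (y i))\<^sup>2" for i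
    using sum_squares_bound[of "cmod (x i)" "cmod (y i)"] mult_nonneg_nonneg[OF norm_ge_zero norm_ge_zero, of "x i" "y i"]
    by linarith
qed simp

lemma square_summable_add:
  assumes "(\<lambda>i. (cmod (x i))\<^sup>2) summable_on UNIV" "(\<lambda>i. (cmod (y i))\<^sup>2) summable_on UNIV"
  shows "(\<lambda>i. (cmod (x i + y i))\<^sup>2) summable_on UNIV"
proof (rule summable_on_comparison_test)
  show "(\<lambda>i. 2 * (cmod (x i))\<^sup>2 + 2 * (cmod (y i))\<^sup>2) summable_on UNIV"
    using assms by (intro summable_on_add summable_on_cmult_right)
  show "(cmod (x i + y i))\<^sup>2 \<le> 2 * (cmod (x i))\<^sup>2 + 2 * (cmod (y i))\<^sup>2" for i
  proof -
    have "(cmod (x i + y i))\<^sup>2 \<le> (cmod (x i) + cmod (y i))\<^sup>2"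
      by (intro power_mono norm_triangle_ineq) simp
    also have "\<dots> \<le> 2 * (cmod (x i))\<^sup>2 + 2 * (cmod (y i))\<^sup>2"
      using sum_squares_bound[of "cmod (x i)" "cmod (y i)"] by (simp add: power2_sum)
    finally show ?thesis .
  qed
qed simp

lemma square_summable_scale:
  assumes "(\<lambda>i. (cmod (x i))\<^sup>2) summable_on UNIV"
  shows "(\<lambda>i. (cmod (c * x i))\<^sup>2) summable_on UNIV"
  using summable_on_cmult_right[OF assms, of "(cmod c)\<^sup>2"] by (simp add: norm_mult power_mult_distrib)

instantiation ell2 :: (type) real_vector
begin

definition zero_ell2 :: "'a ell2" where "0 = Abs_ell2 (\<lambda>_. 0)"
definition plus_ell2 :: "'a ell2 \<Rightarrow> 'a ell2 \<Rightarrow> 'a ell2" where "x + y = Abs_ell2 (\<lambda>i. coord x i + coord y i)"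
definition uminus_ell2 :: "'a ell2 \<Rightarrow> 'a ell2" where "- x = Abs_ell2 (\<lambda>i. - coord x i)"
definition minus_ell2 :: "'a ell2 \<Rightarrow> 'a ell2 \<Rightarrow> 'a ell2" where "x - y = Abs_ell2 (\<lambda>i. coord x i - coord y i)"
definition scaleR_ell2 :: "real \<Rightarrow> 'a ell2 \<Rightarrow> 'a ell2" where "r *\<^sub>R x = Abs_ell2 (\<lambda>i. r *\<^sub>R coord x i)"

lemma coord_0 [simp]: "coord 0 i = 0"
  by (simp add: zero_ell2_def Abs_ell2_inverse)

lemma coord_add [simp]: "coord (x + y) i = coord x i + coord y i"
  using square_summable_add[OF coord_summable coord_summable, of x y]
  by (simp add: plus_ell2_def Abs_ell2_inverse)

lemma coord_uminus [simp]: "coord (- x) i = - coord x i"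
  using coord_summable[of x] by (simp add: uminus_ell2_def Abs_ell2_inverse)

lemma coord_diff [simp]: "coord (x - y) i = coord x i - coord y i"
proof -
  have "(\<lambda>i. (cmod (coord x i - coord y i))\<^sup>2) summable_on UNIV"
    using square_summable_add[OF coord_summable coord_summable, of x "- y"] by simp
  then show ?thesis by (simp add: minus_ell2_def Abs_ell2_inverse)
qed

lemma coord_scaleR [simp]: "coord (r *\<^sub>R x) i = r *\<^sub>R coord x i"
  using square_summable_scale[OF coord_summable, of "of_real r" x]
  by (simp add: scaleR_ell2_def Abs_ell2_inverse scaleR_conv_of_real)

instance
  by standard (rule ell2_eqI, simp add: algebra_simps)+

end

lemma inner_summable: "(\<lambda>i. Re (coord x i * cnj (coord y i))) summable_on UNIV"
proof -
  have "(\<lambda>i. norm (Re (coord x i * cnj (coord y i)))) summable_on UNIV"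
  proof (rule summable_on_comparison_test)
    show "(\<lambda>i. cmod (coord x i) * cmod (coord y i)) summable_on UNIV"
      by (rule square_summable_product[OF coord_summable coord_summable])
    show "norm (Re (coord x i * cnj (coord y i))) \<le> cmod (coord x i) * cmod (coord y i)" for i
      using abs_Re_le_cmod[of "coord x i * cnj (coord y i)"] by (simp add: norm_mult)
  qed simp
  then show ?thesis by (rule abs_summable_summable)
qed

instantiation ell2 :: (type) real_inner
begin

definition inner_ell2 :: "'a ell2 \<Rightarrow> 'a ell2 \<Rightarrow> real"
  where "inner_ell2 x y = (\<Sum>\<^sub>\<infinity>i. Re (coord x i * cnj (coord y i)))"
definition norm_ell2 :: "'a ell2 \<Rightarrow> real"
  where "norm_ell2 x = sqrt (inner x x)"
definition sgn_ell2 :: "'a ell2 \<Rightarrow> 'a ell2"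
  where "sgn_ell2 x = x /\<^sub>R norm x"
definition dist_ell2 :: "'a ell2 \<Rightarrow> 'a ell2 \<Rightarrow> real"
  where "dist_ell2 x y = norm (x - y)"
definition uniformity_ell2 :: "('a ell2 \<times> 'a ell2) filter"
  where "uniformity_ell2 = (INF e\<in>{0<..}. principal {(x, y :: 'a ell2). dist x y < e})"
definition open_ell2 :: "'a ell2 set \<Rightarrow> bool"
  where "open_ell2 U \<longleftrightarrow> (\<forall>x\<in>U. eventually (\<lambda>(x', y). x' = x \<longrightarrow> y \<in> U) uniformity)"

lemma inner_self: "inner x x = (\<Sum>\<^sub>\<infinity>i. (cmod (coord x i))\<^sup>2)"
proof -
  have "Re (coord x i * cnj (coord x i)) = (cmod (coord x i))\<^sup>2" for i
    unfolding cmod_power2 by (simp add: power2_eq_square)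
  then show ?thesis by (simp only: inner_ell2_def)
qed

instance
proof
  fix x y z :: "'a ell2" and r s :: real
  show "inner x y = inner y x"
    unfolding inner_ell2_def by (rule infsum_cong) simp
  show "inner (x + y) z = inner x z + inner y z"
    unfolding inner_ell2_def
    by (simp only: infsum_add[OF inner_summable inner_summable, symmetric] coord_add distrib_right plus_complex.sel)
  show "inner (r *\<^sub>R x) y = r * inner x y"
    unfolding inner_ell2_def
    by (subst infsum_cmult_right'[symmetric], rule infsum_cong) (simp add: right_diff_distrib distrib_left)
  show "0 \<le> inner x x"
    unfolding inner_self by (rule infsum_nonneg) simp
  show "inner x x = 0 \<longleftrightarrow> x = 0"
  proof
    assume "inner x x = 0"
    then have "(cmod (coord x i))\<^sup>2 = 0" for i
      unfolding inner_self using nonneg_infsum_le_0D[OF _ coord_summable, of x] by simp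
    then show "x = 0" by (auto intro!: ell2_eqI)
  next
    assume "x = 0"
    then show "inner x x = 0" by (simp add: inner_self)
  qed
qed (simp_all add: norm_ell2_def sgn_ell2_def dist_ell2_def uniformity_ell2_def open_ell2_def)

end

lemma norm_square_ell2: "(norm x)\<^sup>2 = (\<Sum>\<^sub>\<infinity>i. (cmod (coord x i))\<^sup>2)"
  by (simp add: power2_norm_eq_inner inner_self)

lemma sum_coord_le_norm: "finite F \<Longrightarrow> (\<Sum>i\<in>F. (cmod (coord x i))\<^sup>2) \<le> (norm x)\<^sup>2"
  unfolding norm_square_ell2 by (rule finite_sum_le_infsum[OF coord_summable]) simp_all

text \<open>Bounds on finite partial sums give summability and the norm bound at once; all operators
  below are constructed through this criterion.\<close>

lemma ell2_bounded:
  assumes "\<And>F. finite F \<Longrightarrow> (\<Sum>i\<in>F. (cmod (f i))\<^sup>2) \<le> B\<^sup>2" "0 \<le> B"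
  shows "(\<lambda>i. (cmod (f i))\<^sup>2) summable_on UNIV" "norm (Abs_ell2 f) \<le> B"
proof -
  show s: "(\<lambda>i. (cmod (f i))\<^sup>2) summable_on UNIV"
  proof (rule nonneg_bdd_above_summable_on)
    show "bdd_above (sum (\<lambda>i. (cmod (f i))\<^sup>2) ` {F. F \<subseteq> UNIV \<and> finite F})"
      using assms(1) by (intro bdd_aboveI2[where M = "B\<^sup>2"]) simp
  qed simp
  have "(norm (Abs_ell2 f))\<^sup>2 \<le> B\<^sup>2"
    unfolding norm_square_ell2
    by (rule infsum_le_finite_sums) (use s assms(1) in \<open>simp_all add: Abs_ell2_inverse\<close>)
  then show "norm (Abs_ell2 f) \<le> B"
    using assms(2) by (rule power2_le_imp_le)
qed

lemma coord_Abs: "(\<lambda>i. (cmod (f i))\<^sup>2) summable_on UNIV \<Longrightarrow> coord (Abs_ell2 f) = f"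
  by (simp add: Abs_ell2_inverse)

lemma cmod_coord_le_norm: "cmod (coord x i) \<le> norm x"
  using sum_coord_le_norm[of "{i}" x] power2_le_imp_le[of "cmod (coord x i)" "norm x"] by simp

instance ell2 :: (type) complete_space
proof
  fix X :: "nat \<Rightarrow> 'a ell2"
  assume X: "Cauchy X"
  have "Cauchy (\<lambda>n. coord (X n) i)" for i
  proof (rule metric_CauchyI)
    fix e :: real
    assume "0 < e"
    then obtain M where M: "\<And>m n. m \<ge> M \<Longrightarrow> n \<ge> M \<Longrightarrow> dist (X m) (X n) < e"
      using metric_CauchyD[OF X] by blast
    have "dist (coord (X m) i) (coord (X n) i) < e" if "m \<ge> M" "n \<ge> M" for m n
      using M[OF that] cmod_coord_le_norm[of "X m - X n" i] by (simp add: dist_norm)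
    then show "\<exists>M. \<forall>m\<ge>M. \<forall>n\<ge>M. dist (coord (X m) i) (coord (X n) i) < e"
      by blast
  qed
  then have "\<exists>l. (\<lambda>n. coord (X n) i) \<longlonglongrightarrow> l" for i
    by (simp add: Cauchy_convergent_iff convergent_def)
  then obtain l where l: "\<And>i. (\<lambda>n. coord (X n) i) \<longlonglongrightarrow> l i"
    by metis
  have near: "\<exists>M. \<forall>n\<ge>M. (\<lambda>i. (cmod (coord (X n) i - l i))\<^sup>2) summable_on UNIV \<and>
      norm (Abs_ell2 (\<lambda>i. coord (X n) i - l i)) \<le> e" if e: "0 < e" for e
  proof -
    obtain M where M: "\<And>m n. m \<ge> M \<Longrightarrow> n \<ge> M \<Longrightarrow> dist (X m) (X n) < e"
      using metric_CauchyD[OF X e] by blast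
    have "(\<Sum>i\<in>F. (cmod (coord (X n) i - l i))\<^sup>2) \<le> e\<^sup>2" if "n \<ge> M" "finite F" for n F
    proof (rule tendsto_upperbound)
      show "(\<lambda>m. \<Sum>i\<in>F. (cmod (coord (X n) i - coord (X m) i))\<^sup>2) \<longlonglongrightarrow> (\<Sum>i\<in>F. (cmod (coord (X n) i - l i))\<^sup>2)"
        by (intro tendsto_intros l)
      show "\<forall>\<^sub>F m in sequentially. (\<Sum>i\<in>F. (cmod (coord (X n) i - coord (X m) i))\<^sup>2) \<le> e\<^sup>2"
        unfolding eventually_sequentially
      proof (intro exI allI impI)
        fix m assume "M \<le> m"
        then have "norm (X n - X m) \<le> e"
          using M[OF \<open>n \<ge> M\<close>] by (simp add: dist_norm less_imp_le)
        then have "(norm (X n - X m))\<^sup>2 \<le> e\<^sup>2"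
          by (intro power_mono) auto
        then show "(\<Sum>i\<in>F. (cmod (coord (X n) i - coord (X m) i))\<^sup>2) \<le> e\<^sup>2"
          using sum_coord_le_norm[OF \<open>finite F\<close>, of "X n - X m"] by simp
      qed
    qed simp
    then have "(\<lambda>i. (cmod (coord (X n) i - l i))\<^sup>2) summable_on UNIV"
        "norm (Abs_ell2 (\<lambda>i. coord (X n) i - l i)) \<le> e" if "n \<ge> M" for n
      using ell2_bounded[of "\<lambda>i. coord (X n) i - l i" e, OF _ less_imp_le[OF e]] that by blast+
    then show ?thesis by blast
  qed
  obtain M where "(\<lambda>i. (cmod (coord (X M) i - l i))\<^sup>2) summable_on UNIV"
    using near[of 1] by auto
  then have "(\<lambda>i. (cmod (coord (X M) i + (- 1) * (coord (X M) i - l i)))\<^sup>2) summable_on UNIV"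
    by (rule square_summable_add[OF coord_summable square_summable_scale])
  then have ls: "coord (Abs_ell2 l) = l"
    by (simp add: coord_Abs)
  have "X \<longlonglongrightarrow> Abs_ell2 l"
  proof (rule metric_LIMSEQ_I)
    fix e :: real
    assume "0 < e"
    then obtain M where M: "\<And>n. n \<ge> M \<Longrightarrow> (\<lambda>i. (cmod (coord (X n) i - l i))\<^sup>2) summable_on UNIV \<and>
      norm (Abs_ell2 (\<lambda>i. coord (X n) i - l i)) \<le> e / 2"
      using near[of "e / 2"] by auto
    have "dist (X n) (Abs_ell2 l) < e" if "n \<ge> M" for n
    proof -
      have "X n - Abs_ell2 l = Abs_ell2 (\<lambda>i. coord (X n) i - l i)"
        using M[OF that] by (auto intro!: ell2_eqI simp: coord_Abs ls)
      then show ?thesis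
        using M[OF that] \<open>0 < e\<close> by (simp add: dist_norm)
    qed
    then show "\<exists>no. \<forall>n\<ge>no. dist (X n) (Abs_ell2 l) < e" by blast
  qed
  then show "convergent X" by (auto simp: convergent_def)
qed

instance ell2 :: (type) banach ..

section \<open>Weighted shifts and adjoints\<close>

definition admissible :: "('i \<Rightarrow> complex) \<Rightarrow> ('i \<Rightarrow> 'i) \<Rightarrow> bool"
  where "admissible a \<phi> \<longleftrightarrow> inj_on \<phi> {j. a j \<noteq> 0} \<and> (\<exists>B. \<forall>j. cmod (a j) \<le> B)"

text \<open>Compositions with partial injections, followed by multiplication with a weight. Scalars, the
  generators and their adjoints all have this form, so boundedness and adjoints need to be treated only
  once.\<close>

definition weighted_shift :: "('i \<Rightarrow> complex) \<Rightarrow> ('i \<Rightarrow> 'i) \<Rightarrow> 'i ell2 \<Rightarrow>\<^sub>L 'i ell2"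
  where "weighted_shift a \<phi> = Blinfun (\<lambda>x. Abs_ell2 (\<lambda>j. a j * coord x (\<phi> j)))"

lemma weighted_shift_bound:
  assumes "inj_on \<phi> {j. a j \<noteq> 0}" "\<And>j. cmod (a j) \<le> B"
  shows "(\<lambda>j. (cmod (a j * coord x (\<phi> j)))\<^sup>2) summable_on UNIV"
    "norm (Abs_ell2 (\<lambda>j. a j * coord x (\<phi> j))) \<le> B * norm x"
proof -
  have B: "0 \<le> B" using assms(2) norm_ge_zero order_trans by blast
  have *: "(\<Sum>j\<in>F. (cmod (a j * coord x (\<phi> j)))\<^sup>2) \<le> (B * norm x)\<^sup>2" if F: "finite F" for F
  proof -
    let ?F = "{j\<in>F. a j \<noteq> 0}"
    have "(\<Sum>j\<in>F. (cmod (a j * coord x (\<phi> j)))\<^sup>2) = (\<Sum>j\<in>?F. (cmod (a j * coord x (\<phi> j)))\<^sup>2)"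
      using F by (intro sum.mono_neutral_right) auto
    also have "\<dots> \<le> (\<Sum>j\<in>?F. B\<^sup>2 * (cmod (coord x (\<phi> j)))\<^sup>2)"
      by (rule sum_mono) (simp add: norm_mult power_mult_distrib mult_right_mono power_mono assms(2))
    also have "\<dots> = B\<^sup>2 * (\<Sum>j\<in>?F. (cmod (coord x (\<phi> j)))\<^sup>2)"
      by (simp add: sum_distrib_left)
    also have "(\<Sum>j\<in>?F. (cmod (coord x (\<phi> j)))\<^sup>2) = (\<Sum>i\<in>\<phi> ` ?F. (cmod (coord x i))\<^sup>2)"
      using assms(1) by (subst sum.reindex) (auto intro: inj_on_subset)
    also have "B\<^sup>2 * \<dots> \<le> B\<^sup>2 * (norm x)\<^sup>2"
      using F by (intro mult_left_mono sum_coord_le_norm) auto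
    finally show ?thesis by (simp add: power_mult_distrib)
  qed
  show "(\<lambda>j. (cmod (a j * coord x (\<phi> j)))\<^sup>2) summable_on UNIV"
      "norm (Abs_ell2 (\<lambda>j. a j * coord x (\<phi> j))) \<le> B * norm x"
    using ell2_bounded[of "\<lambda>j. a j * coord x (\<phi> j)" "B * norm x", OF *] B by simp_all
qed

lemma coord_weighted_shift:
  assumes "admissible a \<phi>"
  shows "coord (weighted_shift a \<phi> x) j = a j * coord x (\<phi> j)"
proof -
  obtain B where inj: "inj_on \<phi> {j. a j \<noteq> 0}" and B: "\<And>j. cmod (a j) \<le> B"
    using assms by (auto simp: admissible_def)
  note b = weighted_shift_bound[of \<phi> a B, OF inj B]
  have "bounded_linear (\<lambda>x. Abs_ell2 (\<lambda>j. a j * coord x (\<phi> j)))"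
  proof (rule bounded_linear_intro)
    show "Abs_ell2 (\<lambda>j. a j * coord (x + y) (\<phi> j)) = Abs_ell2 (\<lambda>j. a j * coord x (\<phi> j)) + Abs_ell2 (\<lambda>j. a j * coord y (\<phi> j))" for x y
      using b(1)[of x] b(1)[of y] b(1)[of "x + y"] by (intro ell2_eqI) (simp add: coord_Abs distrib_left)
    show "Abs_ell2 (\<lambda>j. a j * coord (r *\<^sub>R x) (\<phi> j)) = r *\<^sub>R Abs_ell2 (\<lambda>j. a j * coord x (\<phi> j))" for r x
      using b(1)[of x] b(1)[of "r *\<^sub>R x"] by (intro ell2_eqI) (simp add: coord_Abs)
    show "norm (Abs_ell2 (\<lambda>j. a j * coord x (\<phi> j))) \<le> norm x * B" for x
      using b(2)[of x] by (simp add: mult.commute)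
  qed
  then show ?thesis
    using b(1)[of x] by (simp add: weighted_shift_def bounded_linear_Blinfun_apply coord_Abs)
qed

text \<open>The inner product is the real part of the complex one. For complex linear operators adjoints
  with respect to the two coincide; for scalars this gives the complex conjugate.\<close>

definition is_adj :: "('i ell2 \<Rightarrow>\<^sub>L 'i ell2) \<Rightarrow> ('i ell2 \<Rightarrow>\<^sub>L 'i ell2) \<Rightarrow> bool"
  where "is_adj T S \<longleftrightarrow> (\<forall>x y. inner (T x) y = inner x (S y))"

lemma is_adj_weighted_shift:
  assumes adm: "admissible a \<phi>" "admissible b \<psi>"
    and ab: "\<And>j. a j \<noteq> 0 \<Longrightarrow> \<psi> (\<phi> j) = j \<and> b (\<phi> j) = cnj (a j)"
    and ba: "\<And>j. b j \<noteq> 0 \<Longrightarrow> \<phi> (\<psi> j) = j \<and> a (\<psi> j) = cnj (b j)"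
  shows "is_adj (weighted_shift a \<phi>) (weighted_shift b \<psi>)"
  unfolding is_adj_def
proof (intro allI)
  fix x y
  let ?f = "\<lambda>k. Re (coord x k * cnj (b k * coord y (\<psi> k)))"
  have "inner (weighted_shift a \<phi> x) y = (\<Sum>\<^sub>\<infinity>j. Re (a j * coord x (\<phi> j) * cnj (coord y j)))"
    by (simp only: inner_ell2_def coord_weighted_shift[OF adm(1)])
  also have "\<dots> = (\<Sum>\<^sub>\<infinity>j\<in>{j. a j \<noteq> 0}. ?f (\<phi> j))"
  proof (rule infsum_cong_neutral)
    fix j assume "j \<in> UNIV \<inter> {j. a j \<noteq> 0}"
    then have "a j \<noteq> 0" by simp
    then show "Re (a j * coord x (\<phi> j) * cnj (coord y j)) = ?f (\<phi> j)"
      using ab[of j] by (simp add: algebra_simps)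
  qed simp_all
  also have "\<dots> = (\<Sum>\<^sub>\<infinity>k\<in>{k. b k \<noteq> 0}. ?f k)"
  proof (rule infsum_reindex_bij_betw[of \<phi>])
    show "bij_betw \<phi> {j. a j \<noteq> 0} {k. b k \<noteq> 0}"
      using ab ba by (intro bij_betw_byWitness[where f' = \<psi>]) auto
  qed
  also have "\<dots> = (\<Sum>\<^sub>\<infinity>k. ?f k)"
    by (rule infsum_cong_neutral) auto
  also have "\<dots> = inner x (weighted_shift b \<psi> y)"
    by (simp only: inner_ell2_def coord_weighted_shift[OF adm(2)])
  finally show "inner (weighted_shift a \<phi> x) y = inner x (weighted_shift b \<psi> y)" .
qed

definition scale :: "complex \<Rightarrow> 'i ell2 \<Rightarrow>\<^sub>L 'i ell2"
  where "scale c = weighted_shift (\<lambda>_. c) (\<lambda>j. j)"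

lemma coord_scale [simp]: "coord (scale c x) j = c * coord x j"
  unfolding scale_def by (rule coord_weighted_shift) (auto simp: admissible_def inj_on_def)

lemma is_adj_scale: "is_adj (scale c) (scale (cnj c))"
  unfolding scale_def by (rule is_adj_weighted_shift) (auto simp: admissible_def inj_on_def)

lemma norm_scale: "norm (scale c x) = cmod c * norm x"
proof -
  have "(norm (scale c x))\<^sup>2 = (\<Sum>\<^sub>\<infinity>i. (cmod c)\<^sup>2 * (cmod (coord x i))\<^sup>2)"
    by (simp add: norm_square_ell2 norm_mult power_mult_distrib)
  also have "\<dots> = (cmod c * norm x)\<^sup>2"
    by (simp add: infsum_cmult_right' power_mult_distrib norm_square_ell2)
  finally show ?thesis
    by (rule power2_eq_imp_eq) auto
qed

lemma norm_scale_compose_le: "norm (scale c o\<^sub>L T) \<le> cmod c * norm T" for T :: "'a ell2 \<Rightarrow>\<^sub>L 'b ell2"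
proof (rule norm_blinfun_bound)
  show "norm ((scale c o\<^sub>L T) x) \<le> cmod c * norm T * norm x" for x
    using mult_left_mono[OF norm_blinfun[of T x], of "cmod c"] by (simp add: norm_scale mult.assoc)
qed simp

lemma norm_scale_compose: "norm (scale c o\<^sub>L T) = cmod c * norm T" for T :: "'a ell2 \<Rightarrow>\<^sub>L 'b ell2"
proof (rule antisym[OF norm_scale_compose_le])
  show "cmod c * norm T \<le> norm (scale c o\<^sub>L T)"
  proof (cases "c = 0")
    case False
    have "T = scale (inverse c) o\<^sub>L (scale c o\<^sub>L T)"
      using False by (intro blinfun_eqI ell2_eqI) simp
    then have "norm T \<le> cmod (inverse c) * norm (scale c o\<^sub>L T)"
      using norm_scale_compose_le[of "inverse c" "scale c o\<^sub>L T"] by simp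
    then show ?thesis
      using False by (simp add: norm_divide field_simps)
  qed simp
qed

lemma is_adj_sym: "is_adj T S \<Longrightarrow> is_adj S T"
  unfolding is_adj_def by (simp add: inner_commute)

lemma is_adj_unique: "is_adj T S \<Longrightarrow> is_adj T S' \<Longrightarrow> S = S'"
proof (rule blinfun_eqI)
  fix y
  assume "is_adj T S" "is_adj T S'"
  then have "\<forall>x. inner x (S y) = inner x (S' y)" by (simp add: is_adj_def)
  then show "S y = S' y" by (simp only: vector_eq_ldot)
qed

lemma is_adj_compose: "is_adj T T' \<Longrightarrow> is_adj S S' \<Longrightarrow> is_adj (T o\<^sub>L S) (S' o\<^sub>L T')"
  by (simp add: is_adj_def)

lemma is_adj_add: "is_adj T T' \<Longrightarrow> is_adj S S' \<Longrightarrow> is_adj (T + S) (T' + S')"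
  by (simp add: is_adj_def blinfun.add_left inner_add_left inner_add_right)

lemma is_adj_0: "is_adj 0 0"
  by (simp add: is_adj_def)

lemma is_adj_id: "is_adj id_blinfun id_blinfun"
  by (simp add: is_adj_def)

lemma norm_adj_le: "is_adj T S \<Longrightarrow> norm S \<le> norm T"
proof -
  assume adj: "is_adj T S"
  show ?thesis
  proof (rule norm_blinfun_bound)
    fix y
    have "(norm (S y))\<^sup>2 = inner (T (S y)) y"
      using adj by (simp add: is_adj_def power2_norm_eq_inner)
    also have "\<dots> \<le> norm (T (S y)) * norm y"
      by (rule norm_cauchy_schwarz)
    also have "\<dots> \<le> norm T * norm (S y) * norm y"
      by (intro mult_right_mono norm_blinfun) auto
    finally have "norm (S y) * norm (S y) \<le> (norm T * norm y) * norm (S y)"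
      by (simp add: power2_eq_square mult_ac)
    then show "norm (S y) \<le> norm T * norm y"
      by (cases "norm (S y) = 0") (auto simp: mult_le_cancel_right)
  qed simp
qed

lemma norm_adj: "is_adj T S \<Longrightarrow> norm S = norm T"
  using norm_adj_le[of T S] norm_adj_le[of S T] is_adj_sym[of T S] by simp

text \<open>The C*-identity: the square of \<open>norm (T x)\<close> is \<open>inner x (S (T x))\<close>,
  and \<open>S\<close> has the same norm as \<open>T\<close>.\<close>

lemma norm_adj_compose:
  assumes "is_adj T S"
  shows "norm (S o\<^sub>L T) = (norm T)\<^sup>2"
proof (rule antisym)
  show "norm (S o\<^sub>L T) \<le> (norm T)\<^sup>2"
    using norm_blinfun_compose[of S T] norm_adj[OF assms] by (simp add: power2_eq_square)
  have "norm T \<le> sqrt (norm (S o\<^sub>L T))"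
  proof (rule norm_blinfun_bound)
    fix x
    have "(norm (T x))\<^sup>2 = inner x (S (T x))"
      using assms by (simp add: is_adj_def power2_norm_eq_inner)
    also have "\<dots> \<le> norm x * norm (S (T x))"
      by (rule norm_cauchy_schwarz)
    also have "\<dots> \<le> norm x * (norm (S o\<^sub>L T) * norm x)"
      using norm_blinfun[of "S o\<^sub>L T" x] by (intro mult_left_mono) auto
    finally have "(norm (T x))\<^sup>2 \<le> (sqrt (norm (S o\<^sub>L T)) * norm x)\<^sup>2"
      by (simp add: power_mult_distrib power2_eq_square mult_ac)
    then show "norm (T x) \<le> sqrt (norm (S o\<^sub>L T)) * norm x"
      by (rule power2_le_imp_le) simp
  qed simp
  then show "(norm T)\<^sup>2 \<le> norm (S o\<^sub>L T)"
    using power_mono[of "norm T" "sqrt (norm (S o\<^sub>L T))" 2] by simp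
qed

definition ket :: "'i \<Rightarrow> 'i ell2"
  where "ket j = Abs_ell2 (\<lambda>i. if i = j then 1 else 0)"

lemma coord_ket [simp]: "coord (ket j) i = (if i = j then 1 else 0)"
proof -
  have sq: "(cmod (if i = j then 1 else 0))\<^sup>2 = (if i = j then 1 else 0)" for i
    by simp
  have "(\<lambda>i. (cmod (if i = j then 1 else 0))\<^sup>2) summable_on UNIV"
  proof (rule ell2_bounded(1)[of _ 1])
    show "(\<Sum>i\<in>F. (cmod (if i = j then 1 else 0))\<^sup>2) \<le> 1\<^sup>2" if "finite F" for F
      unfolding sq using that by simp
  qed simp
  then show ?thesis by (simp add: ket_def coord_Abs)
qed

lemma norm_ket [simp]: "norm (ket j) = 1"
proof -
  have "(norm (ket j))\<^sup>2 = (\<Sum>\<^sub>\<infinity>i\<in>{j}. (cmod (coord (ket j) i))\<^sup>2)"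
    unfolding norm_square_ell2 by (rule infsum_cong_neutral) simp_all
  then have "(norm (ket j))\<^sup>2 = 1\<^sup>2" by simp
  then show ?thesis by (rule power2_eq_imp_eq) simp_all
qed

section \<open>Operators on a binary tree\<close>

text \<open>A letter \<open>Up i t\<close> stands for the generator \<open>g\<^sub>i\<^sub>t\<close>, and
  \<open>Down i t\<close> for its adjoint.\<close>

datatype letter = Up nat bool | Down nat bool

fun flip_letter :: "letter \<Rightarrow> letter" where
  "flip_letter (Up i t) = Down i t"
| "flip_letter (Down i t) = Up i t"

text \<open>A word in the letters maps the root vector to a multiple of a basis vector. The node of this
  vector does not depend on the points on the spheres; the factor is a monomial in their coordinates. Words
  act from right to left, and the child \<open>t\<close> of the node \<open>y\<close> is \<open>t #
  y\<close>.\<close>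

fun endpoint :: "letter list \<Rightarrow> bool list" where
  "endpoint [] = []"
| "endpoint (Up i t # u) = t # endpoint u"
| "endpoint (Down i t # u) = tl (endpoint u)"

fun amplitude :: "(bool list \<Rightarrow> nat \<Rightarrow> real) \<Rightarrow> letter list \<Rightarrow> real" where
  "amplitude x [] = 1"
| "amplitude x (Up i t # u) = x (t # endpoint u) i * amplitude x u"
| "amplitude x (Down i t # u) =
    (if endpoint u \<noteq> [] \<and> hd (endpoint u) = t then x (endpoint u) i * amplitude x u else 0)"

text \<open>The index \<open>\<rho>\<close> ranges over the summands of a direct sum of tree
  representations. There are generators for all indices \<open>i\<close>, also above \<open>d\<close>, so
  all coordinates have to be bounded.\<close>

locale tree_rep =
  fixes X :: "'r \<Rightarrow> bool list \<Rightarrow> nat \<Rightarrow> real" and d :: nat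
  assumes bounded: "\<bar>X \<rho> y i\<bar> \<le> 1" and unit: "(\<Sum>i\<le>d. (X \<rho> y i)\<^sup>2) = 1"
begin

fun letter_op :: "letter \<Rightarrow> ('r \<times> bool list) ell2 \<Rightarrow>\<^sub>L ('r \<times> bool list) ell2" where
  "letter_op (Up i t) =
    weighted_shift (\<lambda>(\<rho>, y). if y \<noteq> [] \<and> hd y = t then of_real (X \<rho> y i) else 0) (\<lambda>(\<rho>, y). (\<rho>, tl y))"
| "letter_op (Down i t) = weighted_shift (\<lambda>(\<rho>, y). of_real (X \<rho> (t # y) i)) (\<lambda>(\<rho>, y). (\<rho>, t # y))"

lemma admissible_up:
  "admissible (\<lambda>(\<rho>, y). if y \<noteq> [] \<and> hd y = t then of_real (X \<rho> y i) else 0) (\<lambda>(\<rho>, y). (\<rho>, tl y))"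
  unfolding admissible_def
proof (intro conjI exI allI)
  show "inj_on (\<lambda>(\<rho>, y). (\<rho>, tl y))
      {j. (case j of (\<rho>, y) \<Rightarrow> if y \<noteq> [] \<and> hd y = t then complex_of_real (X \<rho> y i) else 0) \<noteq> 0}"
    by (auto simp: inj_on_def split: if_splits intro: list.expand)
  show "cmod (case j of (\<rho>, y) \<Rightarrow> if y \<noteq> [] \<and> hd y = t then of_real (X \<rho> y i) else 0) \<le> 1" for j
    using bounded by (cases j) simp
qed

lemma admissible_down:
  "admissible (\<lambda>(\<rho>, y). of_real (X \<rho> (t # y) i)) (\<lambda>(\<rho>, y). (\<rho>, t # y))"
  unfolding admissible_def
proof (intro conjI exI allI)
  show "cmod (case j of (\<rho>, y) \<Rightarrow> of_real (X \<rho> (t # y) i)) \<le> 1" for j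
    using bounded by (cases j) simp
qed (auto simp: inj_on_def)

lemma coord_up: "coord (letter_op (Up i t) v) (\<rho>, y) =
    (if y \<noteq> [] \<and> hd y = t then of_real (X \<rho> y i) * coord v (\<rho>, tl y) else 0)"
  by (simp add: coord_weighted_shift[OF admissible_up])

lemma coord_down: "coord (letter_op (Down i t) v) (\<rho>, y) = of_real (X \<rho> (t # y) i) * coord v (\<rho>, t # y)"
  by (simp add: coord_weighted_shift[OF admissible_down])

lemma is_adj_up_down: "is_adj (letter_op (Up i t)) (letter_op (Down i t))"
  unfolding letter_op.simps
  by (rule is_adj_weighted_shift[OF admissible_up admissible_down]) (auto simp: neq_Nil_conv split: if_splits)

lemma is_adj_letter: "is_adj (letter_op l) (letter_op (flip_letter l))"
  by (cases l) (auto simp only: flip_letter.simps intro: is_adj_up_down is_adj_sym[OF is_adj_up_down])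

lemma letter_op_scale: "letter_op l o\<^sub>L scale c = scale c o\<^sub>L letter_op l"
  by (intro blinfun_eqI ell2_eqI, cases l)
    (auto simp: coord_up coord_down simp del: letter_op.simps)

definition word_op :: "letter list \<Rightarrow> ('r \<times> bool list) ell2 \<Rightarrow>\<^sub>L ('r \<times> bool list) ell2"
  where "word_op u = foldr (\<lambda>l T. letter_op l o\<^sub>L T) u id_blinfun"

lemma word_op_Nil [simp]: "word_op [] = id_blinfun"
  and word_op_Cons [simp]: "word_op (l # u) = letter_op l o\<^sub>L word_op u"
  by (simp_all add: word_op_def)

lemma word_op_append: "word_op (u @ w) = word_op u o\<^sub>L word_op w"
  by (induction u) (auto intro: blinfun_eqI)

lemma is_adj_word: "is_adj (word_op u) (word_op (rev (map flip_letter u)))"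
proof (induction u)
  case (Cons l u)
  then have "is_adj (letter_op l o\<^sub>L word_op u) (word_op (rev (map flip_letter u)) o\<^sub>L letter_op (flip_letter l))"
    by (intro is_adj_compose is_adj_letter)
  moreover have "letter_op (flip_letter l) o\<^sub>L id_blinfun = letter_op (flip_letter l)"
    by (rule blinfun_eqI) simp
  ultimately show ?case by (simp add: word_op_append)
qed (simp add: is_adj_id)

lemma word_op_scale: "word_op u o\<^sub>L scale c = scale c o\<^sub>L word_op u"
proof (induction u)
  case (Cons l u)
  show ?case
  proof (rule blinfun_eqI)
    fix v
    have 1: "word_op u (scale c v) = scale c (word_op u v)"
      using arg_cong[OF Cons.IH, of "\<lambda>T. T v"] by simp
    have 2: "letter_op l (scale c w) = scale c (letter_op l w)" for w
      using arg_cong[OF letter_op_scale[of l c], of "\<lambda>T. T w"] by simp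
    show "(word_op (l # u) o\<^sub>L scale c) v = (scale c o\<^sub>L word_op (l # u)) v"
      by (simp add: 1 2)
  qed
qed (auto intro: blinfun_eqI)

lemma word_op_root:
  "word_op u (ket (\<rho>, [])) = scale (of_real (amplitude (X \<rho>) u)) (ket (\<rho>, endpoint u))"
proof (induction u)
  case Nil
  show ?case by (rule ell2_eqI) simp
next
  case (Cons l u)
  show ?case
  proof (rule ell2_eqI, safe)
    fix \<rho>' y
    show "coord (word_op (l # u) (ket (\<rho>, []))) (\<rho>', y) =
        coord (scale (of_real (amplitude (X \<rho>) (l # u))) (ket (\<rho>, endpoint (l # u)))) (\<rho>', y)"
    proof (cases l)
      case (Up i t)
      then show ?thesis
        by (cases y) (auto simp: Cons.IH coord_up simp del: letter_op.simps)
    next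
      case (Down i t)
      then show ?thesis
        by (cases "endpoint u") (auto simp: Cons.IH coord_down simp del: letter_op.simps)
    qed
  qed
qed

text \<open>Lists of coefficients and words serve as *-polynomials in the generators. Different lists may
  have the same operator, which does no harm.\<close>

definition poly_op :: "(complex \<times> letter list) list \<Rightarrow> ('r \<times> bool list) ell2 \<Rightarrow>\<^sub>L ('r \<times> bool list) ell2"
  where "poly_op ps = (\<Sum>(c, u)\<leftarrow>ps. scale c o\<^sub>L word_op u)"

lemma poly_op_Nil [simp]: "poly_op [] = 0"
  and poly_op_Cons [simp]: "poly_op (cu # ps) = (scale (fst cu) o\<^sub>L word_op (snd cu)) + poly_op ps"
  by (simp_all add: poly_op_def split: prod.split)

lemma poly_op_append: "poly_op (ps @ qs) = poly_op ps + poly_op qs"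
  by (induction ps) (auto simp: add.assoc)

lemma scale_compose_scale: "scale b o\<^sub>L (scale c o\<^sub>L T) = scale (b * c) o\<^sub>L T"
  by (intro blinfun_eqI ell2_eqI) (simp add: mult.assoc)

lemma compose_add_right: "T o\<^sub>L (S + S') = (T o\<^sub>L S) + (T o\<^sub>L S')"
  and compose_add_left: "(S + S') o\<^sub>L T = (S o\<^sub>L T) + (S' o\<^sub>L T)"
  for T S S' :: "'b::real_normed_vector \<Rightarrow>\<^sub>L 'b"
  by (rule blinfun_eqI; simp add: blinfun.add_left blinfun.add_right)+

lemma poly_op_scale: "scale b o\<^sub>L poly_op ps = poly_op (map (\<lambda>(c, u). (b * c, u)) ps)"
proof (induction ps)
  case Nil
  show ?case by (rule blinfun_eqI) (simp add: blinfun.zero_right)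
next
  case (Cons cu ps)
  then show ?case
    by (cases cu) (simp add: compose_add_right scale_compose_scale)
qed

lemma poly_op_word: "word_op w o\<^sub>L poly_op ps = poly_op (map (\<lambda>(c, u). (c, w @ u)) ps)"
proof (induction ps)
  case Nil
  show ?case by (rule blinfun_eqI) (simp add: blinfun.zero_right)
next
  case (Cons cu ps)
  have "word_op w o\<^sub>L (scale (fst cu) o\<^sub>L word_op (snd cu)) = (word_op w o\<^sub>L scale (fst cu)) o\<^sub>L word_op (snd cu)"
    by (rule blinfun_eqI) simp
  also have "\<dots> = scale (fst cu) o\<^sub>L word_op (w @ snd cu)"
    unfolding word_op_scale word_op_append by (rule blinfun_eqI) simp
  finally show ?case
    using Cons by (cases cu) (simp add: compose_add_right)
qed

lemma poly_op_mult: "\<exists>rs. poly_op ps o\<^sub>L poly_op qs = poly_op rs"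
proof (induction ps)
  case Nil
  have "poly_op [] o\<^sub>L poly_op qs = poly_op []" by (rule blinfun_eqI) simp
  then show ?case by blast
next
  case (Cons cu ps)
  then obtain rs where rs: "poly_op ps o\<^sub>L poly_op qs = poly_op rs" by blast
  have "poly_op (cu # ps) o\<^sub>L poly_op qs = (scale (fst cu) o\<^sub>L (word_op (snd cu) o\<^sub>L poly_op qs)) + poly_op rs"
    unfolding rs[symmetric] by (rule blinfun_eqI) (simp add: blinfun.add_left)
  then show ?case
    unfolding poly_op_word poly_op_scale poly_op_append[symmetric] by blast
qed

lemma is_adj_poly: "\<exists>qs. is_adj (poly_op ps) (poly_op qs)"
proof (induction ps)
  case Nil
  have "is_adj (poly_op []) (poly_op [])" by (simp add: is_adj_0)
  then show ?case by blast
next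
  case (Cons cu ps)
  then obtain qs where qs: "is_adj (poly_op ps) (poly_op qs)" by blast
  have "is_adj (scale (fst cu) o\<^sub>L word_op (snd cu)) (word_op (rev (map flip_letter (snd cu))) o\<^sub>L scale (cnj (fst cu)))"
    by (intro is_adj_compose is_adj_scale is_adj_word)
  then have "is_adj (poly_op (cu # ps)) (poly_op ((cnj (fst cu), rev (map flip_letter (snd cu))) # qs))"
    using is_adj_add[OF _ qs] by (simp add: word_op_scale)
  then show ?case by blast
qed

lemma poly_op_commute: "poly_op ps o\<^sub>L scale c = scale c o\<^sub>L poly_op ps"
proof (induction ps)
  case Nil
  show ?case by (rule blinfun_eqI) (simp add: blinfun.zero_right)
next
  case (Cons cu ps)
  have "(scale (fst cu) o\<^sub>L word_op (snd cu)) o\<^sub>L scale c = scale (fst cu) o\<^sub>L (word_op (snd cu) o\<^sub>L scale c)"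
    by (rule blinfun_eqI) simp
  also have "\<dots> = scale c o\<^sub>L (scale (fst cu) o\<^sub>L word_op (snd cu))"
    unfolding word_op_scale by (intro blinfun_eqI ell2_eqI) (simp add: mult_ac)
  finally show ?case
    using Cons by (simp add: compose_add_left compose_add_right)
qed

definition alg :: "(('r \<times> bool list) ell2 \<Rightarrow>\<^sub>L ('r \<times> bool list) ell2) set"
  where "alg = closure (range poly_op)"

lemma poly_op_alg: "poly_op ps \<in> alg"
  unfolding alg_def by (rule subsetD[OF closure_subset rangeI])

lemma algE:
  assumes "T \<in> alg"
  obtains q where "(\<lambda>n. poly_op (q n)) \<longlonglongrightarrow> T"
proof -
  have "\<exists>t. (\<forall>n. t n \<in> range poly_op) \<and> t \<longlonglongrightarrow> T"
    using assms by (simp only: alg_def closure_sequential)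
  then obtain t where t: "\<forall>n. t n \<in> range poly_op" "t \<longlonglongrightarrow> T" by (elim exE conjE)
  have "\<forall>n. \<exists>q. t n = poly_op q" using t(1) by (simp only: image_iff) simp
  then obtain q where "\<forall>n. t n = poly_op (q n)" by (rule choice[THEN exE])
  then have "t = (\<lambda>n. poly_op (q n))" by auto
  then show thesis using t(2) that by simp
qed

lemma algI: "(\<lambda>n. poly_op (q n)) \<longlonglongrightarrow> T \<Longrightarrow> T \<in> alg"
  unfolding alg_def closure_sequential by (intro exI[of _ "\<lambda>n. poly_op (q n)"] conjI allI rangeI)

lemma closed_alg: "closed alg"
  by (simp add: alg_def)

lemma alg_id: "id_blinfun \<in> alg"
proof -
  have "poly_op [(1, [])] = id_blinfun"
    by (intro blinfun_eqI ell2_eqI) (simp add: blinfun.add_left)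
  then show ?thesis using poly_op_alg[of "[(1, [])]"] by simp
qed

lemma alg_0: "0 \<in> alg"
  using poly_op_alg[of "[]"] by simp

lemma alg_letter: "letter_op l \<in> alg"
proof -
  have "poly_op [(1, [l])] = letter_op l"
    by (intro blinfun_eqI ell2_eqI) (simp add: blinfun.add_left)
  then show ?thesis using poly_op_alg[of "[(1, [l])]"] by simp
qed

lemma alg_add: "S \<in> alg \<Longrightarrow> T \<in> alg \<Longrightarrow> S + T \<in> alg"
proof (elim algE)
  fix p q
  assume "(\<lambda>n. poly_op (p n)) \<longlonglongrightarrow> S" "(\<lambda>n. poly_op (q n)) \<longlonglongrightarrow> T"
  then have "(\<lambda>n. poly_op (p n) + poly_op (q n)) \<longlonglongrightarrow> S + T"
    by (rule tendsto_add)
  then show "S + T \<in> alg"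
    unfolding poly_op_append[symmetric] by (rule algI)
qed

lemma tendsto_compose_blinfun:
  fixes S T :: "'b::real_normed_vector \<Rightarrow>\<^sub>L 'b"
  assumes "(f \<longlongrightarrow> S) F" "(g \<longlongrightarrow> T) F"
  shows "((\<lambda>n. f n o\<^sub>L g n) \<longlongrightarrow> S o\<^sub>L T) F"
  using assms by (rule bounded_bilinear.tendsto[OF bounded_bilinear_blinfun_compose])

lemma alg_compose: "S \<in> alg \<Longrightarrow> T \<in> alg \<Longrightarrow> S o\<^sub>L T \<in> alg"
proof (elim algE)
  fix p q
  assume lim: "(\<lambda>n. poly_op (p n)) \<longlonglongrightarrow> S" "(\<lambda>n. poly_op (q n)) \<longlonglongrightarrow> T"
  have "\<forall>n. \<exists>r. poly_op (p n) o\<^sub>L poly_op (q n) = poly_op r"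
    by (intro allI poly_op_mult)
  then obtain r where r: "\<forall>n. poly_op (p n) o\<^sub>L poly_op (q n) = poly_op (r n)"
    by (rule choice[THEN exE])
  show "S o\<^sub>L T \<in> alg"
    using tendsto_compose_blinfun[OF lim] unfolding r[rule_format] by (rule algI)
qed

lemma alg_scale: "T \<in> alg \<Longrightarrow> scale c o\<^sub>L T \<in> alg"
proof (elim algE)
  fix q
  assume lim: "(\<lambda>n. poly_op (q n)) \<longlonglongrightarrow> T"
  show "scale c o\<^sub>L T \<in> alg"
    using tendsto_compose_blinfun[OF tendsto_const[of "scale c"] lim] unfolding poly_op_scale by (rule algI)
qed

lemma scale_minus_one: "scale (- 1) o\<^sub>L T = - T"
  by (intro blinfun_eqI ell2_eqI) (simp add: blinfun.minus_left)

lemma alg_uminus: "T \<in> alg \<Longrightarrow> - T \<in> alg"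
  using alg_scale[of T "- 1"] by (simp add: scale_minus_one)

lemma alg_diff: "S \<in> alg \<Longrightarrow> T \<in> alg \<Longrightarrow> S - T \<in> alg"
  using alg_add[of S "- T"] alg_uminus[of T] by simp

lemma alg_sum: "(\<And>i. i \<in> I \<Longrightarrow> T i \<in> alg) \<Longrightarrow> sum T I \<in> alg"
  by (induction I rule: infinite_finite_induct) (auto simp: alg_0 alg_add)

lemma alg_commute: "T \<in> alg \<Longrightarrow> T o\<^sub>L scale c = scale c o\<^sub>L T"
proof (elim algE)
  fix q
  assume lim: "(\<lambda>n. poly_op (q n)) \<longlonglongrightarrow> T"
  show "T o\<^sub>L scale c = scale c o\<^sub>L T"
    using tendsto_compose_blinfun[OF lim tendsto_const[of "scale c"]]
      tendsto_compose_blinfun[OF tendsto_const[of "scale c"] lim]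
    unfolding poly_op_commute by (rule LIMSEQ_unique)
qed

text \<open>Taking adjoints is isometric, so the adjoints of an approximating sequence converge as
  well.\<close>

lemma alg_adj:
  assumes "T \<in> alg"
  shows "\<exists>S\<in>alg. is_adj T S"
proof -
  obtain q where lim: "(\<lambda>n. poly_op (q n)) \<longlonglongrightarrow> T"
    using assms by (rule algE)
  have "\<forall>n. \<exists>r. is_adj (poly_op (q n)) (poly_op r)"
    by (intro allI is_adj_poly)
  then obtain r where r: "\<forall>n. is_adj (poly_op (q n)) (poly_op (r n))"
    by (rule choice[THEN exE])
  have adj_diff: "is_adj (poly_op (q m) - poly_op (q n)) (poly_op (r m) - poly_op (r n))" for m n
    using r[rule_format, of m] r[rule_format, of n] by (simp add: is_adj_def blinfun.diff_left inner_diff_left inner_diff_right)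
  have "Cauchy (\<lambda>n. poly_op (r n))"
    using LIMSEQ_imp_Cauchy[OF lim] norm_adj[OF adj_diff] by (simp add: Cauchy_def dist_norm)
  then obtain S where S: "(\<lambda>n. poly_op (r n)) \<longlonglongrightarrow> S"
    by (auto simp: Cauchy_convergent_iff convergent_def)
  have "is_adj T S"
    unfolding is_adj_def
  proof (intro allI)
    fix x y
    have "(\<lambda>n. inner (poly_op (q n) x) y) \<longlonglongrightarrow> inner (T x) y"
      by (intro tendsto_inner tendsto_const blinfun.tendsto lim)
    moreover have "(\<lambda>n. inner x (poly_op (r n) y)) \<longlonglongrightarrow> inner x (S y)"
      by (intro tendsto_inner tendsto_const blinfun.tendsto S)
    then have "(\<lambda>n. inner (poly_op (q n) x) y) \<longlonglongrightarrow> inner x (S y)"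
      using r by (simp add: is_adj_def)
    ultimately show "inner (T x) y = inner x (S y)" by (rule LIMSEQ_unique)
  qed
  then show ?thesis using algI[OF S] by blast
qed

text \<open>Up to the identity, this is a sum of commutators. That it is also a projection makes a trace
  impossible.\<close>

definition root_proj :: "('r \<times> bool list) ell2 \<Rightarrow>\<^sub>L ('r \<times> bool list) ell2"
  where "root_proj = (\<Sum>i\<le>d. \<Sum>t\<in>UNIV. (letter_op (Down i t) o\<^sub>L letter_op (Up i t)) -
    (letter_op (Up i t) o\<^sub>L letter_op (Down i t))) - id_blinfun"

lemma coord_sum: "coord (sum f I) j = (\<Sum>i\<in>I. coord (f i) j)"
  by (induction I rule: infinite_finite_induct) auto

lemma coord_root_proj: "coord (root_proj v) (\<rho>, y) = (if y = [] then coord v (\<rho>, y) else 0)"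
proof -
  have "(\<Sum>i\<le>d. of_real (X \<rho> z i) * (of_real (X \<rho> z i) * c)) = c" for z and c :: complex
  proof -
    have "(\<Sum>i\<le>d. of_real (X \<rho> z i) * (of_real (X \<rho> z i) * c)) = of_real (\<Sum>i\<le>d. (X \<rho> z i)\<^sup>2) * c"
      by (simp add: power2_eq_square sum_distrib_right mult.assoc)
    then show ?thesis by (simp add: unit)
  qed
  note simps = this root_proj_def blinfun.diff_left blinfun.add_left blinfun.sum_left coord_sum UNIV_bool
    coord_up coord_down sum.distrib sum_subtractf
  show ?thesis
  proof (cases y)
    case Nil
    then show ?thesis by (simp add: simps del: letter_op.simps)
  next
    case (Cons t y')
    then show ?thesis by (cases t) (simp_all add: simps del: letter_op.simps)
  qed
qed

lemma root_proj_alg: "root_proj \<in> alg"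
  unfolding root_proj_def
  by (intro alg_diff alg_sum alg_compose alg_letter alg_id)

lemma root_proj_idem: "root_proj o\<^sub>L root_proj = root_proj"
  by (intro blinfun_eqI ell2_eqI) (auto simp: coord_root_proj split: prod.split)

lemma is_adj_root_proj: "is_adj root_proj root_proj"
  unfolding is_adj_def inner_ell2_def
  by (auto intro!: infsum_cong simp: coord_root_proj)

end

section \<open>The C*-algebra and its lack of traces\<close>

lemma complex_alg_cring: "cring complex_alg"
proof -
  have "abelian_group complex_alg"
  proof (rule abelian_groupI)
    fix x assume "x \<in> carrier complex_alg"
    show "\<exists>y\<in>carrier complex_alg. y \<oplus>\<^bsub>complex_alg\<^esub> x = \<zero>\<^bsub>complex_alg\<^esub>"
      by (rule bexI[of _ "- x"]) (simp_all add: complex_alg_def)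
  qed (simp_all add: complex_alg_def)
  moreover have "comm_monoid complex_alg"
    by (rule comm_monoidI) (simp_all add: complex_alg_def)
  ultimately show ?thesis
    by (rule cringI) (simp add: complex_alg_def algebra_simps)
qed

definition coords :: "'i::countable ell2 \<Rightarrow> nat \<Rightarrow> complex"
  where "coords x = (\<lambda>n. coord x (from_nat n))"

lemma inj_coords: "inj coords"
proof (rule injI, rule ell2_eqI)
  fix x y :: "'i::countable ell2" and i :: 'i
  assume "coords x = coords y"
  then have "coords x (to_nat i) = coords y (to_nat i)" by simp
  then show "coord x i = coord y i" by (simp add: coords_def)
qed

text \<open>An operator on a Hilbert space with a countable basis becomes a map on coordinate sequences.
  Its values at sequences that are not square-summable are those at an arbitrary vector.\<close>

definition enc :: "('i::countable ell2 \<Rightarrow>\<^sub>L 'i ell2) \<Rightarrow> ambient"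
  where "enc T = (\<lambda>v. coords (T (inv_into UNIV coords v)))"

definition dec :: "ambient \<Rightarrow> 'i::countable ell2 \<Rightarrow>\<^sub>L 'i ell2"
  where "dec = inv_into UNIV enc"

lemma inj_enc: "inj enc"
proof (rule injI, rule blinfun_eqI)
  fix S T :: "'i::countable ell2 \<Rightarrow>\<^sub>L 'i ell2" and x :: "'i ell2"
  assume "enc S = enc T"
  then have "enc S (coords x) = enc T (coords x)" by simp
  then show "S x = T x"
    by (simp add: enc_def inv_f_f[OF inj_coords] inj_eq[OF inj_coords])
qed

lemma dec_enc [simp]: "dec (enc T) = T"
  unfolding dec_def by (rule inv_f_f[OF inj_enc])

lemma enc_eq_iff [simp]: "enc S = enc T \<longleftrightarrow> S = T"
  by (rule inj_eq[OF inj_enc])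

definition adj :: "('i ell2 \<Rightarrow>\<^sub>L 'i ell2) \<Rightarrow> 'i ell2 \<Rightarrow>\<^sub>L 'i ell2"
  where "adj T = (THE S. is_adj T S)"

lemma adj_eqI: "is_adj T S \<Longrightarrow> adj T = S"
  unfolding adj_def by (rule the_equality) (simp_all add: is_adj_unique)

locale countable_tree_rep = tree_rep X d for X :: "'r::countable \<Rightarrow> bool list \<Rightarrow> nat \<Rightarrow> real" and d
begin

declare alg_0 [simp] alg_id [simp] alg_add [simp] alg_uminus [simp] alg_diff [simp] alg_compose [simp] alg_scale [simp]

text \<open>Mapping everything outside the carrier to \<open>0\<close> makes the distance
  \<open>cstar_norm (x \<ominus> y)\<close> symmetric on the whole type, as the axioms of
  \<open>Metric_space\<close> demand.\<close>

definition decode :: "ambient \<Rightarrow> ('r \<times> bool list) ell2 \<Rightarrow>\<^sub>L ('r \<times> bool list) ell2"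
  where "decode a = (if a \<in> enc ` alg then dec a else 0)"

lemma decode_enc [simp]: "T \<in> alg \<Longrightarrow> decode (enc T) = T"
  by (simp add: decode_def)

lemma decode_alg [simp]: "decode a \<in> alg"
  by (auto simp: decode_def)

definition \<A> :: "ambient cstar"
  where "\<A> = \<lparr>carrier = enc ` alg, mult = (\<lambda>a b. enc (decode a o\<^sub>L decode b)), one = enc (id_blinfun :: ('r \<times> bool list) ell2 \<Rightarrow>\<^sub>L _),
    zero = enc (0 :: ('r \<times> bool list) ell2 \<Rightarrow>\<^sub>L ('r \<times> bool list) ell2),
    add = (\<lambda>a b. enc (decode a + decode b)), smult = (\<lambda>c a. enc (scale c o\<^sub>L decode a)),
    star = (\<lambda>a. enc (adj (decode a))), cstar_norm = (\<lambda>a. norm (decode a))\<rparr>"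

lemma carrier_A: "carrier \<A> = enc ` alg"
  by (simp add: \<A>_def)

lemma carrierE: "a \<in> carrier \<A> \<Longrightarrow> (\<And>T. T \<in> alg \<Longrightarrow> a = enc T \<Longrightarrow> P) \<Longrightarrow> P"
  unfolding carrier_A by blast

lemma enc_carrier [simp]: "enc T \<in> carrier \<A> \<longleftrightarrow> T \<in> alg"
  unfolding carrier_A by (auto simp: image_iff)

lemma A_ops [simp]:
  assumes "S \<in> alg" "T \<in> alg"
  shows "enc S \<otimes>\<^bsub>\<A>\<^esub> enc T = enc (S o\<^sub>L T)"
    "enc S \<oplus>\<^bsub>\<A>\<^esub> enc T = enc (S + T)"
  using assms by (simp_all add: \<A>_def)

lemma A_ops1 [simp]:
  assumes "T \<in> alg"
  shows "c \<odot>\<^bsub>\<A>\<^esub> enc T = enc (scale c o\<^sub>L T)"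
    "star \<A> (enc T) = enc (adj T)"
    "cstar_norm \<A> (enc T) = norm T"
  using assms by (simp_all add: \<A>_def)

lemma A_one: "\<one>\<^bsub>\<A>\<^esub> = enc (id_blinfun :: ('r \<times> bool list) ell2 \<Rightarrow>\<^sub>L _)"
  and A_zero: "\<zero>\<^bsub>\<A>\<^esub> = enc (0 :: ('r \<times> bool list) ell2 \<Rightarrow>\<^sub>L ('r \<times> bool list) ell2)"
  by (simp_all add: \<A>_def)

lemma A_abelian_group: "abelian_group \<A>"
proof (rule abelian_groupI)
  fix x y z
  assume xyz: "x \<in> carrier \<A>" "y \<in> carrier \<A>" "z \<in> carrier \<A>"
  obtain R S T where [simp]: "x = enc R" "y = enc S" "z = enc T" and "R \<in> alg" "S \<in> alg" "T \<in> alg"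
    using xyz by (elim carrierE)
  then show "x \<oplus>\<^bsub>\<A>\<^esub> y \<in> carrier \<A>" "x \<oplus>\<^bsub>\<A>\<^esub> y \<oplus>\<^bsub>\<A>\<^esub> z = x \<oplus>\<^bsub>\<A>\<^esub> (y \<oplus>\<^bsub>\<A>\<^esub> z)"
      "x \<oplus>\<^bsub>\<A>\<^esub> y = y \<oplus>\<^bsub>\<A>\<^esub> x" "\<zero>\<^bsub>\<A>\<^esub> \<oplus>\<^bsub>\<A>\<^esub> x = x"
    by (simp_all add: alg_add add_ac A_zero)
  show "\<exists>y\<in>carrier \<A>. y \<oplus>\<^bsub>\<A>\<^esub> x = \<zero>\<^bsub>\<A>\<^esub>"
    using \<open>R \<in> alg\<close> by (intro bexI[of _ "enc (- R)"]) (simp_all add: A_zero alg_uminus)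
qed (simp add: A_zero alg_0)

lemma A_ring: "ring \<A>"
proof (rule ringI[OF A_abelian_group])
  show "Group.monoid \<A>"
  proof (rule monoidI)
    fix x y z
    assume xyz: "x \<in> carrier \<A>" "y \<in> carrier \<A>" "z \<in> carrier \<A>"
    obtain R S T where [simp]: "x = enc R" "y = enc S" "z = enc T" and alg: "R \<in> alg" "S \<in> alg" "T \<in> alg"
      using xyz by (elim carrierE)
    show "x \<otimes>\<^bsub>\<A>\<^esub> y \<in> carrier \<A>"
      using alg by (simp add: alg_compose)
    show "x \<otimes>\<^bsub>\<A>\<^esub> y \<otimes>\<^bsub>\<A>\<^esub> z = x \<otimes>\<^bsub>\<A>\<^esub> (y \<otimes>\<^bsub>\<A>\<^esub> z)"
        "\<one>\<^bsub>\<A>\<^esub> \<otimes>\<^bsub>\<A>\<^esub> x = x" "x \<otimes>\<^bsub>\<A>\<^esub> \<one>\<^bsub>\<A>\<^esub> = x"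
      using alg by (auto simp: A_one intro: blinfun_eqI)
  qed (simp add: A_one alg_id)
next
  fix x y z
  assume xyz: "x \<in> carrier \<A>" "y \<in> carrier \<A>" "z \<in> carrier \<A>"
  obtain R S T where [simp]: "x = enc R" "y = enc S" "z = enc T" "R \<in> alg" "S \<in> alg" "T \<in> alg"
    using xyz by (elim carrierE)
  show "(x \<oplus>\<^bsub>\<A>\<^esub> y) \<otimes>\<^bsub>\<A>\<^esub> z = x \<otimes>\<^bsub>\<A>\<^esub> z \<oplus>\<^bsub>\<A>\<^esub> y \<otimes>\<^bsub>\<A>\<^esub> z"
      "z \<otimes>\<^bsub>\<A>\<^esub> (x \<oplus>\<^bsub>\<A>\<^esub> y) = z \<otimes>\<^bsub>\<A>\<^esub> x \<oplus>\<^bsub>\<A>\<^esub> z \<otimes>\<^bsub>\<A>\<^esub> y"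
    by (simp_all add: compose_add_left compose_add_right)
qed

lemma scale_add: "scale (b + c) = scale b + scale c"
  by (intro blinfun_eqI ell2_eqI) (simp add: blinfun.add_left distrib_right)

lemma scale_1 [simp]: "scale 1 o\<^sub>L T = T"
  by (intro blinfun_eqI ell2_eqI) simp

lemma A_module: "module complex_alg \<A>"
proof (rule moduleI[OF complex_alg_cring A_abelian_group])
  fix a b x y
  assume "x \<in> carrier \<A>" "y \<in> carrier \<A>"
  then obtain S T where [simp]: "x = enc S" "y = enc T" and alg [simp]: "S \<in> alg" "T \<in> alg"
    by (elim carrierE)
  show "a \<odot>\<^bsub>\<A>\<^esub> x \<in> carrier \<A>"
    using alg by (simp add: alg_scale)
  show "(a \<oplus>\<^bsub>complex_alg\<^esub> b) \<odot>\<^bsub>\<A>\<^esub> x = a \<odot>\<^bsub>\<A>\<^esub> x \<oplus>\<^bsub>\<A>\<^esub> b \<odot>\<^bsub>\<A>\<^esub> x"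
    by (simp add: complex_alg_def scale_add compose_add_left)
  show "a \<odot>\<^bsub>\<A>\<^esub> (x \<oplus>\<^bsub>\<A>\<^esub> y) = a \<odot>\<^bsub>\<A>\<^esub> x \<oplus>\<^bsub>\<A>\<^esub> a \<odot>\<^bsub>\<A>\<^esub> y"
    by (simp add: compose_add_right)
  show "(a \<otimes>\<^bsub>complex_alg\<^esub> b) \<odot>\<^bsub>\<A>\<^esub> x = a \<odot>\<^bsub>\<A>\<^esub> (b \<odot>\<^bsub>\<A>\<^esub> x)"
    by (simp add: complex_alg_def scale_compose_scale)
  show "\<one>\<^bsub>complex_alg\<^esub> \<odot>\<^bsub>\<A>\<^esub> x = x"
    by (simp add: complex_alg_def)
qed

lemma A_minus: "a \<ominus>\<^bsub>\<A>\<^esub> b = enc (decode a - decode b)"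
proof -
  have "\<ominus>\<^bsub>\<A>\<^esub> b = (THE y. y \<in> carrier \<A> \<and> b \<oplus>\<^bsub>\<A>\<^esub> y = \<zero>\<^bsub>\<A>\<^esub> \<and> y \<oplus>\<^bsub>\<A>\<^esub> b = \<zero>\<^bsub>\<A>\<^esub>)"
    by (simp add: a_inv_def m_inv_def)
  also have "\<dots> = enc (- decode b)"
  proof (rule the_equality)
    show "enc (- decode b) \<in> carrier \<A> \<and> b \<oplus>\<^bsub>\<A>\<^esub> enc (- decode b) = \<zero>\<^bsub>\<A>\<^esub> \<and> enc (- decode b) \<oplus>\<^bsub>\<A>\<^esub> b = \<zero>\<^bsub>\<A>\<^esub>"
      by (simp add: \<A>_def)
    show "y = enc (- decode b)"
      if y: "y \<in> carrier \<A> \<and> b \<oplus>\<^bsub>\<A>\<^esub> y = \<zero>\<^bsub>\<A>\<^esub> \<and> y \<oplus>\<^bsub>\<A>\<^esub> b = \<zero>\<^bsub>\<A>\<^esub>" for y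
    proof -
      obtain S where S: "S \<in> alg" "y = enc S" using y by (auto elim: carrierE)
      then have "decode b + S = 0" using y by (simp add: \<A>_def)
      then have "S = - decode b" by (simp only: eq_neg_iff_add_eq_0 add.commute)
      then show ?thesis using S by simp
    qed
  qed
  finally show ?thesis
    by (simp add: a_minus_def) (simp add: \<A>_def)
qed

lemma adj_alg: "T \<in> alg \<Longrightarrow> adj T \<in> alg \<and> is_adj T (adj T)"
  using alg_adj adj_eqI by blast

lemma A_dist: "cstar_norm \<A> (a \<ominus>\<^bsub>\<A>\<^esub> b) = norm (decode a - decode b)"
  by (simp add: A_minus)

lemma A_complete: "Metric_space.mcomplete (carrier \<A>) (\<lambda>x y. cstar_norm \<A> (x \<ominus>\<^bsub>\<A>\<^esub> y))"
proof -
  interpret M: Metric_space "carrier \<A>" "\<lambda>x y. cstar_norm \<A> (x \<ominus>\<^bsub>\<A>\<^esub> y)"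
  proof
    fix x y z
    show "0 \<le> cstar_norm \<A> (x \<ominus>\<^bsub>\<A>\<^esub> y)" by (simp only: A_dist norm_ge_zero)
    show "cstar_norm \<A> (x \<ominus>\<^bsub>\<A>\<^esub> y) = cstar_norm \<A> (y \<ominus>\<^bsub>\<A>\<^esub> x)"
      by (simp only: A_dist norm_minus_commute)
    show "cstar_norm \<A> (x \<ominus>\<^bsub>\<A>\<^esub> y) = 0 \<longleftrightarrow> x = y" if "x \<in> carrier \<A>" "y \<in> carrier \<A>"
      using that unfolding A_dist by (auto elim!: carrierE)
    show "cstar_norm \<A> (x \<ominus>\<^bsub>\<A>\<^esub> z) \<le> cstar_norm \<A> (x \<ominus>\<^bsub>\<A>\<^esub> y) + cstar_norm \<A> (y \<ominus>\<^bsub>\<A>\<^esub> z)"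
      unfolding A_dist using norm_triangle_ineq[of "decode x - decode y" "decode y - decode z"] by simp
  qed
  show ?thesis
    unfolding M.mcomplete_def
  proof (intro allI impI)
    fix \<sigma>
    assume \<sigma>: "M.MCauchy \<sigma>"
    then have ran: "range \<sigma> \<subseteq> carrier \<A>"
      and cau: "\<forall>\<epsilon>>0. \<exists>N. \<forall>n n'. N \<le> n \<longrightarrow> N \<le> n' \<longrightarrow> cstar_norm \<A> (\<sigma> n \<ominus>\<^bsub>\<A>\<^esub> \<sigma> n') < \<epsilon>"
      by (simp_all add: M.MCauchy_def)
    have "Cauchy (\<lambda>n. decode (\<sigma> n))"
    proof (rule metric_CauchyI)
      fix e :: real
      assume "0 < e"
      then obtain N where "\<forall>n n'. N \<le> n \<longrightarrow> N \<le> n' \<longrightarrow> norm (decode (\<sigma> n) - decode (\<sigma> n')) < e"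
        using cau[unfolded A_dist, rule_format, of e] by auto
      then show "\<exists>N. \<forall>m\<ge>N. \<forall>n\<ge>N. dist (decode (\<sigma> m)) (decode (\<sigma> n)) < e"
        by (intro exI[of _ N]) (simp add: dist_norm)
    qed
    then obtain T where T: "(\<lambda>n. decode (\<sigma> n)) \<longlonglongrightarrow> T"
      by (auto simp: Cauchy_convergent_iff convergent_def)
    have "T \<in> alg"
      using closed_sequentially[OF closed_alg _ T] by simp
    then have "limitin M.mtopology \<sigma> (enc T) sequentially"
      unfolding M.limit_metric_sequentially
      unfolding A_dist
      using ran T[unfolded LIMSEQ_iff] by (simp add: image_subset_iff)
    then show "\<exists>x. limitin M.mtopology \<sigma> x sequentially" by blast
  qed
qed

lemma A_cstar: "unital_cstar_algebra \<A>"
proof (intro unital_cstar_algebra.intro A_ring A_module unital_cstar_algebra_axioms.intro)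
  fix x y c
  assume x: "x \<in> carrier \<A>"
  obtain S where S [simp]: "x = enc S" "S \<in> alg"
    using x by (elim carrierE)
  note adj_S [simp] = adj_alg[OF S(2)]
  have adj_scale: "adj (scale c o\<^sub>L S) = scale (cnj c) o\<^sub>L adj S"
  proof (rule adj_eqI)
    have "is_adj (scale c o\<^sub>L S) (adj S o\<^sub>L scale (cnj c))"
      by (intro is_adj_compose is_adj_scale) simp
    then show "is_adj (scale c o\<^sub>L S) (scale (cnj c) o\<^sub>L adj S)"
      using alg_commute[of "adj S"] by simp
  qed
  show "star \<A> x \<in> carrier \<A>" "star \<A> (star \<A> x) = x" "star \<A> (c \<odot>\<^bsub>\<A>\<^esub> x) = cnj c \<odot>\<^bsub>\<A>\<^esub> star \<A> x"
      "0 \<le> cstar_norm \<A> x" "(cstar_norm \<A> x = 0) = (x = \<zero>\<^bsub>\<A>\<^esub>)"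
      "cstar_norm \<A> (c \<odot>\<^bsub>\<A>\<^esub> x) = cmod c * cstar_norm \<A> x"
      "cstar_norm \<A> (star \<A> x \<otimes>\<^bsub>\<A>\<^esub> x) = (cstar_norm \<A> x)\<^sup>2"
    using adj_eqI[OF is_adj_sym[OF adj_S[THEN conjunct2]]]
    by (simp_all add: adj_scale A_zero norm_scale_compose norm_adj_compose)
  assume y: "y \<in> carrier \<A>"
  obtain T where T [simp]: "y = enc T" "T \<in> alg"
    using y by (elim carrierE)
  note adj_T [simp] = adj_alg[OF T(2)]
  have "adj (S + T) = adj S + adj T" "adj (S o\<^sub>L T) = adj T o\<^sub>L adj S"
    by (intro adj_eqI is_adj_add is_adj_compose; simp)+
  then show "star \<A> (x \<oplus>\<^bsub>\<A>\<^esub> y) = star \<A> x \<oplus>\<^bsub>\<A>\<^esub> star \<A> y"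
      "star \<A> (x \<otimes>\<^bsub>\<A>\<^esub> y) = star \<A> y \<otimes>\<^bsub>\<A>\<^esub> star \<A> x"
      "cstar_norm \<A> (x \<oplus>\<^bsub>\<A>\<^esub> y) \<le> cstar_norm \<A> x + cstar_norm \<A> y"
      "cstar_norm \<A> (x \<otimes>\<^bsub>\<A>\<^esub> y) \<le> cstar_norm \<A> x * cstar_norm \<A> y"
    by (simp_all add: norm_triangle_ineq norm_blinfun_compose)
  show "(c \<odot>\<^bsub>\<A>\<^esub> x) \<otimes>\<^bsub>\<A>\<^esub> y = c \<odot>\<^bsub>\<A>\<^esub> (x \<otimes>\<^bsub>\<A>\<^esub> y)"
    by (auto intro: blinfun_eqI)
  have "(S o\<^sub>L (scale c o\<^sub>L T)) = (S o\<^sub>L scale c) o\<^sub>L T"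
    by (rule blinfun_eqI) simp
  also have "\<dots> = scale c o\<^sub>L (S o\<^sub>L T)"
    unfolding alg_commute[OF S(2)] by (rule blinfun_eqI) simp
  finally show "x \<otimes>\<^bsub>\<A>\<^esub> (c \<odot>\<^bsub>\<A>\<^esub> y) = c \<odot>\<^bsub>\<A>\<^esub> (x \<otimes>\<^bsub>\<A>\<^esub> y)"
    by simp
qed (rule A_complete)

lemma finsum_enc:
  assumes "finite I" "\<And>i. i \<in> I \<Longrightarrow> T i \<in> alg"
  shows "(\<Oplus>\<^bsub>\<A>\<^esub>i\<in>I. enc (T i)) = enc (\<Sum>i\<in>I. T i)"
proof -
  interpret abelian_group \<A> by (rule A_abelian_group)
  show ?thesis
    using assms
    by (induction I rule: finite_induct) (simp_all add: finsum_insert Pi_def alg_sum A_zero)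
qed

text \<open>A trace \<open>\<tau>\<close> satisfies \<open>\<tau>(p) = - \<tau>(1)\<close> for the root
  projection \<open>p = p\<^sup>* p\<close>, so \<open>\<tau>(1) = 0\<close> by positivity. Positivity of
  \<open>\<tau>\<close> on \<open>(T + c)\<^sup>* (T + c)\<close> for all scalars \<open>c\<close> then
  gives \<open>\<tau>(T) = 0\<close>.\<close>

lemma no_trace: "\<not> bounded_trace \<A> t"
proof
  assume t: "bounded_trace \<A> t"
  define \<tau> where "\<tau> T = t (enc T)" for T :: "('r \<times> bool list) ell2 \<Rightarrow>\<^sub>L ('r \<times> bool list) ell2"
  have add: "\<tau> (S + T) = \<tau> S + \<tau> T" if "S \<in> alg" "T \<in> alg" for S T
    using t that unfolding bounded_trace_def \<tau>_def by (metis A_ops(2) enc_carrier)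
  have scale: "\<tau> (scale c o\<^sub>L T) = c * \<tau> T" if "T \<in> alg" for c T
    using t that unfolding bounded_trace_def \<tau>_def by (metis A_ops1(1) enc_carrier)
  have pos: "\<tau> (S o\<^sub>L T) \<in> \<real>\<^sub>\<ge>\<^sub>0" if "T \<in> alg" "is_adj T S" for S T
  proof -
    have "adj T = S" using that by (simp add: adj_eqI)
    moreover have "\<forall>a\<in>carrier \<A>. t (star \<A> a \<otimes>\<^bsub>\<A>\<^esub> a) \<in> \<real>\<^sub>\<ge>\<^sub>0"
      using t unfolding bounded_trace_def by (elim conjE)
    then have "t (star \<A> (enc T) \<otimes>\<^bsub>\<A>\<^esub> enc T) \<in> \<real>\<^sub>\<ge>\<^sub>0"
      by (rule bspec) (simp add: that)
    ultimately show ?thesis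
      using that adj_alg[OF that(1)] by (simp add: \<tau>_def)
  qed
  have comm: "\<tau> (S o\<^sub>L T) = \<tau> (T o\<^sub>L S)" if "S \<in> alg" "T \<in> alg" for S T
    using t that unfolding bounded_trace_def \<tau>_def by (metis A_ops(1) enc_carrier)
  have \<tau>0: "\<tau> 0 = 0" using add[of 0 0] by simp
  have diff: "\<tau> (S - T) = \<tau> S - \<tau> T" if "S \<in> alg" "T \<in> alg" for S T
    using add[of "S - T" T] that by simp
  have sum: "\<tau> (sum T I) = (\<Sum>i\<in>I. \<tau> (T i))" if "\<And>i. T i \<in> alg" for T and I :: "'x set"
    by (induction I rule: infinite_finite_induct) (simp_all add: \<tau>0 add that alg_sum)
  have "\<tau> root_proj = - \<tau> id_blinfun"
    unfolding root_proj_def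
    by (simp add: diff sum alg_sum alg_letter comm[OF alg_letter alg_letter] del: letter_op.simps)
  moreover have "\<tau> root_proj \<in> \<real>\<^sub>\<ge>\<^sub>0"
    using pos[OF root_proj_alg is_adj_root_proj] by (simp add: root_proj_idem)
  moreover have id_id: "id_blinfun o\<^sub>L id_blinfun = (id_blinfun :: ('r \<times> bool list) ell2 \<Rightarrow>\<^sub>L _)"
    by (rule blinfun_eqI) simp
  have "\<tau> id_blinfun \<in> \<real>\<^sub>\<ge>\<^sub>0"
    using pos[OF alg_id is_adj_id] by (simp add: id_id)
  ultimately have \<tau>1: "\<tau> id_blinfun = 0"
    by (auto simp: complex_nonneg_Reals_iff complex_eq_iff)
  have "\<tau> T = 0" if T: "T \<in> alg" for T
  proof -
    define S where "S = adj T"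
    have S: "S \<in> alg" "is_adj T S" using adj_alg[OF T] by (simp_all add: S_def)
    have *: "\<tau> (S o\<^sub>L T) + (cnj c * \<tau> T + c * \<tau> S) \<in> \<real>\<^sub>\<ge>\<^sub>0" for c
    proof -
      let ?U = "T + (scale c o\<^sub>L id_blinfun)" and ?V = "S + (id_blinfun o\<^sub>L scale (cnj c))"
      have "is_adj ?U ?V"
        by (intro is_adj_add is_adj_compose is_adj_scale is_adj_id S)
      then have "\<tau> (?V o\<^sub>L ?U) \<in> \<real>\<^sub>\<ge>\<^sub>0"
        using T by (intro pos) auto
      also have "?V o\<^sub>L ?U = (S o\<^sub>L T) + ((scale (cnj c) o\<^sub>L T) + ((scale c o\<^sub>L S) + (scale (cnj c * c) o\<^sub>L id_blinfun)))"
      proof -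
        have "S o\<^sub>L scale c = scale c o\<^sub>L S" using S by (simp add: alg_commute)
        then have "S (scale c v) = scale c (S v)" for v
          using blinfun_apply_blinfun_compose by metis
        then show ?thesis
          by (intro blinfun_eqI ell2_eqI) (simp add: blinfun.add_left blinfun.add_right algebra_simps)
      qed
      finally show ?thesis
        using T S by (simp add: add scale \<tau>1)
    qed
    have "\<tau> (S o\<^sub>L T) \<in> \<real>\<^sub>\<ge>\<^sub>0" using *[of 0] by simp
    define r where "r = Re (\<tau> (S o\<^sub>L T))"
    have r: "0 \<le> r" "\<tau> (S o\<^sub>L T) = of_real r"
      using \<open>\<tau> (S o\<^sub>L T) \<in> _\<close> by (auto simp: r_def complex_nonneg_Reals_iff complex_eq_iff)
    have im: "Im (cnj c * \<tau> T + c * \<tau> S) = 0" and re: "0 \<le> r + Re (cnj c * \<tau> T + c * \<tau> S)" for c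
      using *[of c] by (auto simp: r complex_nonneg_Reals_iff)
    have "\<tau> S = cnj (\<tau> T)"
      using im[of 1] im[of \<i>] by (simp add: complex_eq_iff)
    then have main: "0 \<le> r + 2 * Re (cnj c * \<tau> T)" for c
      using re[of c] by simp
    show "\<tau> T = 0"
    proof (rule ccontr)
      assume "\<tau> T \<noteq> 0"
      have "cnj (- of_real ((r + 1) / (cmod (\<tau> T))\<^sup>2) * \<tau> T) * \<tau> T = - of_real ((r + 1) / (cmod (\<tau> T))\<^sup>2) * (\<tau> T * cnj (\<tau> T))"
        by (simp add: mult_ac)
      also have "\<dots> = - of_real ((r + 1) / (cmod (\<tau> T))\<^sup>2 * (cmod (\<tau> T))\<^sup>2)"
        unfolding complex_norm_square[symmetric] by simp
      also have "\<dots> = - of_real (r + 1)"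
        using \<open>\<tau> T \<noteq> 0\<close> by simp
      finally have "Re (cnj (- of_real ((r + 1) / (cmod (\<tau> T))\<^sup>2) * \<tau> T) * \<tau> T) = - (r + 1)"
        by simp
      then show False
        using main[of "- of_real ((r + 1) / (cmod (\<tau> T))\<^sup>2) * \<tau> T"] r(1) by simp
    qed
  qed
  then show False
    using t unfolding bounded_trace_def \<tau>_def by (auto elim!: carrierE)
qed

end

section \<open>A mod 2 cup product on a glued cubical grid\<close>

lemma char2_add_self [simp]: "x + x = (0::2)"
proof -
  have "x + x = 2 * x" by (rule mult_2[symmetric])
  also have "(2::2) = 0" by simp
  finally show ?thesis by simp
qed

lemma char2_add_self_left [simp]: "x + (x + y) = (y::2)"
  by (simp flip: add.assoc)

lemma char2_double [simp]: "2 * x = (0::2)"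
  by (simp add: mult_2)

lemma sum_char2_involution:
  fixes f :: "'a \<Rightarrow> 2"
  assumes "finite S" and "\<And>x. x \<in> S \<Longrightarrow> \<phi> x \<in> S \<and> \<phi> (\<phi> x) = x \<and> \<phi> x \<noteq> x \<and> f (\<phi> x) = f x"
  shows "sum f S = 0"
  using assms
proof (induction "card S" arbitrary: S rule: less_induct)
  case less
  show ?case
  proof (cases "S = {}")
    case False
    then obtain x where x: "x \<in> S" by auto
    note inv = less.prems(2)
    let ?S = "S - {x, \<phi> x}"
    have "sum f ?S = 0"
    proof (rule less.hyps)
      show "card ?S < card S"
        using x less.prems(1) by (intro psubset_card_mono) auto
      show "finite ?S"
        using less.prems(1) by simp
      show "\<phi> y \<in> ?S \<and> \<phi> (\<phi> y) = y \<and> \<phi> y \<noteq> y \<and> f (\<phi> y) = f y" if "y \<in> ?S" for y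
        using inv[of y] inv[OF x] that by auto
    qed
    moreover have "S = insert x (insert (\<phi> x) ?S)"
      using x inv[OF x] by auto
    then have "sum f S = sum f (insert x (insert (\<phi> x) ?S))"
      by simp
    moreover have "x \<notin> insert (\<phi> x) ?S" "\<phi> x \<notin> ?S"
      using inv[OF x] by auto
    ultimately show ?thesis
      using less.prems(1) inv[OF x] by simp
  qed simp
qed

text \<open>The face of a simplex, given by its sequence of vertices, that is opposite to the vertex with
  index \<open>i\<close>.\<close>

definition skip :: "nat \<Rightarrow> (nat \<Rightarrow> 'v) \<Rightarrow> nat \<Rightarrow> 'v"
  where "skip i v = (\<lambda>l. v (if l < i then l else Suc l))"

text \<open>The coboundary of a product of 1-cocycles \<open>s\<^sub>l(x) + s\<^sub>l(y)\<close>
  vanishes. Written for a simplex with \<open>m + 2\<close> vertices, this says that the last face equals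
  the sum of the other faces.\<close>

lemma sum_skip_coboundary:
  fixes s :: "nat \<Rightarrow> 'v \<Rightarrow> 2"
  shows "(\<Sum>i\<le>m. \<Prod>l<m. (s l (skip i v l) + s l (skip i v (Suc l)))) = (\<Prod>l<m. (s l (v l) + s l (v (Suc l))))"
proof (induction m)
  case (Suc m)
  let ?P = "\<lambda>i. \<Prod>l<m. (s l (skip i v l) + s l (skip i v (Suc l)))"
  have "(\<Sum>i\<le>m. ?P i * (s m (skip i v m) + s m (skip i v (Suc m))))
      = (\<Sum>i\<le>m. ?P i * (s m (v (Suc m)) + s m (v (Suc (Suc m)))))"
    by (intro sum.cong) (auto simp: skip_def)
  also have "\<dots> = (\<Prod>l<m. (s l (v l) + s l (v (Suc l)))) * (s m (v (Suc m)) + s m (v (Suc (Suc m))))"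
    by (simp add: Suc.IH flip: sum_distrib_right)
  finally have 1: "(\<Sum>i\<le>m. ?P i * (s m (skip i v m) + s m (skip i v (Suc m)))) = \<dots>" .
  have 2: "?P (Suc m) * (s m (skip (Suc m) v m) + s m (skip (Suc m) v (Suc m)))
      = (\<Prod>l<m. (s l (v l) + s l (v (Suc l)))) * (s m (v m) + s m (v (Suc (Suc m))))"
    by (intro arg_cong2[where f = "(*)"] prod.cong) (auto simp: skip_def)
  show ?case
    by (simp add: 1 2 flip: distrib_left) (simp add: add.commute)
qed simp

lemma sum_skip_coboundary':
  fixes s :: "nat \<Rightarrow> 'v \<Rightarrow> 2"
  shows "(\<Sum>i=1..Suc m. \<Prod>l<m. (s l (skip i v l) + s l (skip i v (Suc l))))
    = (\<Prod>l<m. (s l (v (Suc l)) + s l (v (Suc (Suc l)))))"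
proof -
  let ?P = "\<lambda>i. \<Prod>l<m. (s l (skip i v l) + s l (skip i v (Suc l)))"
  have "(\<Sum>i=1..Suc m. ?P i) = (\<Sum>i=1..m. ?P i) + ?P (Suc m)"
    by simp
  also have "(\<Sum>i=1..m. ?P i) = ?P 0 + (\<Sum>i\<le>m. ?P i)"
    by (simp add: atMost_atLeast0 sum.atLeast_Suc_atMost[of 0 m])
  also have "?P (Suc m) = (\<Prod>l<m. (s l (v l) + s l (v (Suc l))))"
    by (intro prod.cong) (auto simp: skip_def)
  also have "(\<Sum>i\<le>m. ?P i) = (\<Prod>l<m. (s l (v l) + s l (v (Suc l))))"
    by (rule sum_skip_coboundary)
  finally show ?thesis
    by (simp add: skip_def add.assoc)
qed

text \<open>The cup product \<open>\<delta>s\<^sub>0 \<union> \<dots> \<union> u \<union> \<dots>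
  \<union> \<delta>s\<^sub>n\<^sub>-\<^sub>1\<close> with the 0-cochain \<open>u\<close> in place of the
  factor \<open>\<delta>s\<^sub>k\<close>.\<close>

definition cochain :: "nat \<Rightarrow> (nat \<Rightarrow> 'v \<Rightarrow> 2) \<Rightarrow> nat \<Rightarrow> ('v \<Rightarrow> 2) \<Rightarrow> (nat \<Rightarrow> 'v) \<Rightarrow> 2"
  where "cochain n s k u v = (\<Prod>l<k. (s l (v l) + s l (v (Suc l)))) * u (v k) *
    (\<Prod>l<n - Suc k. (s (l + Suc k) (v (l + k)) + s (l + Suc k) (v (Suc (l + k)))))"

lemma prod_split_at:
  fixes f :: "nat \<Rightarrow> 2"
  assumes "k < n"
  shows "(\<Prod>l<n. f l) = (\<Prod>l<k. f l) * f k * (\<Prod>l<n - Suc k. f (l + Suc k))"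
proof -
  obtain m where m: "n = Suc k + m"
    using assms by (metis less_iff_Suc_add add_Suc)
  show ?thesis unfolding m
    by (induction m) (simp_all add: mult_ac add_ac)
qed

text \<open>The Leibniz rule: as the other factors are cocycles, the coboundary only hits
  \<open>u\<close>.\<close>

lemma cochain_coboundary:
  assumes "k < n"
  shows "(\<Sum>i\<le>n. cochain n s k u (skip i v)) =
    (\<Prod>l<n. ((s(k := u)) l (v l) + (s(k := u)) l (v (Suc l))))"
proof -
  let ?A = "\<Prod>l<k. (s l (v l) + s l (v (Suc l)))"
  let ?B = "\<Prod>l<n - Suc k. (s (l + Suc k) (v (l + Suc k)) + s (l + Suc k) (v (Suc (l + Suc k))))"
  let ?m = "n - Suc k"
  have "(\<Sum>i\<le>n. cochain n s k u (skip i v)) =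
      (\<Sum>i\<le>k. cochain n s k u (skip i v)) + (\<Sum>i=Suc k..n. cochain n s k u (skip i v))"
    using assms by (subst sum.union_disjoint[symmetric]) (auto intro!: sum.cong)
  also have "(\<Sum>i\<le>k. cochain n s k u (skip i v)) =
      (\<Sum>i\<le>k. (\<Prod>l<k. (s l (skip i v l) + s l (skip i v (Suc l)))) * (u (v (Suc k)) * ?B))"
    unfolding cochain_def mult.assoc
    by (intro sum.cong refl arg_cong2[where f = "(*)"] prod.cong) (auto simp: skip_def)
  also have "\<dots> = ?A * (u (v (Suc k)) * ?B)"
    by (simp add: sum_skip_coboundary flip: sum_distrib_right)
  also have "(\<Sum>i=Suc k..n. cochain n s k u (skip i v)) =
      (\<Sum>i=Suc k..n. ?A * u (v k) * (\<Prod>l<?m. (s (l + Suc k) (skip i v (l + k)) + s (l + Suc k) (skip i v (Suc (l + k))))))"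
    unfolding cochain_def
    by (intro sum.cong refl arg_cong2[where f = "(*)"] prod.cong) (auto simp: skip_def)
  also have "\<dots> = (\<Sum>i=1 + k..Suc ?m + k. ?A * u (v k) * (\<Prod>l<?m. (s (l + Suc k) (skip i v (l + k)) + s (l + Suc k) (skip i v (Suc (l + k))))))"
    using assms by (intro sum.cong) auto
  also have "\<dots> = (\<Sum>i=1..Suc ?m. ?A * u (v k) * (\<Prod>l<?m. (s (l + Suc k) (skip (i + k) v (l + k)) + s (l + Suc k) (skip (i + k) v (Suc (l + k))))))"
    by (rule sum.shift_bounds_cl_nat_ivl)
  also have "\<dots> = (\<Sum>i=1..Suc ?m. ?A * u (v k) * (\<Prod>l<?m. (s (l + Suc k) (skip i (\<lambda>l. v (l + k)) l) + s (l + Suc k) (skip i (\<lambda>l. v (l + k)) (Suc l)))))"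
    by (intro sum.cong refl arg_cong2[where f = "(*)"] prod.cong) (auto simp: skip_def)
  also have "\<dots> = ?A * u (v k) * ?B"
    using sum_skip_coboundary'[where m = ?m and s = "\<lambda>l. s (l + Suc k)" and v = "\<lambda>l. v (l + k)"]
    by (simp flip: sum_distrib_left)
  also have "?A * (u (v (Suc k)) * ?B) + ?A * u (v k) * ?B = ?A * (u (v k) + u (v (Suc k))) * ?B"
    by (simp add: algebra_simps)
  also have "\<dots> = (\<Prod>l<n. ((s(k := u)) l (v l) + (s(k := u)) l (v (Suc l))))"
    unfolding prod_split_at[OF assms]
    by (intro arg_cong2[where f = "(*)"] prod.cong) auto
  finally show ?thesis .
qed

text \<open>A cubical complex: the cube \<open>[0, 2p]\<^sup>I\<close>, in which the face
  \<open>w\<^sub>j = 0\<close> is glued to the face \<open>w\<^sub>j = 2p\<close> by reflecting all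
  coordinates in \<open>R j\<close>, among them \<open>j\<close> itself.\<close>

locale glued_grid =
  fixes I :: "'i set" and p :: int and R :: "'i \<Rightarrow> 'i set"
  assumes fin: "finite I" and p_pos: "0 < p" and R: "i \<in> I \<Longrightarrow> i \<in> R i \<and> R i \<subseteq> I"
begin

definition reflect :: "'i set \<Rightarrow> ('i \<Rightarrow> int) \<Rightarrow> 'i \<Rightarrow> int"
  where "reflect Q w = (\<lambda>j. if j \<in> Q then 2 * p - w j else w j)"

definition grid :: "('i \<Rightarrow> int) set"
  where "grid = (\<Pi>\<^sub>E i\<in>I. {0..2 * p})"

text \<open>The maximal simplices of the barycentric subdivision of the grid with mesh 2. Even
  coordinates belong to vertices and odd ones to midpoints: a flag starts at a vertex \<open>a\<close> of
  the grid and ends at the centre \<open>c\<close> of an adjacent cube, changing the coordinates one after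
  the other in the order \<open>\<pi>\<close>. The number of odd coordinates orders the vertices of a
  simplex, and reflections preserve this order, which is why the subdivision is used: the cup product is
  compatible with the gluing.\<close>

definition flags :: "(('i \<Rightarrow> int) \<times> ('i \<Rightarrow> int) \<times> 'i list) set"
  where "flags = {(a, c, \<pi>). a \<in> grid \<and> c \<in> grid \<and>
    (\<forall>i\<in>I. even (a i) \<and> odd (c i) \<and> \<bar>a i - c i\<bar> = 1) \<and> distinct \<pi> \<and> set \<pi> = I}"

definition vertex :: "('i \<Rightarrow> int) \<times> ('i \<Rightarrow> int) \<times> 'i list \<Rightarrow> nat \<Rightarrow> 'i \<Rightarrow> int"
  where "vertex = (\<lambda>(a, c, \<pi>) l j. if j \<in> set (take l \<pi>) then c j else a j)"

lemma finite_flags: "finite flags"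
proof (rule finite_subset)
  show "flags \<subseteq> grid \<times> grid \<times> {xs. set xs \<subseteq> I \<and> distinct xs}"
    by (auto simp: flags_def)
  show "finite (grid \<times> grid \<times> {xs. set xs \<subseteq> I \<and> distinct xs})"
    using fin unfolding grid_def
    by (intro finite_cartesian_product finite_PiE finite_subset_distinct) auto
qed

lemma length_flag: "(a, c, \<pi>) \<in> flags \<Longrightarrow> length \<pi> = card I"
  by (auto simp: flags_def distinct_card)

lemma reflect_reflect [simp]: "reflect Q (reflect Q w) = w"
  by (auto simp: reflect_def)

lemma reflect_grid: "\<lbrakk>w \<in> grid; i \<in> I\<rbrakk> \<Longrightarrow> reflect (R i) w \<in> grid"
  using R unfolding grid_def reflect_def by (fastforce simp: PiE_iff extensional_def)

lemma vertex_grid: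
  assumes "\<sigma> \<in> flags"
  shows "vertex \<sigma> l \<in> grid"
  using assms unfolding vertex_def flags_def grid_def
  by (auto simp: PiE_iff extensional_def split: if_splits dest!: in_set_takeD)

text \<open>Every facet lies in exactly two flags, since the glued grid has no boundary. A missing first
  vertex can be replaced by its mirror image; for a missing vertex in the middle two steps can be
  exchanged; the last vertex can be moved to the adjacent cube, which may lie across a glued face.\<close>

lemma facets_cancel:
  fixes \<beta> :: "(nat \<Rightarrow> 'i \<Rightarrow> int) \<Rightarrow> 2"
  assumes cong: "\<And>v v'. (\<And>l. l < card I \<Longrightarrow> v l = v' l) \<Longrightarrow> \<beta> v = \<beta> v'"
    and glue: "\<And>v j. \<lbrakk>j \<in> I; \<And>l. v l \<in> grid; \<And>l. l < card I \<Longrightarrow> v l j \<in> {0, 2 * p}\<rbrakk> \<Longrightarrow>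
      \<beta> (\<lambda>l. reflect (R j) (v l)) = \<beta> v"
    and "i \<le> card I" "0 < card I"
  shows "(\<Sum>\<sigma>\<in>flags. \<beta> (skip i (vertex \<sigma>))) = 0"
proof -
  let ?n = "card I"
  consider "i = 0" | "0 < i" "i < ?n" | "i = ?n"
    using assms(3) by linarith
  then show ?thesis
  proof cases
    case 1
    define \<phi> where "\<phi> = (\<lambda>(a :: 'i \<Rightarrow> int, c, \<pi>). (a(\<pi> ! 0 := 2 * c (\<pi> ! 0) - a (\<pi> ! 0)), c, \<pi>))"
    show ?thesis
    proof (rule sum_char2_involution[OF finite_flags, of \<phi>], clarify)
      fix a c \<pi>
      assume *: "(a, c, \<pi>) \<in> flags"
      let ?j = "\<pi> ! 0"
      have len: "length \<pi> = ?n"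
        using * by (rule length_flag)
      have j: "?j \<in> I"
        using * len assms(4) by (auto simp: flags_def)
      have bd: "0 \<le> a ?j" "a ?j \<le> 2 * p" "0 \<le> c ?j" "c ?j \<le> 2 * p" "even (a ?j)" "odd (c ?j)" "\<bar>a ?j - c ?j\<bar> = 1"
        using * j by (auto simp: flags_def grid_def)
      have "odd (c ?j)" "c ?j \<noteq> 0" "c ?j \<noteq> 2 * p"
        using bd by auto
      then have "0 \<le> 2 * c ?j - a ?j" "2 * c ?j - a ?j \<le> 2 * p"
        using bd by linarith+
      then have "\<phi> (a, c, \<pi>) \<in> flags"
        using * j unfolding flags_def grid_def \<phi>_def
        by (auto simp: PiE_iff extensional_def)
      moreover have "\<phi> (\<phi> (a, c, \<pi>)) = (a, c, \<pi>)"
        by (simp add: \<phi>_def Let_def)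
      moreover have "a ?j \<noteq> 2 * c ?j - a ?j"
        using bd by auto
      then have "\<phi> (a, c, \<pi>) \<noteq> (a, c, \<pi>)"
        by (auto simp: \<phi>_def dest: fun_cong[of _ _ ?j])
      moreover have "?j \<in> set (take (Suc l) \<pi>)" for l
        using len assms(4) by (cases \<pi>) auto
      then have "\<beta> (skip i (vertex (\<phi> (a, c, \<pi>)))) = \<beta> (skip i (vertex (a, c, \<pi>)))"
        unfolding 1 by (intro cong) (auto simp: skip_def vertex_def \<phi>_def fun_eq_iff)
      ultimately show "\<phi> (a, c, \<pi>) \<in> flags \<and> \<phi> (\<phi> (a, c, \<pi>)) = (a, c, \<pi>) \<and> \<phi> (a, c, \<pi>) \<noteq> (a, c, \<pi>) \<and>
          \<beta> (skip i (vertex (\<phi> (a, c, \<pi>)))) = \<beta> (skip i (vertex (a, c, \<pi>)))"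
        by blast
    qed
  next
    case 2
    define \<phi> where "\<phi> = (\<lambda>(a :: 'i \<Rightarrow> int, c :: 'i \<Rightarrow> int, \<pi> :: 'i list). (a, c, \<pi>[i - 1 := \<pi> ! i, i := \<pi> ! (i - 1)]))"
    show ?thesis
    proof (rule sum_char2_involution[OF finite_flags, of \<phi>], clarify)
      fix a c \<pi>
      assume *: "(a, c, \<pi>) \<in> flags"
      let ?\<pi> = "\<pi>[i - 1 := \<pi> ! i, i := \<pi> ! (i - 1)]"
      have len: "length \<pi> = ?n"
        using * by (rule length_flag)
      have dist: "distinct \<pi>"
        using * by (auto simp: flags_def)
      have "\<phi> (a, c, \<pi>) \<in> flags"
        using * 2 len by (auto simp: flags_def \<phi>_def)
      moreover have "\<phi> (\<phi> (a, c, \<pi>)) = (a, c, \<pi>)"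
        using 2 len by (auto simp: \<phi>_def list_eq_iff_nth_eq nth_list_update)
      moreover have "\<pi> ! i \<noteq> \<pi> ! (i - 1)"
        using 2 len dist by (auto simp: nth_eq_iff_index_eq)
      then have "?\<pi> ! i \<noteq> \<pi> ! i"
        using 2 len by (auto simp: nth_list_update)
      then have "\<phi> (a, c, \<pi>) \<noteq> (a, c, \<pi>)"
        unfolding \<phi>_def by auto
      moreover have "set (take l ?\<pi>) = set (take l \<pi>)" if "l \<noteq> i" "l \<le> ?n" for l
      proof (cases "l < i")
        case True
        then show ?thesis by simp
      next
        case False
        then have "take l ?\<pi> = (take l \<pi>)[i - 1 := take l \<pi> ! i, i := take l \<pi> ! (i - 1)]"
          using that by (simp add: take_update_swap)
        then show ?thesis
          using False that 2 len set_swap[of "i - 1" "take l \<pi>" i] by simp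
      qed
      then have "\<beta> (skip i (vertex (\<phi> (a, c, \<pi>)))) = \<beta> (skip i (vertex (a, c, \<pi>)))"
        by (intro cong) (auto simp: skip_def vertex_def \<phi>_def fun_eq_iff)
      ultimately show "\<phi> (a, c, \<pi>) \<in> flags \<and> \<phi> (\<phi> (a, c, \<pi>)) = (a, c, \<pi>) \<and> \<phi> (a, c, \<pi>) \<noteq> (a, c, \<pi>) \<and>
          \<beta> (skip i (vertex (\<phi> (a, c, \<pi>)))) = \<beta> (skip i (vertex (a, c, \<pi>)))"
        by blast
    qed
  next
    case 3
    define \<phi> where "\<phi> = (\<lambda>(a :: 'i \<Rightarrow> int, c :: 'i \<Rightarrow> int, \<pi> :: 'i list). let j = \<pi> ! (?n - 1) in
      if a j \<in> {0, 2 * p} then (reflect (R j) a, reflect (R j) c, \<pi>) else (a, c(j := 2 * a j - c j), \<pi>))"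
    show ?thesis
    proof (rule sum_char2_involution[OF finite_flags, of \<phi>], clarify)
      fix a c \<pi>
      assume *: "(a, c, \<pi>) \<in> flags"
      let ?j = "\<pi> ! (?n - 1)"
      have len: "length \<pi> = ?n"
        using * by (rule length_flag)
      have j: "?j \<in> I"
        using * len assms(4) by (auto simp: flags_def)
      have bd: "0 \<le> a ?j" "a ?j \<le> 2 * p" "0 \<le> c ?j" "c ?j \<le> 2 * p" "even (a ?j)" "odd (c ?j)" "\<bar>a ?j - c ?j\<bar> = 1"
        using * j by (auto simp: flags_def grid_def)
      have nin: "?j \<notin> set (take l \<pi>)" if "l < ?n" for l
        using that len * by (auto simp: flags_def in_set_conv_nth nth_eq_iff_index_eq)
      show "\<phi> (a, c, \<pi>) \<in> flags \<and> \<phi> (\<phi> (a, c, \<pi>)) = (a, c, \<pi>) \<and> \<phi> (a, c, \<pi>) \<noteq> (a, c, \<pi>) \<and>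
          \<beta> (skip i (vertex (\<phi> (a, c, \<pi>)))) = \<beta> (skip i (vertex (a, c, \<pi>)))"
      proof (cases "a ?j \<in> {0, 2 * p}")
        case True
        have \<phi>: "\<phi> (a, c, \<pi>) = (reflect (R ?j) a, reflect (R ?j) c, \<pi>)"
          using True by (simp add: \<phi>_def Let_def)
        have ra: "reflect (R ?j) a ?j = 2 * p - a ?j"
          using R[OF j] by (simp add: reflect_def)
        have "even (a i) \<and> odd (c i) \<and> \<bar>a i - c i\<bar> = 1" if "i \<in> I" for i
          using * that by (auto simp: flags_def)
        then have "\<forall>i\<in>I. even (reflect (R ?j) a i) \<and> odd (reflect (R ?j) c i) \<and>
            \<bar>reflect (R ?j) a i - reflect (R ?j) c i\<bar> = 1"
          by (simp add: reflect_def abs_minus_commute)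
        then have "\<phi> (a, c, \<pi>) \<in> flags"
          unfolding \<phi> using * reflect_grid[OF _ j] by (auto simp: flags_def)
        moreover have "\<phi> (\<phi> (a, c, \<pi>)) = (a, c, \<pi>)"
          unfolding \<phi> using True ra by (auto simp: \<phi>_def Let_def)
        moreover have "\<phi> (a, c, \<pi>) \<noteq> (a, c, \<pi>)"
          unfolding \<phi> using True ra p_pos by (auto dest: fun_cong[of _ _ ?j])
        moreover have "\<beta> (skip i (vertex (\<phi> (a, c, \<pi>)))) = \<beta> (\<lambda>l. reflect (R ?j) (skip i (vertex (a, c, \<pi>)) l))"
          unfolding \<phi> by (intro cong) (auto simp: skip_def vertex_def reflect_def fun_eq_iff)
        moreover have "\<dots> = \<beta> (skip i (vertex (a, c, \<pi>)))"
        proof (rule glue[OF j])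
          show "skip i (vertex (a, c, \<pi>)) l \<in> grid" for l
            using * by (simp add: skip_def vertex_grid)
          show "skip i (vertex (a, c, \<pi>)) l ?j \<in> {0, 2 * p}" if "l < ?n" for l
            using True nin[OF that] that by (simp add: skip_def vertex_def 3)
        qed
        ultimately show ?thesis by simp
      next
        case False
        have \<phi>: "\<phi> (a, c, \<pi>) = (a, c(?j := 2 * a ?j - c ?j), \<pi>)"
          using False by (simp add: \<phi>_def Let_def)
        have "0 \<le> 2 * a ?j - c ?j" "2 * a ?j - c ?j \<le> 2 * p" "\<bar>c ?j - a ?j\<bar> = 1"
          using bd False by auto
        then have "\<phi> (a, c, \<pi>) \<in> flags"
          unfolding \<phi> using * j by (auto simp: flags_def grid_def PiE_iff extensional_def)
        moreover have "\<phi> (\<phi> (a, c, \<pi>)) = (a, c, \<pi>)"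
          unfolding \<phi> using False by (auto simp: \<phi>_def Let_def)
        moreover have "2 * a ?j - c ?j \<noteq> c ?j"
          using bd by auto
        then have "\<phi> (a, c, \<pi>) \<noteq> (a, c, \<pi>)"
          unfolding \<phi> by (auto dest: fun_cong[of _ _ ?j])
        moreover have "\<beta> (skip i (vertex (\<phi> (a, c, \<pi>)))) = \<beta> (skip i (vertex (a, c, \<pi>)))"
          unfolding \<phi> using nin by (intro cong) (auto simp: skip_def vertex_def 3 fun_eq_iff)
        ultimately show ?thesis by simp
      qed
    qed
  qed
qed

text \<open>The value of the cup product of the cocycles \<open>\<delta>s\<^sub>l\<close> on the
  fundamental class. A summand is nonzero if the \<open>l\<close>-th function changes in the
  \<open>l\<close>-th step of the flag for all \<open>l\<close>.\<close>

definition total :: "(nat \<Rightarrow> ('i \<Rightarrow> int) \<Rightarrow> 2) \<Rightarrow> 2"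
  where "total s = (\<Sum>\<sigma>\<in>flags. \<Prod>l<card I. (s l (vertex \<sigma> l) + s l (vertex \<sigma> (Suc l))))"

text \<open>A function on the grid that is a section of a double cover of the glued grid: crossing the
  face \<open>j\<close> changes it by \<open>e j\<close>. Its coboundary is compatible with the gluing, and
  its cohomology class depends on \<open>e\<close> only.\<close>

definition glued :: "('i \<Rightarrow> 2) \<Rightarrow> (('i \<Rightarrow> int) \<Rightarrow> 2) \<Rightarrow> bool"
  where "glued e s \<longleftrightarrow> (\<forall>w\<in>grid. \<forall>j\<in>I. w j \<in> {0, 2 * p} \<longrightarrow> s (reflect (R j) w) = s w + e j)"

lemma total_invariant_zero:
  assumes s: "\<And>l. l < card I \<Longrightarrow> glued (e l) (s l)" and u: "glued (\<lambda>_. 0) u" and k: "k < card I"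
  shows "total (s(k := u)) = 0"
proof -
  let ?n = "card I"
  have "total (s(k := u)) = (\<Sum>\<sigma>\<in>flags. \<Sum>i\<le>?n. cochain ?n s k u (skip i (vertex \<sigma>)))"
    unfolding total_def by (simp only: cochain_coboundary[OF k])
  also have "\<dots> = (\<Sum>i\<le>?n. \<Sum>\<sigma>\<in>flags. cochain ?n s k u (skip i (vertex \<sigma>)))"
    by (rule sum.swap)
  also have "\<dots> = 0"
  proof (rule sum.neutral, rule ballI, rule facets_cancel)
    show "cochain ?n s k u v = cochain ?n s k u v'" if "\<And>l. l < ?n \<Longrightarrow> v l = v' l" for v v'
      unfolding cochain_def using that k
      by (intro arg_cong2[where f = "(*)"] prod.cong) auto
    show "cochain ?n s k u (\<lambda>l. reflect (R j) (v l)) = cochain ?n s k u v"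
      if j: "j \<in> I" and v: "\<And>l. v l \<in> grid" "\<And>l. l < ?n \<Longrightarrow> v l j \<in> {0, 2 * p}" for v j
    proof -
      have *: "s m (reflect (R j) (v l)) + s m (reflect (R j) (v l')) = s m (v l) + s m (v l')"
        if "m < ?n" "l < ?n" "l' < ?n" for m l l'
      proof -
        have "s m (reflect (R j) (v l)) = s m (v l) + e m j" "s m (reflect (R j) (v l')) = s m (v l') + e m j"
          using s[OF that(1)] v j that unfolding glued_def by auto
        then show ?thesis by (simp add: add_ac)
      qed
      have "u (reflect (R j) (v k)) = u (v k)"
        using u v(1)[of k] v(2)[OF k] j unfolding glued_def by auto
      then show ?thesis
        unfolding cochain_def using k
        by (intro arg_cong2[where f = "(*)"] prod.cong) (auto intro!: *)
    qed
  qed (use k in auto)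
  finally show ?thesis .
qed

text \<open>Two functions with the same twist differ by a function on the glued grid, so that their
  coboundaries are cohomologous and can be exchanged in the cup product one by one.\<close>

lemma total_eq:
  assumes s: "\<And>l. l < card I \<Longrightarrow> glued (e l) (s l)" and s': "\<And>l. l < card I \<Longrightarrow> glued (e l) (s' l)"
  shows "total s = total s'"
proof -
  let ?t = "\<lambda>m l. if l < m then s' l else s l"
  have "total (?t m) = total s" if "m \<le> card I" for m
    using that
  proof (induction m)
    case (Suc m)
    have m: "m < card I" using Suc.prems by simp
    define u where "u w = s m w + s' m w" for w
    have "total ((?t m)(m := u)) = 0"
    proof (rule total_invariant_zero[OF _ _ m])
      show "glued (e l) (?t m l)" if "l < card I" for l
        using s s' that by simp
      show "glued (\<lambda>_. 0) u"
        using s[OF m] s'[OF m] unfolding glued_def u_def by (simp add: algebra_simps)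
    qed
    moreover have "total (?t (Suc m)) = total (?t m) + total ((?t m)(m := u))"
      unfolding total_def sum.distrib[symmetric]
    proof (rule sum.cong[OF refl])
      fix \<sigma>
      let ?v = "vertex \<sigma>"
      let ?f = "\<lambda>t l. t l (?v l) + t l (?v (Suc l))"
      have A: "(\<Prod>l<m. ?f (?t (Suc m)) l) = (\<Prod>l<m. ?f (?t m) l)"
          "(\<Prod>l<m. ?f ((?t m)(m := u)) l) = (\<Prod>l<m. ?f (?t m) l)"
          "(\<Prod>l<card I - Suc m. ?f (?t (Suc m)) (l + Suc m)) = (\<Prod>l<card I - Suc m. ?f (?t m) (l + Suc m))"
          "(\<Prod>l<card I - Suc m. ?f ((?t m)(m := u)) (l + Suc m)) = (\<Prod>l<card I - Suc m. ?f (?t m) (l + Suc m))"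
        by (auto intro!: prod.cong)
      have B: "?f (?t (Suc m)) m = ?f (?t m) m + ?f ((?t m)(m := u)) m"
        by (simp add: u_def algebra_simps)
      show "(\<Prod>l<card I. ?f (?t (Suc m)) l) = (\<Prod>l<card I. ?f (?t m) l) + (\<Prod>l<card I. ?f ((?t m)(m := u)) l)"
        unfolding prod_split_at[OF m] A B by (simp only: distrib_left distrib_right)
    qed
    ultimately show ?case
      using Suc by simp
  qed simp
  from this[of "card I"] have "total (?t (card I)) = total s" by simp
  moreover have "total (?t (card I)) = total s'"
    unfolding total_def by (intro sum.cong prod.cong) auto
  ultimately show ?thesis by simp
qed

end

section \<open>Common zeros of odd functions on a product of spheres\<close>

definition polar :: "nat \<Rightarrow> (nat \<Rightarrow> real) \<Rightarrow> nat \<Rightarrow> real"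
  where "polar d \<theta> k = (if k < d then (\<Prod>i<k. sin (\<theta> i)) * cos (\<theta> k)
    else if k = d then (\<Prod>i<d. sin (\<theta> i)) else 0)"

lemma polar_beyond: "d < k \<Longrightarrow> polar d \<theta> k = 0"
  by (simp add: polar_def)

lemma polar_norm: "(\<Sum>k\<le>d. (polar d \<theta> k)\<^sup>2) = 1"
proof -
  have "(\<Sum>k<m. ((\<Prod>i<k. sin (\<theta> i)) * cos (\<theta> k))\<^sup>2) = 1 - (\<Prod>i<m. sin (\<theta> i))\<^sup>2" for m
    by (induction m) (auto simp: power_mult_distrib cos_squared_eq algebra_simps)
  from this[of d] show ?thesis
    by (simp add: polar_def flip: lessThan_Suc_atMost)
qed

lemma polar_abs_le_1: "\<bar>polar d \<theta> k\<bar> \<le> 1"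
proof (cases "k \<le> d")
  case True
  have "(polar d \<theta> k)\<^sup>2 \<le> (\<Sum>k\<le>d. (polar d \<theta> k)\<^sup>2)"
    using True by (intro member_le_sum) auto
  then show ?thesis
    by (simp add: polar_norm abs_square_le_1)
qed (simp add: polar_def)

text \<open>With all angles in \<open>[0, \<pi>]\<close>, polar coordinates cover half of the sphere, and
  this is how the faces of the cube of angles are glued to obtain the projective space: the components up
  to \<open>i\<close> change sign under the reflection, and the remaining ones contain the factor
  \<open>sin \<theta>\<^sub>i = 0\<close>.\<close>

lemma polar_reflect:
  assumes "i < d" "sin (\<theta> i) = 0"
  shows "polar d (\<lambda>j. if j \<le> i then pi - \<theta> j else \<theta> j) k = - polar d \<theta> k"
proof -
  have *: "sin (if j \<le> i then pi - \<theta> j else \<theta> j) = sin (\<theta> j)" for j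
    by simp
  have "k \<le> i \<or> (\<Prod>j<k. sin (\<theta> j)) = 0"
    using assms(2) by (auto simp: not_le)
  then show ?thesis
    using assms(1) unfolding polar_def * by auto
qed

lemma polar_lipschitz: "\<bar>polar d \<theta> k - polar d \<theta>' k\<bar> \<le> (\<Sum>i<d. \<bar>\<theta> i - \<theta>' i\<bar>)"
proof -
  have sin: "\<bar>sin x - sin y\<bar> \<le> \<bar>x - y\<bar>" and cos: "\<bar>cos x - cos y\<bar> \<le> \<bar>x - y\<bar>" for x y :: real
  proof -
    have "norm (sin x - sin y) \<le> 1 * norm (x - y)"
      by (rule field_differentiable_bound[where S = UNIV and f' = cos])
        (auto intro!: derivative_eq_intros)
    then show "\<bar>sin x - sin y\<bar> \<le> \<bar>x - y\<bar>" by simp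
    have "norm (cos x - cos y) \<le> 1 * norm (x - y)"
      by (rule field_differentiable_bound[where S = UNIV and f' = "\<lambda>x. - sin x"])
        (auto intro!: derivative_eq_intros)
    then show "\<bar>cos x - cos y\<bar> \<le> \<bar>x - y\<bar>" by simp
  qed
  have main: "\<bar>(\<Prod>i<m. f i (\<theta> i)) - (\<Prod>i<m. f i (\<theta>' i))\<bar> \<le> (\<Sum>i<d. \<bar>\<theta> i - \<theta>' i\<bar>)"
    if "m \<le> d" and f: "\<And>i. f i = sin \<or> f i = cos" for m and f :: "nat \<Rightarrow> real \<Rightarrow> real"
  proof -
    have "norm ((\<Prod>i<m. f i (\<theta> i)) - (\<Prod>i<m. f i (\<theta>' i))) \<le> (\<Sum>i<m. norm (f i (\<theta> i) - f i (\<theta>' i)))"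
      by (rule norm_prod_diff) (metis f abs_cos_le_one abs_sin_le_one real_norm_def)+
    also have "\<dots> \<le> (\<Sum>i<m. \<bar>\<theta> i - \<theta>' i\<bar>)"
      by (rule sum_mono) (metis f sin cos real_norm_def)
    also have "\<dots> \<le> (\<Sum>i<d. \<bar>\<theta> i - \<theta>' i\<bar>)"
      using \<open>m \<le> d\<close> by (intro sum_mono2) auto
    finally show ?thesis by simp
  qed
  consider "k < d" | "k = d" | "d < k" by linarith
  then show ?thesis
  proof cases
    case 1
    have "(\<Prod>i<Suc k. (if i < k then sin else cos) (\<phi> i)) = (\<Prod>i<k. sin (\<phi> i)) * cos (\<phi> k)" for \<phi> :: "nat \<Rightarrow> real"
      by simp
    then show ?thesis
      using main[of "Suc k" "\<lambda>i. if i < k then sin else cos"] 1 by (simp add: polar_def)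
  next
    case 2
    then show ?thesis using main[of d "\<lambda>_. sin"] by (simp add: polar_def)
  next
    case 3
    then show ?thesis by (simp add: polar_def sum_nonneg)
  qed
qed

text \<open>A sign function on the nonzero vectors that changes under \<open>x \<mapsto> -x\<close> also
  if the \<open>k\<close>-th coordinate is zero. The search for a nonzero coordinate begins at
  \<open>k\<close>, and its order after that fixes where the sign changes in
  \<open>reference_step\<close>.\<close>

definition odd_sign :: "nat \<Rightarrow> nat \<Rightarrow> (nat \<Rightarrow> real) \<Rightarrow> 2"
  where "odd_sign d k x = of_bool (x (if \<exists>j. k \<le> j \<and> j \<le> d \<and> x j \<noteq> 0
    then LEAST j. k \<le> j \<and> j \<le> d \<and> x j \<noteq> 0 else LEAST j. x j \<noteq> 0) < 0)"

lemma odd_sign_uminus: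
  assumes "x i \<noteq> 0"
  shows "odd_sign d k (\<lambda>j. - x j) = odd_sign d k x + 1"
proof -
  define m where "m = (if \<exists>j. k \<le> j \<and> j \<le> d \<and> x j \<noteq> 0
    then LEAST j. k \<le> j \<and> j \<le> d \<and> x j \<noteq> 0 else LEAST j. x j \<noteq> 0)"
  have "x m \<noteq> 0"
  proof (cases "\<exists>j. k \<le> j \<and> j \<le> d \<and> x j \<noteq> 0")
    case True
    then show ?thesis
      using LeastI_ex[OF True] by (simp add: m_def)
  next
    case False
    then have "m = (LEAST j. x j \<noteq> 0)"
      unfolding m_def by (rule if_not_P)
    then show ?thesis
      using LeastI[of "\<lambda>j. x j \<noteq> 0", OF assms] by simp
  qed
  moreover have "odd_sign d k x = of_bool (x m < 0)" "odd_sign d k (\<lambda>j. - x j) = of_bool (- x m < 0)"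
    unfolding odd_sign_def m_def by (simp_all only: neg_equal_0_iff_equal)
  ultimately show ?thesis
    by (cases "x m < 0") auto
qed

lemma odd_sign_eq: "\<lbrakk>k \<le> d; x k \<noteq> 0\<rbrakk> \<Longrightarrow> odd_sign d k x = of_bool (x k < 0)"
proof -
  assume a: "k \<le> d" "x k \<noteq> 0"
  then have "(LEAST j. k \<le> j \<and> j \<le> d \<and> x j \<noteq> 0) = k"
    by (intro Least_equality) auto
  then show ?thesis using a by (auto simp: odd_sign_def)
qed

lemma odd_sign_eq_Suc: "\<lbrakk>Suc k \<le> d; x k = 0; x (Suc k) \<noteq> 0\<rbrakk> \<Longrightarrow> odd_sign d k x = of_bool (x (Suc k) < 0)"
proof -
  assume a: "Suc k \<le> d" "x k = 0" "x (Suc k) \<noteq> 0"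
  then have "(LEAST j. k \<le> j \<and> j \<le> d \<and> x j \<noteq> 0) = Suc k"
    by (intro Least_equality) (auto simp: not_less_eq_eq[symmetric] le_less Suc_le_eq)
  then show ?thesis using a by (auto simp: odd_sign_def intro!: exI[of _ "Suc k"])
qed

definition angle :: "int \<Rightarrow> int \<Rightarrow> real"
  where "angle p m = pi * of_int m / (2 * of_int p)"

definition sphere_point :: "nat \<Rightarrow> int \<Rightarrow> ('z \<times> nat \<Rightarrow> int) \<Rightarrow> 'z \<Rightarrow> nat \<Rightarrow> real"
  where "sphere_point d p w z = polar d (\<lambda>i. angle p (w (z, i)))"

lemma angle_mid: "p > 0 \<Longrightarrow> angle p p = pi / 2"
  by (simp add: angle_def)

lemma cos_angle:
  assumes "0 < p" "0 \<le> m" "m \<le> 2 * p" "m \<noteq> p"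
  shows "cos (angle p m) \<noteq> 0" "cos (angle p m) < 0 \<longleftrightarrow> p < m"
proof -
  have lo: "0 \<le> angle p m" and hi: "angle p m \<le> pi"
    using assms by (auto simp: angle_def field_simps)
  have "cos (angle p m) < 0" if "p < m"
  proof -
    have "pi / 2 < angle p m"
      using that assms by (simp add: angle_def field_simps)
    then have "cos (angle p m) < cos (pi / 2)"
      using hi by (intro cos_monotone_0_pi) auto
    then show ?thesis by simp
  qed
  moreover have "cos (angle p m) > 0" if "m < p"
  proof -
    have "angle p m < pi / 2"
      using that assms by (simp add: angle_def field_simps)
    then show ?thesis using lo by (intro cos_gt_zero_pi) auto
  qed
  ultimately show "cos (angle p m) \<noteq> 0" "cos (angle p m) < 0 \<longleftrightarrow> p < m"
    using assms(4) by (metis less_irrefl linorder_neqE not_less_iff_gr_or_eq)+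
qed

lemma sphere_point_sign:
  assumes "0 < p" "k < d" "\<And>i. i < k \<Longrightarrow> w (y, i) = p"
    and "0 \<le> w (y, k)" "w (y, k) \<le> 2 * p" "w (y, k) \<noteq> p"
  shows "odd_sign d k (sphere_point d p w y) = of_bool (p < w (y, k))"
proof -
  have "sphere_point d p w y k = cos (angle p (w (y, k)))"
    using assms(1-3) by (simp add: sphere_point_def polar_def angle_mid)
  then show ?thesis
    using cos_angle[OF assms(1,4-6)] assms(2) by (simp add: odd_sign_eq)
qed

lemma sphere_point_sign_next:
  assumes "0 < p" "k < d" "\<And>i. i \<le> k \<Longrightarrow> w (y, i) = p"
    and "Suc k < d \<Longrightarrow> 0 \<le> w (y, Suc k) \<and> w (y, Suc k) \<le> 2 * p \<and> w (y, Suc k) \<noteq> p"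
  shows "odd_sign d k (sphere_point d p w y) = of_bool (Suc k < d \<and> p < w (y, Suc k))"
proof -
  have s: "(\<Prod>i<Suc k. sin (angle p (w (y, i)))) = 1"
    using assms(1-3) by (intro prod.neutral) (simp add: angle_mid)
  have 0: "sphere_point d p w y k = 0"
    using assms(1-3) by (simp add: sphere_point_def polar_def angle_mid)
  have 1: "sphere_point d p w y (Suc k) = (if Suc k < d then cos (angle p (w (y, Suc k))) else 1)"
  proof (cases "Suc k < d")
    case True
    then show ?thesis
      unfolding sphere_point_def polar_def s by simp
  next
    case False
    then have "d = Suc k" using assms(2) by simp
    then show ?thesis
      unfolding sphere_point_def polar_def using s by simp
  qed
  show ?thesis
  proof (cases "Suc k < d")
    case True
    then show ?thesis
      using 0 1 cos_angle[OF assms(1), of "w (y, Suc k)"] assms(4) by (simp add: odd_sign_eq_Suc)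
  next
    case False
    then show ?thesis
      using 0 1 assms(2) by (simp add: odd_sign_eq_Suc)
  qed
qed

lemma sphere_point_nonzero: "\<exists>i. sphere_point d p w z i \<noteq> 0"
proof (rule ccontr)
  assume "\<nexists>i. sphere_point d p w z i \<noteq> 0"
  then have "(\<Sum>k\<le>d. (sphere_point d p w z k)\<^sup>2) = 0" by simp
  then show False by (simp add: sphere_point_def polar_norm)
qed

lemma of_bool_2_neq: "(x::2) + y \<noteq> 0 \<longleftrightarrow> x \<noteq> y"
  by (metis char2_add_self char2_add_self_left add.right_neutral)

lemma nonzero_2: "(x::2) \<noteq> 0 \<longleftrightarrow> x = 1"
  using exhaust_2[of x] by auto

text \<open>The list \<open>zs\<close> enumerates the spheres, and \<open>A z y\<close> means that the
  functions attached to \<open>y\<close> are also odd in the variable at \<open>z\<close>. For the tree,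
  \<open>z\<close> is a proper ancestor of \<open>y\<close>. That \<open>p\<close> is odd ensures that no
  vertex with even coordinates has an angle \<open>\<pi> / 2\<close>.\<close>

locale sites =
  fixes zs :: "'z list" and A :: "'z \<Rightarrow> 'z \<Rightarrow> bool" and d :: nat and p :: int
  assumes dist: "distinct zs"
    and order: "\<lbrakk>i < length zs; j < length zs; A (zs ! i) (zs ! j)\<rbrakk> \<Longrightarrow> i < j"
    and p_pos: "0 < p" and p_odd: "odd p"
begin

sublocale glued_grid "set zs \<times> {..<d}" p "\<lambda>(z, i). {z} \<times> {..i}"
  using p_pos by unfold_locales auto

abbreviation "I \<equiv> set zs \<times> {..<d}"
abbreviation "R \<equiv> (\<lambda>(z, i). {z} \<times> {..i :: nat}) :: 'z \<times> nat \<Rightarrow> ('z \<times> nat) set"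

definition label :: "nat \<Rightarrow> 'z \<times> nat"
  where "label l = (zs ! (l div d), l mod d)"

lemma card_set_zs [simp]: "card (set zs) = length zs"
  using dist by (rule distinct_card)

lemma card_coordinates: "card I = length zs * d"
  using dist by (simp add: card_cartesian_product distinct_card)

lemma label_in_coordinates:
  assumes "l < card I"
  shows "label l \<in> I"
proof -
  have "0 < d" using assms card_coordinates by (cases d) auto
  moreover have "l div d < length zs"
    using assms card_coordinates by (simp add: less_mult_imp_div_less)
  ultimately show ?thesis by (auto simp: label_def)
qed

lemma label_surj:
  assumes "q < length zs" "k < d"
  shows "q * d + k < card I" "label (q * d + k) = (zs ! q, k)"
proof -
  have "q * d + k < Suc q * d" using assms by simp
  also have "\<dots> \<le> length zs * d"
    using assms by (intro mult_le_mono1) auto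
  finally show "q * d + k < card I" by (simp add: card_coordinates)
  show "label (q * d + k) = (zs ! q, k)"
    using assms by (simp add: label_def)
qed

lemma label_inj: "\<lbrakk>l < card I; m < card I; label l = label m\<rbrakk> \<Longrightarrow> l = m"
proof -
  assume a: "l < card I" "m < card I" "label l = label m"
  have "l div d < length zs" "m div d < length zs"
    using a card_coordinates by (simp_all add: less_mult_imp_div_less)
  then have "l div d = m div d" "l mod d = m mod d"
    using a dist by (auto simp: label_def nth_eq_iff_index_eq)
  then show "l = m" by (metis div_mult_mod_eq)
qed

lemma earlier_same_site:
  assumes "l < card I" "i < snd (label l)"
  shows "\<exists>m<l. label m = (fst (label l), i)"
proof (intro exI[of _ "l - (snd (label l) - i)"] conjI)
  have *: "l = (l div d) * d + snd (label l)"
    by (simp add: label_def)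
  have d: "snd (label l) < d"
    using label_in_coordinates[OF assms(1)] by (cases "label l") auto
  have q: "l div d < length zs"
    using assms card_coordinates by (simp add: less_mult_imp_div_less)
  show "l - (snd (label l) - i) < l"
    using * assms(2) by linarith
  have "l - (snd (label l) - i) = (l div d) * d + i"
    using * assms(2) by linarith
  then show "label (l - (snd (label l) - i)) = (fst (label l), i)"
    using label_surj(2)[OF q, of i] d assms(2) by (simp add: label_def)
qed

lemma earlier_ancestor:
  assumes "l < card I" "A z (fst (label l))" "z \<in> set zs" "i < d"
  shows "\<exists>m<l. label m = (z, i)"
proof -
  have q: "l div d < length zs"
    using assms card_coordinates by (simp add: less_mult_imp_div_less)
  obtain j where j: "j < length zs" "z = zs ! j"
    using assms(3) by (auto simp: in_set_conv_nth)
  then have "j < l div d"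
    using order[OF j(1) q] assms(2) by (simp add: label_def)
  then have "j * d + d \<le> (l div d) * d"
    by (metis Suc_leI mult_Suc add.commute mult_le_mono1)
  then have "j * d + i < (l div d) * d"
    using assms(4) by linarith
  also have "\<dots> \<le> l" by simp
  finally show ?thesis
    using label_surj(2)[OF j(1) assms(4)] j(2) by blast
qed

abbreviation "X \<equiv> sphere_point d p :: _ \<Rightarrow> 'z \<Rightarrow> nat \<Rightarrow> real"

text \<open>The reference functions: the \<open>k\<close>-th coordinate on the sphere at
  \<open>y\<close>, corrected to have the required parities at the ancestors.\<close>

definition reference :: "nat \<Rightarrow> ('z \<times> nat \<Rightarrow> int) \<Rightarrow> 2"
  where "reference l w = odd_sign d (snd (label l)) (X w (fst (label l))) +
    (\<Sum>z\<in>{z\<in>set zs. A z (fst (label l))}. odd_sign d 0 (X w z))"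

lemma X_reflect:
  assumes "i < d" "w (z, i) \<in> {0, 2 * p}"
  shows "X (reflect (R (z, i)) w) = (X w)(z := \<lambda>k. - X w z k)"
proof (intro ext)
  fix y k
  show "X (reflect (R (z, i)) w) y k = ((X w)(z := \<lambda>k. - X w z k)) y k"
  proof (cases "y = z")
    case True
    have "angle p (2 * p - m) = pi - angle p m" for m
      using p_pos by (simp add: angle_def field_simps)
    then have "(\<lambda>j. angle p (reflect (R (z, i)) w (z, j))) = (\<lambda>j. if j \<le> i then pi - angle p (w (z, j)) else angle p (w (z, j)))"
      by (auto simp: reflect_def)
    moreover have "sin (angle p (w (z, i))) = 0"
      using assms(2) p_pos by (auto simp: angle_def)
    ultimately show ?thesis
      using polar_reflect[OF assms(1), of "\<lambda>j. angle p (w (z, j))" k] True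
      by (simp add: sphere_point_def)
  qed (simp add: sphere_point_def reflect_def)
qed

definition twist :: "nat \<Rightarrow> 'z \<times> nat \<Rightarrow> 2"
  where "twist l = (\<lambda>(z, i). of_bool (z = fst (label l)) + of_bool (A z (fst (label l))))"

lemma not_A_self: "z \<in> set zs \<Longrightarrow> \<not> A z z"
  using order by (fastforce simp: in_set_conv_nth)

lemma glued_reference: "glued (twist l) (reference l)"
  unfolding glued_def
proof clarify
  fix w z i
  assume w: "w \<in> grid" "w (z, i) \<in> {0, 2 * p}" and zi: "z \<in> set zs" "i < d"
  let ?y = "fst (label l)" and ?w = "reflect ({z} \<times> {..i}) w"
  have X: "X ?w = (X w)(z := \<lambda>k. - X w z k)"
    using X_reflect zi(2) w(2) by simp
  have os: "odd_sign d k (X ?w y) = odd_sign d k (X w y) + of_bool (z = y)" for k y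
  proof (cases "z = y")
    case True
    obtain j where "X w z j \<noteq> 0" using sphere_point_nonzero[of d p w z] by auto
    then show ?thesis
      using odd_sign_uminus[of "X w z" j d k] True unfolding X by simp
  next
    case False
    then show ?thesis unfolding X by simp
  qed
  have T: "(\<Sum>y\<in>{y\<in>set zs. A y ?y}. of_bool (z = y) :: 2) = of_bool (A z ?y)"
    using zi by (simp add: of_bool_def)
  show "reference l ?w = reference l w + twist l (z, i)"
    unfolding reference_def os sum.distrib T by (simp only: twist_def prod.case add_ac)
qed

lemma X_cong: "(\<And>k. w (z, k) = w' (z, k)) \<Longrightarrow> X w z = X w' z"
  by (simp add: sphere_point_def)

text \<open>After the first \<open>k\<close> angles of a site have become \<open>\<pi> / 2\<close>, the
  \<open>k\<close>-th reference function has the sign of the cosine of the next angle. It can only change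
  when this angle moves to \<open>\<pi> / 2\<close>, and there it takes the sign of the next coordinate.
  The correction terms do not change, as ancestors come first in the list and their angles have already
  moved. Thus in a flag that carries sign changes of all reference functions, the path runs through the
  coordinates in the order of the labels, and ends with all angles equal to \<open>\<pi> /
  2\<close>.\<close>

lemma reference_step:
  assumes \<sigma>: "(a, c, \<pi>) \<in> flags" and l: "l < card I"
    and prev: "\<And>m. m < l \<Longrightarrow> \<pi> ! m = label m \<and> c (label m) = p"
    and y: "label l = (y, k)"
  shows "reference l (vertex (a, c, \<pi>) l) \<noteq> reference l (vertex (a, c, \<pi>) (Suc l)) \<longleftrightarrow>
    \<pi> ! l = label l \<and> c (label l) = p \<and> (p < a (y, k)) \<noteq> (Suc k < d \<and> p < a (y, Suc k))"
proof -
  let ?v = "vertex (a, c, \<pi>) l" and ?v' = "vertex (a, c, \<pi>) (Suc l)"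
  have len: "length \<pi> = card I"
    using \<sigma> by (rule length_flag)
  have \<pi>: "distinct \<pi>" "set \<pi> = I" and ac: "\<And>i. i \<in> I \<Longrightarrow> even (a i) \<and> odd (c i) \<and> \<bar>a i - c i\<bar> = 1"
    and bds: "\<And>i. i \<in> I \<Longrightarrow> 0 \<le> a i \<and> a i \<le> 2 * p \<and> 0 \<le> c i \<and> c i \<le> 2 * p"
    using \<sigma> by (auto simp: flags_def grid_def PiE_iff)
  have take: "set (take l \<pi>) = label ` {..<l}"
  proof -
    have "take l \<pi> = map label [0..<l]"
      using l len prev by (intro nth_equalityI) auto
    then show ?thesis by (simp add: atLeast0LessThan)
  qed
  have take': "set (take (Suc l) \<pi>) = insert (\<pi> ! l) (set (take l \<pi>))"
    using l len by (simp add: take_Suc_conv_app_nth)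
  have yk: "y \<in> set zs" "k < d"
    using label_in_coordinates[OF l] y by auto
  have reached: "?v (label m) = p" "?v' (label m) = p" if "m < l" for m
    using that prev take take' by (auto simp: vertex_def)
  have fresh: "?v i = a i" if "i \<notin> label ` {..<l}" for i
    using that take by (auto simp: vertex_def)
  have step: "?v' i = (if i = \<pi> ! l then c i else ?v i)" for i
    using take' by (auto simp: vertex_def)
  have \<pi>l: "\<pi> ! l \<in> I" "\<pi> ! l \<notin> label ` {..<l}"
  proof -
    show "\<pi> ! l \<in> I" using l len \<pi>(2) nth_mem by metis
    have "\<pi> ! l \<noteq> \<pi> ! m" if "m < l" for m
      using \<pi>(1) l len that by (simp add: nth_eq_iff_index_eq)
    then show "\<pi> ! l \<notin> label ` {..<l}" using prev by fastforce
  qed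
  have anc: "X ?v' z = X ?v z" if "A z y" "z \<in> set zs" for z
  proof -
    have "\<pi> ! l \<noteq> (z, i)" for i
    proof
      assume "\<pi> ! l = (z, i)"
      then have "i < d" using \<pi>l(1) by auto
      then show False
        using earlier_ancestor[OF l, of z i] that y \<pi>l(2) \<open>\<pi> ! l = (z, i)\<close> by (metis fst_conv imageI lessThan_iff)
    qed
    then show ?thesis by (intro X_cong) (metis step)
  qed
  have "(\<Sum>z\<in>{z\<in>set zs. A z y}. odd_sign d 0 (X ?v' z)) = (\<Sum>z\<in>{z\<in>set zs. A z y}. odd_sign d 0 (X ?v z))"
    by (rule sum.cong) (auto simp: anc)
  then have red: "reference l ?v \<noteq> reference l ?v' \<longleftrightarrow> odd_sign d k (X ?v y) \<noteq> odd_sign d k (X ?v' y)"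
    by (simp add: reference_def y)
  have before: "\<exists>m<l. label m = (y, i)" if "i < k" for i
    using earlier_same_site[OF l, of i] y that by simp
  have later: "(y, i) \<notin> label ` {..<l}" if "k \<le> i" for i
  proof
    assume "(y, i) \<in> label ` {..<l}"
    then obtain m where m: "m < l" "label m = (y, i)" by auto
    have ml: "m < card I" using m l by simp
    have "m div d < length zs" "l div d < length zs"
      using ml l card_coordinates by (simp_all add: less_mult_imp_div_less)
    then have "m div d = l div d"
      using m y dist by (auto simp: label_def nth_eq_iff_index_eq)
    moreover have "l mod d \<le> m mod d"
      using m y that by (simp add: label_def)
    ultimately have "l \<le> m"
      using div_mult_mod_eq[of l d] div_mult_mod_eq[of m d] by (metis add_le_cancel_left)
    then show False using m by simp
  qed
  have even_ne: "a i \<noteq> p" if "i \<in> I" for i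
    using ac[OF that] p_odd by auto
  have ayk: "0 \<le> a (y, k)" "a (y, k) \<le> 2 * p" "a (y, k) \<noteq> p"
    using bds[of "(y, k)"] even_ne[of "(y, k)"] yk by auto
  have vk: "odd_sign d k (X ?v y) = of_bool (p < a (y, k))"
  proof -
    have eq: "?v (y, k) = a (y, k)" using fresh later[of k] by simp
    have "?v (y, i) = p" if "i < k" for i
    proof -
      obtain m where m: "m < l" "label m = (y, i)"
        using before[OF \<open>i < k\<close>] by blast
      show ?thesis using reached(1)[OF m(1)] unfolding m(2) .
    qed
    then show ?thesis
      using sphere_point_sign[of p k d ?v y] p_pos yk ayk eq by simp
  qed
  show ?thesis
  proof (cases "\<pi> ! l = label l")
    case False
    then have eq: "?v' (y, k) = a (y, k)"
      using step[of "(y, k)"] fresh later[of k] y by auto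
    have "?v' (y, i) = p" if "i < k" for i
    proof -
      obtain m where m: "m < l" "label m = (y, i)"
        using before[OF \<open>i < k\<close>] by blast
      show ?thesis using reached(2)[OF m(1)] unfolding m(2) .
    qed
    then have "odd_sign d k (X ?v' y) = of_bool (p < a (y, k))"
      using sphere_point_sign[of p k d ?v' y] p_pos yk ayk eq by simp
    then show ?thesis using red vk False by simp
  next
    case True
    have eq: "?v' (y, k) = c (y, k)"
      using step[of "(y, k)"] True y by simp
    show ?thesis
    proof (cases "c (y, k) = p")
      case False
      have "?v' (y, i) = p" if "i < k" for i
      proof -
      obtain m where m: "m < l" "label m = (y, i)"
        using before[OF \<open>i < k\<close>] by blast
      show ?thesis using reached(2)[OF m(1)] unfolding m(2) .
    qed
      then have "odd_sign d k (X ?v' y) = of_bool (p < c (y, k))"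
        using sphere_point_sign[of p k d ?v' y] p_pos yk eq False bds[of "(y, k)"] by simp
      moreover have "p < c (y, k) \<longleftrightarrow> p < a (y, k)"
        using False ayk ac[of "(y, k)"] yk by auto
      ultimately show ?thesis using red vk False y by simp
    next
      case c: True
      have "odd_sign d k (X ?v' y) = of_bool (Suc k < d \<and> p < ?v' (y, Suc k))"
      proof (rule sphere_point_sign_next[OF p_pos yk(2)])
        show "?v' (y, i) = p" if "i \<le> k" for i
        proof (cases "i = k")
          case True
          then show ?thesis using eq c by simp
        next
          case False
          then obtain m where "m < l" "label m = (y, i)"
            using before[of i] \<open>i \<le> k\<close> by auto
          then show ?thesis using reached(2)[of m] by simp
        qed
        show "0 \<le> ?v' (y, Suc k) \<and> ?v' (y, Suc k) \<le> 2 * p \<and> ?v' (y, Suc k) \<noteq> p" if "Suc k < d"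
          using that step[of "(y, Suc k)"] fresh later[of "Suc k"] True y bds[of "(y, Suc k)"] even_ne[of "(y, Suc k)"] yk by auto
      qed
      moreover have "?v' (y, Suc k) = a (y, Suc k)"
        using step[of "(y, Suc k)"] fresh later[of "Suc k"] True y by auto
      ultimately show ?thesis using red vk True c y by auto
    qed
  qed
qed

text \<open>The only flag on which all reference functions change. The last coordinate \<open>\<Prod>i<d.
  sin \<theta>\<^sub>i\<close> is positive, so the last angle of each site has to start above \<open>\<pi>
  / 2\<close>; going backwards, the initial angles lie alternately above and below \<open>\<pi> /
  2\<close>.\<close>

definition turning_flag :: "('z \<times> nat \<Rightarrow> int) \<times> ('z \<times> nat \<Rightarrow> int) \<times> ('z \<times> nat) list"
  where "turning_flag = (\<lambda>i\<in>I. p + (if odd (d - snd i) then 1 else - 1), \<lambda>i\<in>I. p, map label [0..<card I])"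

lemma turning_flag_flags: "turning_flag \<in> flags"
proof -
  have "inj_on label {0..<card I}"
    using label_inj by (auto simp: inj_on_def)
  moreover have "label ` {0..<card I} = I"
  proof (rule card_subset_eq)
    show "label ` {0..<card I} \<subseteq> I" using label_in_coordinates by (metis atLeastLessThan_iff image_subsetI)
    show "card (label ` {0..<card I}) = card I"
      using \<open>inj_on label _\<close> by (simp add: card_image)
  qed simp
  ultimately show ?thesis
    using p_pos p_odd by (auto simp: flags_def turning_flag_def grid_def distinct_map)
qed

lemma reference_all_iff:
  assumes \<sigma>: "\<sigma> \<in> flags"
  shows "(\<forall>l<card I. reference l (vertex \<sigma> l) \<noteq> reference l (vertex \<sigma> (Suc l))) \<longleftrightarrow> \<sigma> = turning_flag"
proof -
  obtain a c \<pi> where eq: "\<sigma> = (a, c, \<pi>)" by (cases \<sigma>)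
  note \<sigma> = \<sigma>[unfolded eq]
  let ?C = "\<lambda>l. reference l (vertex (a, c, \<pi>) l) \<noteq> reference l (vertex (a, c, \<pi>) (Suc l))"
  let ?alt = "\<lambda>y k. (p < a (y, k)) \<noteq> (Suc k < d \<and> p < a (y, Suc k))"
  have len: "length \<pi> = card I"
    using \<sigma> by (rule length_flag)
  have ext: "a \<in> grid" "c \<in> grid" and ac: "\<And>i. i \<in> I \<Longrightarrow> \<bar>a i - c i\<bar> = 1"
    using \<sigma> by (auto simp: flags_def)
  have fwd: "\<sigma> = turning_flag" if C: "\<forall>l<card I. ?C l"
  proof -
    have *: "\<pi> ! l = label l \<and> c (label l) = p" if "l < card I" for l
      using that
    proof (induction l rule: less_induct)
      case (less l)
      obtain y k where y: "label l = (y, k)" by force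
      show ?case
        using reference_step[OF \<sigma> less.prems _ y] less C by auto
    qed
    have \<pi>: "\<pi> = map label [0..<card I]"
      using * len by (auto intro: nth_equalityI)
    have all: "c (y, k) = p \<and> ?alt y k" if yk: "y \<in> set zs" "k < d" for y k
    proof -
      obtain q where q: "q < length zs" "y = zs ! q"
        using yk(1) by (auto simp: in_set_conv_nth)
      note ls = label_surj[OF q(1) yk(2), folded q(2)]
      show ?thesis
        using reference_step[OF \<sigma> ls(1) _ ls(2)] * ls C by auto
    qed
    have side: "p < a (y, k) \<longleftrightarrow> odd (d - k)" if "y \<in> set zs" "k < d" for y k
      using that(2)
    proof (induction "d - k" arbitrary: k rule: less_induct)
      case less
      show ?case
      proof (cases "Suc k < d")
        case True
        then have "p < a (y, Suc k) \<longleftrightarrow> odd (d - Suc k)"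
          using less by simp
        moreover have "d - k = Suc (d - Suc k)" using True by simp
        ultimately show ?thesis
          using all[OF that(1) less.prems] True by auto
      next
        case False
        then have "d - k = 1" using less.prems by simp
        then show ?thesis
          using all[OF that(1) less.prems] False by simp
      qed
    qed
    have "a i = p + (if odd (d - snd i) then 1 else - 1)" if "i \<in> I" for i
      using that side[of "fst i" "snd i"] all[of "fst i" "snd i"] ac[OF that] by (cases i) auto
    moreover have "c i = p" if "i \<in> I" for i
      using that all by auto
    ultimately show ?thesis
      using ext unfolding eq turning_flag_def \<pi>
      by (auto simp: grid_def PiE_iff extensional_def fun_eq_iff)
  qed
  have bwd: "?C l" if "\<sigma> = turning_flag" "l < card I" for l
  proof -
    obtain y k where y: "label l = (y, k)" by force
    have yk: "y \<in> set zs" "k < d" using label_in_coordinates[OF that(2)] y by auto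
    have trn: "a = (\<lambda>i\<in>I. p + (if odd (d - snd i) then 1 else - 1))" "c = (\<lambda>i\<in>I. p)" "\<pi> = map label [0..<card I]"
      using \<open>\<sigma> = turning_flag\<close> unfolding eq turning_flag_def by (simp_all only: prod.inject)
    have a: "a (z, i) = p + (if odd (d - i) then 1 else - 1)" if "z \<in> set zs" "i < d" for z i
      using that by (simp add: trn)
    have "d - k = Suc (d - Suc k)" using yk by simp
    moreover have "\<pi> ! m = label m \<and> c (label m) = p" if "m < card I" for m
    proof
      show "\<pi> ! m = label m" using that unfolding trn(3) by (simp only: nth_map_upt) simp
      show "c (label m) = p" unfolding trn(2) using label_in_coordinates[OF that] by (rule restrict_apply')
    qed
    ultimately show ?thesis
      using reference_step[OF \<sigma> that(2) _ y] that(2) a[OF yk] a[of y "Suc k"] yk by (cases "Suc k < d") (auto simp: not_less le_Suc_eq)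
  qed
  have "(\<forall>l<card I. ?C l) \<longleftrightarrow> \<sigma> = turning_flag"
  proof
    assume "\<forall>l<card I. ?C l"
    then show "\<sigma> = turning_flag" by (rule fwd)
  next
    assume "\<sigma> = turning_flag"
    then show "\<forall>l<card I. ?C l" using bwd by simp
  qed
  then show ?thesis unfolding eq .
qed

lemma total_reference: "total reference = 1"
proof -
  have "(\<Prod>l<card I. (reference l (vertex \<sigma> l) + reference l (vertex \<sigma> (Suc l)))) = of_bool (\<sigma> = turning_flag)"
    if "\<sigma> \<in> flags" for \<sigma>
  proof (cases "\<sigma> = turning_flag")
    case True
    then have "\<forall>l<card I. reference l (vertex \<sigma> l) + reference l (vertex \<sigma> (Suc l)) = 1"
      using reference_all_iff[OF that] of_bool_2_neq nonzero_2 by blast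
    then show ?thesis using True by simp
  next
    case False
    then have "\<exists>l<card I. reference l (vertex \<sigma> l) + reference l (vertex \<sigma> (Suc l)) = 0"
      using reference_all_iff[OF that] of_bool_2_neq by metis
    then show ?thesis using False by (auto intro!: prod_zero)
  qed
  then have "total reference = (\<Sum>\<sigma>\<in>flags. of_bool (\<sigma> = turning_flag))"
    unfolding total_def by (intro sum.cong) auto
  also have "\<dots> = 1"
    using turning_flag_flags finite_flags by (simp add: of_bool_def)
  finally show ?thesis .
qed

lemma sign_changes:
  assumes "\<And>l. l < card I \<Longrightarrow> glued (twist l) (s l)"
  obtains \<sigma> where "\<sigma> \<in> flags" "\<And>l. l < card I \<Longrightarrow> s l (vertex \<sigma> l) \<noteq> s l (vertex \<sigma> (Suc l))"
proof -
  have "total s = 1"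
    using total_eq[of twist s reference] assms glued_reference total_reference by simp
  then have "total s \<noteq> 0" by simp
  then obtain \<sigma> where \<sigma>: "\<sigma> \<in> flags" "(\<Prod>l<card I. (s l (vertex \<sigma> l) + s l (vertex \<sigma> (Suc l)))) \<noteq> 0"
    unfolding total_def by (rule sum.not_neutral_contains_not_neutral)
  have "s l (vertex \<sigma> l) + s l (vertex \<sigma> (Suc l)) \<noteq> 0" if "l < card I" for l
    using \<sigma>(2) that by (metis (no_types, lifting) finite_lessThan lessThan_iff prod_zero)
  then show thesis
    using that[OF \<sigma>(1)] of_bool_2_neq by blast
qed

end

text \<open>A Borsuk-Ulam theorem for a product of \<open>d\<close>-dimensional spheres with
  \<open>d\<close> real functions per sphere. If \<open>A\<close> is empty, then the functions attached to
  a sphere are odd in its variable and even in the others. The conclusion gives, instead of a zero, a grid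
  point where all functions are small: a countable set of points is then enough for all functions.\<close>

lemma common_near_zero:
  fixes F :: "'z \<times> nat \<Rightarrow> ('z \<Rightarrow> nat \<Rightarrow> real) \<Rightarrow> real"
  assumes dist: "distinct zs"
    and order: "\<And>i j. \<lbrakk>i < length zs; j < length zs; A (zs ! i) (zs ! j)\<rbrakk> \<Longrightarrow> i < j"
    and odd: "\<And>x z y k. \<lbrakk>z \<in> set zs; y \<in> set zs; k < d\<rbrakk> \<Longrightarrow>
      F (y, k) (x(z := \<lambda>i. - x z i)) = (if z = y \<or> A z y then - F (y, k) x else F (y, k) x)"
    and lipschitz: "\<And>x x' y k. \<lbrakk>y \<in> set zs; k < d; \<And>z i. \<bar>x z i\<bar> \<le> 1; \<And>z i. \<bar>x' z i\<bar> \<le> 1;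
        \<And>z i. d < i \<Longrightarrow> x z i = x' z i\<rbrakk> \<Longrightarrow> \<bar>F (y, k) x - F (y, k) x'\<bar> \<le> C * (\<Sum>z\<in>set zs. \<Sum>i\<le>d. \<bar>x z i - x' z i\<bar>)"
    and "0 \<le> C" "0 < \<epsilon>"
  obtains p w where "\<And>y k. \<lbrakk>y \<in> set zs; k < d\<rbrakk> \<Longrightarrow> \<bar>F (y, k) (sphere_point d p w)\<bar> < \<epsilon>"
proof -
  define M where "M = C * (real (length zs) * (real (Suc d) * (real d * pi)))"
  \<comment> \<open>The mesh has to be so fine that the functions vary by less than \<open>\<epsilon> / 2\<close> within a cell.\<close>
  define p where "p = 2 * \<lceil>M / \<epsilon>\<rceil> + 1"
  have M: "0 \<le> M" using assms(5) by (simp add: M_def)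
  then have "0 \<le> M / \<epsilon>" using assms(6) by simp
  then have ceil: "0 \<le> \<lceil>M / \<epsilon>\<rceil>" by linarith
  have p: "0 < p" "odd p" using ceil by (auto simp: p_def)
  have "M / \<epsilon> < of_int p" using ceil by (simp add: p_def) linarith
  then have Mp: "M / of_int p < \<epsilon>"
    using p assms(6) by (simp add: field_simps)
  interpret sites zs A d p
    using dist order p by unfold_locales
  define f where "f l w = F (label l) (X w)" for l w
  \<comment> \<open>Where \<open>f l\<close> vanishes, the reference function decides; this keeps the parities.\<close>
  define s where "s l w = (if 0 < f l w then 1 else if f l w < 0 then 0 else reference l w)" for l w
  have g: "glued (twist l) (s l)" if l: "l < card I" for l
    unfolding glued_def
  proof clarify
    fix w z i
    assume w: "w \<in> grid" "w (z, i) \<in> {0, 2 * p}" and zi: "z \<in> set zs" "i < d"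
    let ?w = "reflect ({z} \<times> {..i}) w"
    obtain y k where y: "label l = (y, k)" by force
    have yk: "y \<in> set zs" "k < d" using label_in_coordinates[OF l] y by auto
    have reference: "reference l ?w = reference l w + twist l (z, i)"
      using glued_reference[of l] w zi unfolding glued_def by fastforce
    have tw: "twist l (z, i) = of_bool (z = y \<or> A z y)"
      using not_A_self[OF yk(1)] by (auto simp: twist_def y)
    have "X ?w = (X w)(z := \<lambda>k. - X w z k)"
      using X_reflect[of i w z] zi(2) w(2) by simp
    then have "f l ?w = (if z = y \<or> A z y then - f l w else f l w)"
      using odd[OF zi(1) yk] by (simp add: f_def y)
    then show "s l ?w = s l w + twist l (z, i)"
      unfolding s_def reference tw by (auto simp: not_less)
  qed
  obtain \<sigma> where \<sigma>: "\<sigma> \<in> flags" "\<And>l. l < card I \<Longrightarrow> s l (vertex \<sigma> l) \<noteq> s l (vertex \<sigma> (Suc l))"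
    by (rule sign_changes[of s, OF g]) blast+
  have near: "\<bar>f l (vertex \<sigma> m) - f l (vertex \<sigma> m')\<bar> \<le> M / (2 * of_int p)" if l: "l < card I" for l m m'
  proof -
    let ?v = "vertex \<sigma> m" and ?v' = "vertex \<sigma> m'"
    obtain y k where y: "label l = (y, k)" by force
    have yk: "y \<in> set zs" "k < d" using label_in_coordinates[OF l] y by auto
    have vv: "\<bar>?v j - ?v' j\<bar> \<le> 1" for j
    proof -
      obtain a c \<pi> where eq: "\<sigma> = (a, c, \<pi>)" by (cases \<sigma>)
      show ?thesis
      proof (cases "j \<in> I")
        case True
        then have "\<bar>a j - c j\<bar> = 1" using \<sigma>(1) by (auto simp: flags_def eq)
        then show ?thesis by (auto simp: eq vertex_def)
      next
        case False
        then have "j \<notin> set \<pi>" using \<sigma>(1) by (auto simp: flags_def eq)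
        then show ?thesis by (auto simp: eq vertex_def dest: in_set_takeD)
      qed
    qed
    have "\<bar>X ?v z i - X ?v' z i\<bar> \<le> real d * (pi / (2 * of_int p))" for z i
    proof -
      have "\<bar>X ?v z i - X ?v' z i\<bar> \<le> (\<Sum>i<d. \<bar>angle p (?v (z, i)) - angle p (?v' (z, i))\<bar>)"
        unfolding sphere_point_def by (rule polar_lipschitz)
      also have "\<dots> \<le> (\<Sum>i<d. pi / (2 * of_int p))"
      proof (rule sum_mono)
        fix i
        have "angle p (?v (z, i)) - angle p (?v' (z, i)) = (pi / (2 * of_int p)) * of_int (?v (z, i) - ?v' (z, i))"
          by (simp add: angle_def diff_divide_distrib right_diff_distrib)
        then have "\<bar>angle p (?v (z, i)) - angle p (?v' (z, i))\<bar> = (pi / (2 * of_int p)) * of_int \<bar>?v (z, i) - ?v' (z, i)\<bar>"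
          using p by (simp add: abs_mult)
        also have "\<dots> \<le> (pi / (2 * of_int p)) * 1"
          using vv[of "(z, i)"] p by (intro mult_left_mono) auto
        finally show "\<bar>angle p (?v (z, i)) - angle p (?v' (z, i))\<bar> \<le> pi / (2 * of_int p)" by simp
      qed
      finally show ?thesis by simp
    qed
    then have "(\<Sum>z\<in>set zs. \<Sum>i\<le>d. \<bar>X ?v z i - X ?v' z i\<bar>) \<le>
        (\<Sum>z\<in>set zs. \<Sum>i\<le>d. real d * (pi / (2 * of_int p)))"
      by (intro sum_mono)
    also have "\<dots> = real (length zs) * (real (Suc d) * (real d * (pi / (2 * of_int p))))"
      by simp
    finally have "C * (\<Sum>z\<in>set zs. \<Sum>i\<le>d. \<bar>X ?v z i - X ?v' z i\<bar>) \<le>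
        C * (real (length zs) * (real (Suc d) * (real d * (pi / (2 * of_int p)))))"
      using assms(5) by (rule mult_left_mono)
    moreover have "\<dots> = M / (2 * of_int p)"
      by (simp add: M_def)
    moreover have "\<bar>f l ?v - f l ?v'\<bar> \<le> C * (\<Sum>z\<in>set zs. \<Sum>i\<le>d. \<bar>X ?v z i - X ?v' z i\<bar>)"
      unfolding f_def y using yk
      by (intro lipschitz) (auto simp: sphere_point_def polar_abs_le_1 polar_beyond)
    ultimately show ?thesis by linarith
  qed
  have small: "\<bar>f l (vertex \<sigma> 0)\<bar> < \<epsilon>" if l: "l < card I" for l
  proof -
    let ?a = "f l (vertex \<sigma> l)" and ?b = "f l (vertex \<sigma> (Suc l))"
    have "\<not> (0 < ?a \<and> 0 < ?b)" "\<not> (?a < 0 \<and> ?b < 0)"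
      using \<sigma>(2)[OF l] by (auto simp: s_def)
    then have "\<bar>?a\<bar> \<le> \<bar>?a - ?b\<bar>" by linarith
    also have "\<dots> \<le> M / (2 * of_int p)" by (rule near[OF l])
    finally have "\<bar>f l (vertex \<sigma> 0)\<bar> \<le> M / (2 * of_int p) + M / (2 * of_int p)"
      using near[OF l, of 0 l] by linarith
    then show ?thesis using Mp by (simp add: field_simps)
  qed
  show thesis
  proof (rule that[of p "vertex \<sigma> 0"])
    fix y k
    assume yk: "y \<in> set zs" "k < d"
    then obtain q where q: "q < length zs" "y = zs ! q"
      by (auto simp: in_set_conv_nth)
    show "\<bar>F (y, k) (X (vertex \<sigma> 0))\<bar> < \<epsilon>"
      using small[OF label_surj(1)[OF q(1) yk(2)]] label_surj(2)[OF q(1) yk(2)] q(2) by (simp add: f_def)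
  qed
qed

section \<open>Approximate joint eigenvectors\<close>

definition lookup_coord :: "((bool list \<times> nat) \<times> int) list \<Rightarrow> bool list \<times> nat \<Rightarrow> int"
  where "lookup_coord l j = (case map_of l j of None \<Rightarrow> 0 | Some m \<Rightarrow> m)"

text \<open>A countable family of configurations: grid points, given by finite association lists.\<close>

definition sample :: "nat \<Rightarrow> int \<times> ((bool list \<times> nat) \<times> int) list \<Rightarrow> bool list \<Rightarrow> nat \<Rightarrow> real"
  where "sample d \<rho> = sphere_point d (fst \<rho>) (lookup_coord (snd \<rho>))"

lemma countable_tree_rep_sample: "countable_tree_rep (sample d) d"
  by unfold_locales (simp_all add: sample_def sphere_point_def polar_abs_le_1 polar_norm)

text \<open>Polynomials of bounded degree only see finitely many spheres, so it suffices to match a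
  configuration there.\<close>

lemma sample_dense:
  assumes "finite S"
  obtains \<rho> where "\<And>z i. z \<in> S \<Longrightarrow> sample d \<rho> z i = sphere_point d p w z i"
proof -
  obtain js where js: "set js = S \<times> {..<d}"
    using assms finite_list[of "S \<times> {..<d}"] by auto
  define l where "l = map (\<lambda>j. (j, w j)) js"
  have l: "lookup_coord l j = w j" if "j \<in> S \<times> {..<d}" for j
    using that js by (simp add: lookup_coord_def l_def map_of_map_restrict restrict_map_def)
  have "sample d (p, l) z i = sphere_point d p w z i" if "z \<in> S" for z i
  proof -
    have "\<bar>sample d (p, l) z i - sphere_point d p w z i\<bar> \<le>
        (\<Sum>k<d. \<bar>angle p (lookup_coord l (z, k)) - angle p (w (z, k))\<bar>)"
      unfolding sample_def sphere_point_def fst_conv snd_conv by (rule polar_lipschitz)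
    also have "\<dots> = 0"
      using that by (intro sum.neutral) (simp add: l)
    finally show ?thesis by simp
  qed
  then show thesis by (rule that)
qed

lemma length_endpoint: "length (endpoint u) \<le> length u"
  by (induction u rule: endpoint.induct) auto

lemma amplitude_bound: "(\<And>z i. \<bar>x z i\<bar> \<le> 1) \<Longrightarrow> \<bar>amplitude x u\<bar> \<le> 1"
proof (induction u rule: endpoint.induct)
  case (2 i t u)
  then show ?case using mult_mono[of "\<bar>x (t # endpoint u) i\<bar>" 1 "\<bar>amplitude x u\<bar>" 1] by (simp add: abs_mult)
next
  case (3 i t u)
  then show ?case using mult_mono[of "\<bar>x (endpoint u) i\<bar>" 1 "\<bar>amplitude x u\<bar>" 1] by (simp add: abs_mult)
qed simp

lemma amplitude_lipschitz:
  assumes x: "\<And>z i. \<bar>x z i\<bar> \<le> 1" and x': "\<And>z i. \<bar>x' z i\<bar> \<le> 1"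
    and \<Delta>: "\<And>z i. z \<noteq> [] \<Longrightarrow> length z \<le> L \<Longrightarrow> \<bar>x z i - x' z i\<bar> \<le> \<Delta>" and "0 \<le> \<Delta>"
    and "length u \<le> L"
  shows "\<bar>amplitude x u - amplitude x' u\<bar> \<le> real (length u) * \<Delta>"
  using assms(5)
proof (induction u rule: endpoint.induct)
  case (2 i t u)
  have "\<bar>x (t # endpoint u) i * amplitude x u - x' (t # endpoint u) i * amplitude x' u\<bar> \<le>
      \<bar>x (t # endpoint u) i - x' (t # endpoint u) i\<bar> * \<bar>amplitude x u\<bar> +
      \<bar>x' (t # endpoint u) i\<bar> * \<bar>amplitude x u - amplitude x' u\<bar>"
    unfolding abs_mult[symmetric] by (rule order_trans[OF _ abs_triangle_ineq]) (simp add: algebra_simps)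
  also have "\<dots> \<le> \<Delta> * 1 + 1 * (real (length u) * \<Delta>)"
    using 2 length_endpoint[of u] \<open>0 \<le> \<Delta>\<close>
    by (intro add_mono mult_mono \<Delta> x' amplitude_bound x) auto
  finally show ?case by (simp add: algebra_simps)
next
  case (3 i t u)
  show ?case
  proof (cases "endpoint u \<noteq> [] \<and> hd (endpoint u) = t")
    case True
    have "\<bar>x (endpoint u) i * amplitude x u - x' (endpoint u) i * amplitude x' u\<bar> \<le>
        \<bar>x (endpoint u) i - x' (endpoint u) i\<bar> * \<bar>amplitude x u\<bar> +
        \<bar>x' (endpoint u) i\<bar> * \<bar>amplitude x u - amplitude x' u\<bar>"
      unfolding abs_mult[symmetric] by (rule order_trans[OF _ abs_triangle_ineq]) (simp add: algebra_simps)
    also have "\<dots> \<le> \<Delta> * 1 + 1 * (real (length u) * \<Delta>)"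
      using 3 True length_endpoint[of u] \<open>0 \<le> \<Delta>\<close>
      by (intro add_mono mult_mono \<Delta> x' amplitude_bound x) auto
    finally show ?thesis using True by (simp add: algebra_simps)
  next
    case False
    then show ?thesis using \<open>0 \<le> \<Delta>\<close> by auto
  qed
qed simp

text \<open>Changing the sign of \<open>x z\<close> amounts to conjugation with the diagonal operator
  that is \<open>-1\<close> on the subtree at \<open>z\<close>. In other words, a path from the root to the
  node \<open>y\<close> crosses the edge above \<open>z\<close> an odd number of times if and only if
  \<open>z\<close> is a suffix of \<open>y\<close>.\<close>

lemma amplitude_flip:
  assumes "z \<noteq> []"
  shows "amplitude (x(z := \<lambda>i. - x z i)) u = (if suffix z (endpoint u) then - amplitude x u else amplitude x u)"
proof (induction u rule: endpoint.induct)
  case 1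
  then show ?case using assms by simp
next
  case (2 i t u)
  have "\<not> suffix (t # endpoint u) (endpoint u)"
    using suffix_length_le[of "t # endpoint u" "endpoint u"] by auto
  then show ?case
    using 2 by (auto simp: suffix_Cons)
next
  case (3 i t u)
  show ?case
  proof (cases "endpoint u")
    case Nil
    then show ?thesis using assms by simp
  next
    case (Cons s y)
    have "\<not> suffix (s # y) y"
      using suffix_length_le[of "s # y" y] by auto
    then show ?thesis
      using 3 Cons by (auto simp: suffix_Cons)
  qed
qed

definition component :: "(complex \<times> letter list) list \<Rightarrow> bool list \<Rightarrow> (bool list \<Rightarrow> nat \<Rightarrow> real) \<Rightarrow> complex"
  where "component ps y x = (\<Sum>(c, u)\<leftarrow>ps. if endpoint u = y then c * of_real (amplitude x u) else 0)"

lemma component_simps [simp]: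
  "component [] y x = 0"
  "component (cu # ps) y x = (if endpoint (snd cu) = y then fst cu * of_real (amplitude x (snd cu)) else 0) + component ps y x"
  by (simp_all add: component_def split: prod.split)

lemma component_flip:
  assumes "z \<noteq> []"
  shows "component ps y (x(z := \<lambda>i. - x z i)) = (if suffix z y then - component ps y x else component ps y x)"
proof (induction ps)
  case (Cons cu ps)
  show ?case
    unfolding component_simps amplitude_flip[OF assms] Cons.IH by auto
qed simp

lemma component_zero: "\<forall>(c, u)\<in>set ps. length u \<le> L \<Longrightarrow> L < length y \<Longrightarrow> component ps y x = 0"
proof (induction ps)
  case (Cons cu ps)
  then have "endpoint (snd cu) \<noteq> y"
    using length_endpoint[of "snd cu"] by (cases cu) auto
  then show ?case using Cons by simp
qed simp

lemma component_lipschitz: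
  assumes "\<And>z i. \<bar>x z i\<bar> \<le> 1" and "\<And>z i. \<bar>x' z i\<bar> \<le> 1"
    and "\<And>z i. z \<noteq> [] \<Longrightarrow> length z \<le> L \<Longrightarrow> \<bar>x z i - x' z i\<bar> \<le> \<Delta>" and "0 \<le> \<Delta>"
    and "\<forall>(c, u)\<in>set ps. length u \<le> L"
  shows "cmod (component ps y x - component ps y x') \<le> (\<Sum>(c, u)\<leftarrow>ps. cmod c * real (length u)) * \<Delta>"
  using assms(5)
proof (induction ps)
  case (Cons cu ps)
  obtain c u where cu: "cu = (c, u)" by force
  let ?g = "\<lambda>x. if endpoint u = y then c * complex_of_real (amplitude x u) else 0"
  have "cmod (?g x - ?g x') \<le> cmod c * \<bar>amplitude x u - amplitude x' u\<bar>"
    by (auto simp: norm_mult simp flip: right_diff_distrib of_real_diff)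
  also have "\<dots> \<le> cmod c * (real (length u) * \<Delta>)"
    using Cons.prems cu by (intro mult_left_mono amplitude_lipschitz[OF assms(1-4)]) auto
  finally have "cmod (?g x - ?g x') + cmod (component ps y x - component ps y x') \<le>
      cmod c * (real (length u) * \<Delta>) + (\<Sum>(c, u)\<leftarrow>ps. cmod c * real (length u)) * \<Delta>"
    using Cons by (intro add_mono) auto
  moreover have "cmod (component (cu # ps) y x - component (cu # ps) y x') \<le>
      cmod (?g x - ?g x') + cmod (component ps y x - component ps y x')"
    unfolding cu component_simps fst_conv snd_conv by (rule norm_diff_triangle_ineq)
  ultimately show ?case
    by (simp add: cu algebra_simps)
qed simp

lemma (in tree_rep) poly_op_root:
  "coord (poly_op ps (ket (\<rho>, []))) (\<rho>', y) = (if \<rho>' = \<rho> then component ps y (X \<rho>) else 0)"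
  by (induction ps) (auto simp: blinfun.add_left word_op_root)

text \<open>The real and imaginary parts of the \<open>N\<close> components at a node are \<open>2
  N\<close> real functions attached to the sphere of dimension \<open>2 N\<close> at this node.\<close>

lemma common_small_components:
  fixes ps :: "nat \<Rightarrow> (complex \<times> letter list) list"
  assumes L: "\<And>q. q < N \<Longrightarrow> \<forall>(c, u)\<in>set (ps q). length u \<le> L" and "0 < \<epsilon>"
  obtains \<rho> where "\<And>q y. \<lbrakk>q < N; y \<noteq> []; length y \<le> L\<rbrakk> \<Longrightarrow> cmod (component (ps q) y (sample (2 * N) \<rho>)) < \<epsilon>"
proof -
  let ?d = "2 * N"
  define S where "S = {y :: bool list. y \<noteq> [] \<and> length y \<le> L}"
  have "S \<subseteq> {y. set y \<subseteq> UNIV \<and> length y \<le> L}" by (auto simp: S_def)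
  then have fin: "finite S"
    using finite_lists_length_le[of "UNIV :: bool set" L] by (rule finite_subset) simp
  obtain zs0 where zs0: "set zs0 = S" "distinct zs0"
    using finite_distinct_list[OF fin] by blast
  \<comment> \<open>A proper suffix is shorter, so sorting by length puts ancestors first.\<close>
  define zs where "zs = sort_key length zs0"
  have zs: "set zs = S" "distinct zs" "sorted (map length zs)"
    using zs0 by (simp_all add: zs_def)
  \<comment> \<open>The functions \<open>2 q\<close> and \<open>2 q + 1\<close> are the real and imaginary parts for the polynomial \<open>q\<close>.\<close>
  define F where "F = (\<lambda>(y, k) x. (if even k then Re else Im) (component (ps (k div 2)) y x))"
  define C where "C = (\<Sum>q<N. \<Sum>(c, u)\<leftarrow>ps q. cmod c * real (length u))"
  have nonneg: "0 \<le> (\<Sum>(c, u)\<leftarrow>ps q. cmod c * real (length u))" for q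
    by (rule sum_list_nonneg) auto
  have C: "(\<Sum>(c, u)\<leftarrow>ps q. cmod c * real (length u)) \<le> C" if "q < N" for q
    unfolding C_def using that nonneg by (intro member_le_sum) auto
  have C0: "0 \<le> C"
    unfolding C_def using nonneg by (intro sum_nonneg) auto
  have odd: "F (y, k) (x(z := \<lambda>i. - x z i)) = (if z = y \<or> strict_suffix z y then - F (y, k) x else F (y, k) x)"
    if "z \<in> set zs" for x z y k
    using that zs(1) by (auto simp: F_def component_flip S_def strict_suffix_def)
  have lip: "\<bar>F (y, k) x - F (y, k) x'\<bar> \<le> C * (\<Sum>z\<in>set zs. \<Sum>i\<le>?d. \<bar>x z i - x' z i\<bar>)"
    if k: "k < ?d" and x: "\<And>z i. \<bar>x z i\<bar> \<le> 1" "\<And>z i. \<bar>x' z i\<bar> \<le> 1" and beyond: "\<And>z i. ?d < i \<Longrightarrow> x z i = x' z i"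
    for x x' y k
  proof -
    let ?\<Delta> = "\<Sum>z\<in>set zs. \<Sum>i\<le>?d. \<bar>x z i - x' z i\<bar>"
    have \<Delta>0: "0 \<le> ?\<Delta>" by (intro sum_nonneg) auto
    have \<Delta>: "\<bar>x z i - x' z i\<bar> \<le> ?\<Delta>" if z: "z \<noteq> []" "length z \<le> L" for z i
    proof (cases "i \<le> ?d")
      case True
      then have "\<bar>x z i - x' z i\<bar> \<le> (\<Sum>i\<le>?d. \<bar>x z i - x' z i\<bar>)"
        by (intro member_le_sum[where f = "\<lambda>i. \<bar>x z i - x' z i\<bar>"]) auto
      also have "\<dots> \<le> ?\<Delta>"
      proof (rule member_le_sum[where f = "\<lambda>z. \<Sum>i\<le>?d. \<bar>x z i - x' z i\<bar>"])
        show "z \<in> set zs" using z by (simp add: zs(1) S_def)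
      qed (simp_all add: sum_nonneg)
      finally show ?thesis .
    next
      case False
      then show ?thesis using beyond \<Delta>0 by simp
    qed
    have "k div 2 < N" using k by auto
    have "\<bar>F (y, k) x - F (y, k) x'\<bar> \<le> cmod (component (ps (k div 2)) y x - component (ps (k div 2)) y x')"
      using abs_Re_le_cmod[of "component (ps (k div 2)) y x - component (ps (k div 2)) y x'"]
        abs_Im_le_cmod[of "component (ps (k div 2)) y x - component (ps (k div 2)) y x'"]
      by (simp add: F_def)
    also have "\<dots> \<le> (\<Sum>(c, u)\<leftarrow>ps (k div 2). cmod c * real (length u)) * ?\<Delta>"
      by (rule component_lipschitz[OF x \<Delta> \<Delta>0 L[OF \<open>k div 2 < N\<close>]])
    also have "\<dots> \<le> C * ?\<Delta>"
      by (rule mult_right_mono[OF C[OF \<open>k div 2 < N\<close>] \<Delta>0])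
    finally show ?thesis .
  qed
  have order: "i < j" if "i < length zs" "j < length zs" "strict_suffix (zs ! i) (zs ! j)" for i j
  proof (rule ccontr)
    assume "\<not> i < j"
    then have "length (zs ! j) \<le> length (zs ! i)"
      using sorted_nth_mono[OF zs(3), of j i] that by simp
    moreover have "length (zs ! i) < length (zs ! j)"
      using that(3) by (auto simp: strict_suffix_def suffix_def)
    ultimately show False by simp
  qed
  obtain p w where small: "\<And>y k. \<lbrakk>y \<in> set zs; k < ?d\<rbrakk> \<Longrightarrow> \<bar>F (y, k) (sphere_point ?d p w)\<bar> < \<epsilon> / 2"
  proof (rule common_near_zero[where zs = zs and A = strict_suffix and d = ?d and F = F and C = C and \<epsilon> = "\<epsilon> / 2"])
    show "distinct zs" by (rule zs)
    show "0 \<le> C" by (rule C0)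
    show "0 < \<epsilon> / 2" using \<open>0 < \<epsilon>\<close> by simp
  qed (use order odd lip in blast)+
  obtain \<rho> where \<rho>: "\<And>z i. z \<in> S \<Longrightarrow> sample ?d \<rho> z i = sphere_point ?d p w z i"
    by (rule sample_dense[OF fin, of ?d p w]) blast
  show thesis
  proof (rule that)
    fix q and y :: "bool list"
    assume q: "q < N" and y: "y \<noteq> []" "length y \<le> L"
    let ?c = "component (ps q) y (sphere_point ?d p w)"
    have "cmod (component (ps q) y (sample ?d \<rho>) - ?c) \<le> (\<Sum>(c, u)\<leftarrow>ps q. cmod c * real (length u)) * 0"
      by (rule component_lipschitz[OF _ _ _ _ L[OF q]])
        (auto simp: \<rho> S_def, simp_all add: sample_def sphere_point_def polar_abs_le_1)
    then have "component (ps q) y (sample ?d \<rho>) = ?c" by simp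
    moreover have "\<bar>Re ?c\<bar> < \<epsilon> / 2" "\<bar>Im ?c\<bar> < \<epsilon> / 2"
      using small[of y "2 * q"] small[of y "2 * q + 1"] q y zs(1) by (simp_all add: F_def S_def)
    then have "cmod ?c < \<epsilon>"
      using cmod_le[of ?c] by linarith
    ultimately show "cmod (component (ps q) y (sample ?d \<rho>)) < \<epsilon>" by simp
  qed
qed

context tree_rep
begin

lemma poly_op_root_decomp:
  assumes L: "\<forall>(c, u)\<in>set ps. length u \<le> L"
  shows "norm (poly_op ps (ket (\<rho>, [])) - scale (component ps [] (X \<rho>)) (ket (\<rho>, []))) \<le>
    (\<Sum>y\<in>{y. y \<noteq> [] \<and> length y \<le> L}. cmod (component ps y (X \<rho>)))"
proof -
  let ?S = "{y :: bool list. y \<noteq> [] \<and> length y \<le> L}"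
  have "?S \<subseteq> {y. set y \<subseteq> UNIV \<and> length y \<le> L}" by auto
  then have fin: "finite ?S"
    using finite_lists_length_le[of "UNIV :: bool set" L] by (rule finite_subset) simp
  have "poly_op ps (ket (\<rho>, [])) - scale (component ps [] (X \<rho>)) (ket (\<rho>, [])) =
      (\<Sum>y\<in>?S. scale (component ps y (X \<rho>)) (ket (\<rho>, y)))"
  proof (rule ell2_eqI)
    fix j :: "'r \<times> bool list"
    obtain \<rho>' y where j: "j = (\<rho>', y)" by force
    have "coord (\<Sum>y\<in>?S. scale (component ps y (X \<rho>)) (ket (\<rho>, y))) j =
        (\<Sum>y'\<in>?S. if y' = y then (if \<rho>' = \<rho> then component ps y (X \<rho>) else 0) else 0)"
      unfolding coord_sum j by (rule sum.cong) auto
    also have "\<dots> = (if y \<in> ?S \<and> \<rho>' = \<rho> then component ps y (X \<rho>) else 0)"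
      using fin by simp
    also have "\<dots> = coord (poly_op ps (ket (\<rho>, [])) - scale (component ps [] (X \<rho>)) (ket (\<rho>, []))) j"
      unfolding j using component_zero[OF L, of y] by (auto simp: poly_op_root not_le)
    finally show "coord (poly_op ps (ket (\<rho>, [])) - scale (component ps [] (X \<rho>)) (ket (\<rho>, []))) j =
        coord (\<Sum>y\<in>?S. scale (component ps y (X \<rho>)) (ket (\<rho>, y))) j" by simp
  qed
  also have "norm \<dots> \<le> (\<Sum>y\<in>?S. norm (scale (component ps y (X \<rho>)) (ket (\<rho>, y))))"
    by (rule norm_sum)
  finally show ?thesis by (simp add: norm_scale)
qed

end

lemma approximate_joint_eigenvector:
  fixes N :: nat
  defines "Y \<equiv> sample (2 * N)"
  assumes T: "\<And>q. q < N \<Longrightarrow> T q \<in> tree_rep.alg Y" and "0 < \<epsilon>"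
  shows "\<exists>\<rho> \<mu>. \<forall>q<N. norm (T q (ket (\<rho>, [])) - scale (\<mu> q) (ket (\<rho>, []))) < \<epsilon>"
proof -
  interpret countable_tree_rep Y "2 * N"
    unfolding Y_def by (rule countable_tree_rep_sample)
  have "\<exists>ps. norm (T q - poly_op ps) < \<epsilon> / 2" if "q < N" for q
  proof -
    have "T q \<in> closure (range poly_op)"
      using T[OF that] by (simp only: alg_def)
    then obtain B where "B \<in> range poly_op" "dist B (T q) < \<epsilon> / 2"
      unfolding closure_approachable using \<open>0 < \<epsilon>\<close> by (meson half_gt_zero)
    then show ?thesis by (auto simp: dist_norm norm_minus_commute)
  qed
  then have "\<forall>q. \<exists>ps. q < N \<longrightarrow> norm (T q - poly_op ps) < \<epsilon> / 2" by blast
  then obtain ps where ps: "\<forall>q. q < N \<longrightarrow> norm (T q - poly_op (ps q)) < \<epsilon> / 2"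
    by (rule choice[THEN exE])
  define L where "L = (\<Sum>q<N. \<Sum>(c, u)\<leftarrow>ps q. length u)"
  have L: "\<forall>(c, u)\<in>set (ps q). length u \<le> L" if "q < N" for q
  proof clarify
    fix c u assume "(c, u) \<in> set (ps q)"
    then have "length u \<le> (\<Sum>(c, u)\<leftarrow>ps q. length u)"
      by (intro member_le_sum_list) (force, simp)
    also have "\<dots> \<le> L"
      unfolding L_def using that by (intro member_le_sum) auto
    finally show "length u \<le> L" .
  qed
  let ?S = "{y :: bool list. y \<noteq> [] \<and> length y \<le> L}"
  define \<delta> where "\<delta> = \<epsilon> / (2 * (real (card ?S) + 1))"
  have \<delta>: "0 < \<delta>" using \<open>0 < \<epsilon>\<close> by (simp add: \<delta>_def)
  obtain \<rho> where \<rho>: "\<And>q y. \<lbrakk>q < N; y \<noteq> []; length y \<le> L\<rbrakk> \<Longrightarrow> cmod (component (ps q) y (Y \<rho>)) < \<delta>"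
    unfolding Y_def by (rule common_small_components[OF L \<delta>]) blast+
  have "norm (T q (ket (\<rho>, [])) - scale (component (ps q) [] (Y \<rho>)) (ket (\<rho>, []))) < \<epsilon>" if q: "q < N" for q
  proof -
    let ?v = "ket (\<rho>, [] :: bool list)"
    have "norm (poly_op (ps q) ?v - scale (component (ps q) [] (Y \<rho>)) ?v) \<le> (\<Sum>y\<in>?S. cmod (component (ps q) y (Y \<rho>)))"
      by (rule poly_op_root_decomp[OF L[OF q]])
    also have "\<dots> \<le> (\<Sum>y\<in>?S. \<delta>)"
      using \<rho>[OF q] by (intro sum_mono) (simp add: less_imp_le)
    also have "\<dots> = real (card ?S) * \<delta>" by simp
    also have "\<dots> \<le> \<epsilon> / 2"
      using \<open>0 < \<epsilon>\<close> by (simp add: \<delta>_def field_simps)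
    finally have 1: "norm (poly_op (ps q) ?v - scale (component (ps q) [] (Y \<rho>)) ?v) \<le> \<epsilon> / 2" .
    have 2: "norm (T q ?v - poly_op (ps q) ?v) < \<epsilon> / 2"
      using norm_blinfun[of "T q - poly_op (ps q)" ?v] ps[rule_format, OF q] by (simp add: blinfun.diff_left)
    show ?thesis
      using norm_triangle_ineq[of "T q ?v - poly_op (ps q) ?v" "poly_op (ps q) ?v - scale (component (ps q) [] (Y \<rho>)) ?v"] 1 2
      by simp
  qed
  then show ?thesis by (intro exI[of _ \<rho>] exI[of _ "\<lambda>q. component (ps q) [] (Y \<rho>)"]) blast
qed

context countable_tree_rep
begin

definition word_value :: "(nat \<Rightarrow> ('r \<times> bool list) ell2 \<Rightarrow>\<^sub>L ('r \<times> bool list) ell2) \<Rightarrow> nat list \<Rightarrow> ('r \<times> bool list) ell2 \<Rightarrow>\<^sub>L ('r \<times> bool list) ell2"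
  where "word_value T w = foldr (\<lambda>i S. T i o\<^sub>L S) w id_blinfun"

lemma word_value_simps [simp]:
  "word_value T [] = id_blinfun" "word_value T (i # w) = T i o\<^sub>L word_value T w"
  by (simp_all add: word_value_def)

lemma word_eval_A:
  assumes "\<And>i. i \<in> set w \<Longrightarrow> a i = enc (T i) \<and> T i \<in> alg"
  shows "word_value T w \<in> alg \<and> word_eval \<A> a w = enc (word_value T w)"
  using assms
proof (induction w)
  case (Cons i w)
  then show ?case by (simp add: word_eval_def)
qed (simp add: word_eval_def A_one)

definition poly_value :: "ncpoly \<Rightarrow> (nat \<Rightarrow> ('r \<times> bool list) ell2 \<Rightarrow>\<^sub>L ('r \<times> bool list) ell2) \<Rightarrow> ('r \<times> bool list) ell2 \<Rightarrow>\<^sub>L ('r \<times> bool list) ell2"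
  where "poly_value f T = (\<Sum>w\<in>Poly_Mapping.keys f. scale (Poly_Mapping.lookup f w) o\<^sub>L word_value T w)"

lemma ncpoly_eval_A:
  assumes "f \<in> ncpolys n" and "\<And>i. i < n \<Longrightarrow> a i = enc (T i) \<and> T i \<in> alg"
  shows "poly_value f T \<in> alg \<and> ncpoly_eval \<A> f a = enc (poly_value f T)"
proof -
  have w: "word_value T w \<in> alg \<and> word_eval \<A> a w = enc (word_value T w)" if "w \<in> Poly_Mapping.keys f" for w
    using assms that by (intro word_eval_A) (auto simp: ncpolys_def)
  interpret abelian_group \<A> by (rule A_abelian_group)
  have "ncpoly_eval \<A> f a = (\<Oplus>\<^bsub>\<A>\<^esub>w\<in>Poly_Mapping.keys f. enc (scale (Poly_Mapping.lookup f w) o\<^sub>L word_value T w))"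
    unfolding ncpoly_eval_def using w by (intro finsum_cong') (auto simp: Pi_def)
  also have "\<dots> = enc (poly_value f T)"
    unfolding poly_value_def using w by (intro finsum_enc) auto
  finally show ?thesis
    using w by (auto simp: poly_value_def intro!: alg_sum)
qed

text \<open>The boundedness of the scalars is part of the induction, as the error at the next letter is
  multiplied by the value of the scalar word.\<close>

lemma word_value_limit:
  assumes T: "\<And>i. i \<in> set w \<Longrightarrow> T i \<in> alg"
    and lim: "\<And>i. i \<in> set w \<Longrightarrow> (\<lambda>m. T i (\<xi> m) - scale (\<mu> m i) (\<xi> m)) \<longlonglongrightarrow> 0"
    and bound: "\<And>i m. i \<in> set w \<Longrightarrow> cmod (\<mu> m i) \<le> M"
  shows "(\<lambda>m. word_value T w (\<xi> m) - scale (word_eval complex_alg (\<mu> m) w) (\<xi> m)) \<longlonglongrightarrow> 0 \<and>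
    (\<exists>B. \<forall>m. cmod (word_eval complex_alg (\<mu> m) w) \<le> B)"
  using assms
proof (induction w)
  case Nil
  have "scale 1 v = v" for v :: "('r \<times> bool list) ell2" by (rule ell2_eqI) simp
  then show ?case by (auto simp: word_eval_def complex_alg_def)
next
  case (Cons i w)
  let ?e = "\<lambda>m. word_eval complex_alg (\<mu> m) w"
  have e: "word_eval complex_alg (\<mu> m) (i # w) = \<mu> m i * ?e m" for m
    by (simp add: word_eval_def complex_alg_def)
  have IH: "(\<lambda>m. word_value T w (\<xi> m) - scale (?e m) (\<xi> m)) \<longlonglongrightarrow> 0"
    and "\<exists>B. \<forall>m. cmod (?e m) \<le> B"
    using Cons by auto
  then obtain B where B: "\<And>m. cmod (?e m) \<le> B" by auto
  have Ti: "T i (scale c v) = scale c (T i v)" for c v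
    using arg_cong[OF alg_commute[of "T i" c], of "\<lambda>S. S v"] Cons.prems(1) by simp
  have split: "word_value T (i # w) (\<xi> m) - scale (word_eval complex_alg (\<mu> m) (i # w)) (\<xi> m) =
      T i (word_value T w (\<xi> m) - scale (?e m) (\<xi> m)) + scale (?e m) (T i (\<xi> m) - scale (\<mu> m i) (\<xi> m))" for m
  proof -
    have "scale (\<mu> m i * ?e m) (\<xi> m) = scale (?e m) (scale (\<mu> m i) (\<xi> m))"
      by (rule ell2_eqI) simp
    then show ?thesis by (simp add: e Ti blinfun.diff_right)
  qed
  have "(\<lambda>m. T i (word_value T w (\<xi> m) - scale (?e m) (\<xi> m))) \<longlonglongrightarrow> T i 0"
    by (intro blinfun.tendsto tendsto_const IH)
  moreover have "(\<lambda>m. scale (?e m) (T i (\<xi> m) - scale (\<mu> m i) (\<xi> m))) \<longlonglongrightarrow> 0"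
  proof (rule Lim_null_comparison)
    show "\<forall>\<^sub>F m in sequentially. norm (scale (?e m) (T i (\<xi> m) - scale (\<mu> m i) (\<xi> m))) \<le> B * norm (T i (\<xi> m) - scale (\<mu> m i) (\<xi> m))"
      using B by (simp add: norm_scale mult_right_mono)
    have "(\<lambda>m. B * norm (T i (\<xi> m) - scale (\<mu> m i) (\<xi> m))) \<longlonglongrightarrow> B * norm (0 :: ('r \<times> bool list) ell2)"
      using Cons.prems(2) by (intro tendsto_intros) simp
    then show "(\<lambda>m. B * norm (T i (\<xi> m) - scale (\<mu> m i) (\<xi> m))) \<longlonglongrightarrow> 0" by simp
  qed
  ultimately have "(\<lambda>m. word_value T (i # w) (\<xi> m) - scale (word_eval complex_alg (\<mu> m) (i # w)) (\<xi> m)) \<longlonglongrightarrow> 0"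
    unfolding split using tendsto_add by fastforce
  moreover have "cmod (word_eval complex_alg (\<mu> m) (i # w)) \<le> M * B" for m
    unfolding e norm_mult using Cons.prems(3)[of i m] B[of m]
    by (intro mult_mono) (auto intro: order_trans[OF norm_ge_zero])
  ultimately show ?case by blast
qed

lemma complex_alg_finsum: "finite I \<Longrightarrow> finsum complex_alg g I = sum g I"
proof (induction I rule: finite_induct)
  case empty
  interpret cring complex_alg by (rule complex_alg_cring)
  show ?case unfolding finsum_empty by (simp add: complex_alg_def)
next
  case (insert i I)
  interpret cring complex_alg by (rule complex_alg_cring)
  have "finsum complex_alg g (insert i I) = g i \<oplus>\<^bsub>complex_alg\<^esub> finsum complex_alg g I"
    using insert by (intro finsum_insert) (auto simp: complex_alg_def)
  then show ?case using insert by (simp add: complex_alg_def)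
qed

text \<open>This is where the hypothesis on scalars enters: on approximate joint eigenvectors, the value
  of \<open>f\<close> is close to its value at the eigenvalues, which is \<open>0\<close>.\<close>

lemma poly_value_limit:
  assumes f: "f \<in> ncpolys n" and vanish: "ncpoly_values complex_alg n f = {0}"
    and T: "\<And>i. i < n \<Longrightarrow> T i \<in> alg"
    and lim: "\<And>i. i < n \<Longrightarrow> (\<lambda>m. T i (\<xi> m) - scale (\<mu> m i) (\<xi> m)) \<longlonglongrightarrow> 0"
    and bound: "\<And>i m. i < n \<Longrightarrow> cmod (\<mu> m i) \<le> M"
  shows "(\<lambda>m. poly_value f T (\<xi> m)) \<longlonglongrightarrow> 0"
proof -
  let ?c = "Poly_Mapping.lookup f" and ?e = "\<lambda>m. word_eval complex_alg (\<mu> m)"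
  have w: "(\<lambda>m. word_value T w (\<xi> m) - scale (?e m w) (\<xi> m)) \<longlonglongrightarrow> 0" if "w \<in> Poly_Mapping.keys f" for w
  proof -
    have "set w \<subseteq> {..<n}" using f that by (auto simp: ncpolys_def)
    then show ?thesis
      using T lim bound by (intro conjunct1[OF word_value_limit[where M = M]]) auto
  qed
  have zero: "(\<Sum>w\<in>Poly_Mapping.keys f. ?c w * ?e m w) = 0" for m
  proof -
    have "ncpoly_eval complex_alg f (\<mu> m) \<in> ncpoly_values complex_alg n f"
      unfolding ncpoly_values_def by (auto simp: complex_alg_def)
    then have "ncpoly_eval complex_alg f (\<mu> m) = 0" using vanish by simp
    then show ?thesis
      by (simp add: ncpoly_eval_def complex_alg_finsum) (simp add: complex_alg_def)
  qed
  have eq: "poly_value f T (\<xi> m) = (\<Sum>w\<in>Poly_Mapping.keys f. scale (?c w) (word_value T w (\<xi> m) - scale (?e m w) (\<xi> m)))" for m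
  proof -
    have "(\<Sum>w\<in>Poly_Mapping.keys f. scale (?c w) (scale (?e m w) (\<xi> m))) = 0"
      by (rule ell2_eqI) (simp add: coord_sum zero flip: mult.assoc sum_distrib_right)
    then show ?thesis
      by (simp add: poly_value_def blinfun.sum_left blinfun.diff_right sum_subtractf)
  qed
  have "(\<lambda>m. \<Sum>w\<in>Poly_Mapping.keys f. scale (?c w) (word_value T w (\<xi> m) - scale (?e m w) (\<xi> m))) \<longlonglongrightarrow>
      (\<Sum>w\<in>Poly_Mapping.keys f. scale (?c w) 0)"
    by (intro tendsto_sum blinfun.tendsto tendsto_const w)
  then show ?thesis unfolding eq by (simp add: blinfun.zero_right)
qed

end

theorem mainTheorem5:
  fixes f :: ncpoly and n K :: nat
  assumes "f \<in> ncpolys n"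
    and "ncpoly_values complex_alg n f = {0}"
  shows "\<exists>A :: ambient cstar. unital_cstar_algebra A \<and> (\<nexists>t. bounded_trace A t) \<and>
    (\<exists>e\<in>carrier A. \<not> (\<exists>c v. (\<forall>i<K. v i \<in> ncpoly_values A n f) \<and>
      e = (\<Oplus>\<^bsub>A\<^esub>i\<in>{..<K}. c i \<odot>\<^bsub>A\<^esub> v i)))"
proof -
  define N where "N = K * n"
  define Y where "Y = sample (2 * N)"
  interpret countable_tree_rep Y "2 * N"
    unfolding Y_def by (rule countable_tree_rep_sample)
  have no: False
    if v: "\<forall>j<K. v j \<in> ncpoly_values \<A> n f" and one: "\<one>\<^bsub>\<A>\<^esub> = (\<Oplus>\<^bsub>\<A>\<^esub>j\<in>{..<K}. c j \<odot>\<^bsub>\<A>\<^esub> v j)" for c v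
  proof -
    have "\<forall>j. \<exists>a. j < K \<longrightarrow> v j = ncpoly_eval \<A> f a \<and> (\<forall>i<n. a i \<in> carrier \<A>)"
      using v by (auto simp: ncpoly_values_def)
    then obtain a where a: "\<forall>j. j < K \<longrightarrow> v j = ncpoly_eval \<A> f (a j) \<and> (\<forall>i<n. a j i \<in> carrier \<A>)"
      by (rule choice[THEN exE])
    \<comment> \<open>The operator \<open>T j i\<close> with \<open>j < K\<close> and \<open>i < n\<close> gets the number \<open>j * n + i\<close>.\<close>
    define T where "T j i = decode (a j i)" for j i
    have T: "a j i = enc (T j i) \<and> T j i \<in> alg" if "j < K" "i < n" for j i
    proof -
      have "a j i \<in> carrier \<A>" using a that by blast
      then show ?thesis by (auto simp: T_def elim: carrierE)
    qed
    have val: "poly_value f (T j) \<in> alg \<and> v j = enc (poly_value f (T j))" if "j < K" for j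
      using ncpoly_eval_A[OF assms(1), of "a j" "T j"] T a that by auto
    have "\<one>\<^bsub>\<A>\<^esub> = (\<Oplus>\<^bsub>\<A>\<^esub>j\<in>{..<K}. enc (scale (c j) o\<^sub>L poly_value f (T j)))"
    proof -
      interpret abelian_group \<A> by (rule A_abelian_group)
      show ?thesis
        unfolding one using val by (intro finsum_cong') (auto simp: Pi_def)
    qed
    also have "\<dots> = enc (\<Sum>j<K. scale (c j) o\<^sub>L poly_value f (T j))"
      using val by (intro finsum_enc) auto
    finally have id: "id_blinfun = (\<Sum>j<K. scale (c j) o\<^sub>L poly_value f (T j))"
      by (simp add: A_one)
    have idx: "q div n < K \<and> q mod n < n" if "q < N" for q
      using that by (cases n) (auto simp: N_def less_mult_imp_div_less)
    have "\<exists>\<rho> \<mu>. \<forall>q<N. norm (T (q div n) (q mod n) (ket (\<rho>, [])) - scale (\<mu> q) (ket (\<rho>, []))) < inverse (real (Suc m))" for m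
      using approximate_joint_eigenvector[of N "\<lambda>q. T (q div n) (q mod n)" "inverse (real (Suc m))", folded Y_def] idx T by auto
    then obtain \<rho> where "\<forall>m. \<exists>\<mu>. \<forall>q<N. norm (T (q div n) (q mod n) (ket (\<rho> m, [])) - scale (\<mu> q) (ket (\<rho> m, []))) < inverse (real (Suc m))"
      using choice[of "\<lambda>m \<rho>. \<exists>\<mu>. \<forall>q<N. norm (T (q div n) (q mod n) (ket (\<rho>, [])) - scale (\<mu> q) (ket (\<rho>, []))) < inverse (real (Suc m))"] by blast
    then obtain \<mu> where \<mu>: "\<forall>m. \<forall>q<N. norm (T (q div n) (q mod n) (ket (\<rho> m, [])) - scale (\<mu> m q) (ket (\<rho> m, []))) < inverse (real (Suc m))"
      by (rule choice[THEN exE])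
    define \<xi> where "\<xi> m = ket (\<rho> m, [] :: bool list)" for m
    have near: "norm (T j i (\<xi> m) - scale (\<mu> m (j * n + i)) (\<xi> m)) < inverse (real (Suc m))" if "j < K" "i < n" for j i m
    proof -
      have "j * n + i < Suc j * n" using that by simp
      also have "\<dots> \<le> N" unfolding N_def using that by (intro mult_le_mono1) simp
      finally have "j * n + i < N" .
      then show ?thesis using \<mu>[rule_format, of "j * n + i" m] that by (simp add: \<xi>_def)
    qed
    have "(\<lambda>m. poly_value f (T j) (\<xi> m)) \<longlonglongrightarrow> 0" if j: "j < K" for j
    proof (rule poly_value_limit[OF assms, where \<mu> = "\<lambda>m i. \<mu> m (j * n + i)" and M = "1 + (\<Sum>i<n. norm (T j i))"])
      fix i
      assume i: "i < n"
      show "T j i \<in> alg" using T[OF j i] by simp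
      show "(\<lambda>m. T j i (\<xi> m) - scale (\<mu> m (j * n + i)) (\<xi> m)) \<longlonglongrightarrow> 0"
        using near[OF j i] by (intro Lim_null_comparison[OF _ LIMSEQ_inverse_real_of_nat]) (simp add: less_imp_le)
      fix m
      have "cmod (\<mu> m (j * n + i)) = norm (scale (\<mu> m (j * n + i)) (\<xi> m))"
        by (simp add: norm_scale \<xi>_def)
      also have "\<dots> \<le> norm (T j i (\<xi> m)) + norm (T j i (\<xi> m) - scale (\<mu> m (j * n + i)) (\<xi> m))"
        using norm_triangle_ineq4[of "T j i (\<xi> m)" "T j i (\<xi> m) - scale (\<mu> m (j * n + i)) (\<xi> m)"] by simp
      also have "\<dots> \<le> norm (T j i) + 1"
      proof (rule add_mono)
        show "norm (T j i (\<xi> m)) \<le> norm (T j i)"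
          using norm_blinfun[of "T j i" "\<xi> m"] by (simp add: \<xi>_def)
        have "inverse (real (Suc m)) \<le> 1" by (simp add: inverse_le_1_iff)
        then show "norm (T j i (\<xi> m) - scale (\<mu> m (j * n + i)) (\<xi> m)) \<le> 1"
          using near[OF j i, of m] by linarith
      qed
      also have "norm (T j i) \<le> (\<Sum>i<n. norm (T j i))"
        using i by (intro member_le_sum) auto
      finally show "cmod (\<mu> m (j * n + i)) \<le> 1 + (\<Sum>i<n. norm (T j i))" by simp
    qed
    then have "(\<lambda>m. \<Sum>j<K. scale (c j) (poly_value f (T j) (\<xi> m))) \<longlonglongrightarrow> (\<Sum>j<K. scale (c j) 0)"
      by (intro tendsto_sum blinfun.tendsto tendsto_const) simp
    moreover have "(\<Sum>j<K. scale (c j) (poly_value f (T j) (\<xi> m))) = \<xi> m" for m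
      using arg_cong[OF id, of "\<lambda>S. S (\<xi> m)"] by (simp add: blinfun.sum_left)
    ultimately have "\<xi> \<longlonglongrightarrow> 0" by (simp add: blinfun.zero_right)
    then have "(\<lambda>m. norm (\<xi> m)) \<longlonglongrightarrow> 0" by (rule tendsto_norm_zero)
    then show False by (simp add: \<xi>_def LIMSEQ_const_iff)
  qed
  have "\<one>\<^bsub>\<A>\<^esub> \<in> carrier \<A>" by (simp add: A_one)
  then show ?thesis
    using A_cstar no_trace no by blast
qed

end
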